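(* Let $f\in\Lambda_p$, $1<p<\infty$, $0<\alpha_i<\beta_i$, $\delta_i\in(0,\frac12)$, $i=1,2$. Then $$\omega_{\alpha_1,\alpha_2}(f,\delta_1,\delta_2)_{L_p(\mathbb{T}^2)}\asymp\delta_1^{\alpha_1}\delta_2^{\alpha_2}\Big\{\int_{\delta_1}^1\int_{\delta_2}^1\big[t_1^{-\alpha_1}t_2^{-\alpha_2}\omega_{\beta_1,\beta_2}(f,t_1,t_2)_{L_p(\mathbb{T}^2)}\big]^2\frac{dt_2}{t_2}\frac{dt_1}{t_1}\Big\}^{1/2}$$ (with $t_i\in(\delta_i,1)$).
   Context: $L_p(\mathbb{T}^2)$, $1<p<\infty$, is the space of measurable functions $f(x,y)$ that are $2\pi$-periodic in each variable with $\|f\|_{L_p(\mathbb{T}^2)}=\big(\int_0^{2\pi}\int_0^{2\pi}|f(x,y)|^p\,dx\,dy\big)^{1/p}<\infty$; $L_p^0(\mathbb{T}^2)$ is the set of $f\in L_p(\mathbb{T}^2)$ with $\int_0^{2\pi}f(x,y)\,dy=0$ for a.e. $x$ and $\int_0^{2\pi}f(x,y)\,dx=0$ for a.e. $y$. The class $\Lambda_p$, $1<p<\infty$, is the set of $f\in L_p^0(\mathbb{T}^2)$ whose Fourier series is $\sum_{\mu_1=0}^\infty\sum_{\mu_2=0}^\infty\lambda_{\mu_1,\mu_2}\cos2^{\mu_1}x\cos2^{\mu_2}y$ with $\lambda_{\mu_1,\mu_2}\in\mathbb{R}$. For $\alpha_1,\alpha_2>0$ the (fractional) differences are $\Delta_{h_1}^{\alpha_1}(f)=\sum_{\nu=0}^\infty(-1)^\nu\binom{\alpha_1}{\nu}f(x+(\alpha_1-\nu)h_1,y)$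 and $\Delta_{h_2}^{\alpha_2}(f)=\sum_{\nu=0}^\infty(-1)^\nu\binom{\alpha_2}{\nu}f(x,y+(\alpha_2-\nu)h_2)$, where $\binom{\alpha}{0}=1$, $\binom{\alpha}{\nu}=\frac{\alpha(\alpha-1)\cdots(\alpha-\nu+1)}{\nu!}$ for $\nu\ge1$. The mixed modulus of smoothness is $\omega_{\alpha_1,\alpha_2}(f,\delta_1,\delta_2)_{L_p(\mathbb{T}^2)}=\sup_{|h_i|\le\delta_i,\,i=1,2}\|\Delta_{h_1}^{\alpha_1}(\Delta_{h_2}^{\alpha_2}(f))\|_{L_p(\mathbb{T}^2)}$. $A\asymp B$ means $C^{-1}B\le A\le CB$ with a constant $C>0$ independent of $f,\delta_1,\delta_2$ ($C$ may depend on $p,\alpha_i,\beta_i$). *)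

theory Defs
  imports "HOL-Analysis.Analysis"
begin

abbreviation period_square :: "(real \<times> real) set" where
  "period_square \<equiv> {0..2*pi} \<times> {0..2*pi}"

definition Lp_norm :: "real \<Rightarrow> (real \<times> real \<Rightarrow> real) \<Rightarrow> real" where
  "Lp_norm p f = (LINT z:period_square|lebesgue. \<bar>f z\<bar> powr p) powr (1 / p)"

definition Lp_space :: "real \<Rightarrow> (real \<times> real \<Rightarrow> real) set" where
  "Lp_space p = {f. f \<in> borel_measurable lebesgue
      \<and> (\<forall>x y. f (x + 2*pi, y) = f (x, y) \<and> f (x, y + 2*pi) = f (x, y))
      \<and> set_integrable lebesgue period_square (\<lambda>z. \<bar>f z\<bar> powr p)}"

definition Lp0_space :: "real \<Rightarrow> (real \<times> real \<Rightarrow> real) set" where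
  "Lp0_space p = {f \<in> Lp_space p.
      (AE x in lebesgue. (LINT y:{0..2*pi}|lebesgue. f (x, y)) = 0)
      \<and> (AE y in lebesgue. (LINT x:{0..2*pi}|lebesgue. f (x, y)) = 0)}"

text \<open>
  Coefficient of \<open>u (m x) v (n y)\<close>, where each of \<open>u\<close>, \<open>v\<close> is \<open>cos\<close> or \<open>sin\<close>, in the double
  trigonometric Fourier series of \<open>f\<close>. The norming factor is halved for each zero frequency,
  because \<open>cos 0\<close> has squared norm \<open>2 pi\<close> instead of \<open>pi\<close>.
\<close>

definition fourier_coeff ::
    "(real \<Rightarrow> real) \<Rightarrow> (real \<Rightarrow> real) \<Rightarrow> (real \<times> real \<Rightarrow> real) \<Rightarrow> nat \<Rightarrow> nat \<Rightarrow> real" where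
  "fourier_coeff u v f m n =
     (if m = 0 then 1 / 2 else 1) * (if n = 0 then 1 / 2 else 1) / pi\<^sup>2
       * (LINT z:period_square|lebesgue. f z * u (real m * fst z) * v (real n * snd z))"

text \<open>
  The Fourier series of \<open>f\<close> is the formal series with terms
  \<open>lam i j * cos (2^i x) * cos (2^j y)\<close>; no convergence is involved.
\<close>

definition has_lacunary_fourier_series ::
    "(real \<times> real \<Rightarrow> real) \<Rightarrow> (nat \<Rightarrow> nat \<Rightarrow> real) \<Rightarrow> bool" where
  "has_lacunary_fourier_series f lam \<longleftrightarrow>
     (\<forall>i j. fourier_coeff cos cos f (2^i) (2^j) = lam i j)
     \<and> (\<forall>m n. (\<nexists>i j. m = 2^i \<and> n = 2^j) \<longrightarrow> fourier_coeff cos cos f m n = 0)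
     \<and> (\<forall>m n. fourier_coeff cos sin f m n = 0
            \<and> fourier_coeff sin cos f m n = 0
            \<and> fourier_coeff sin sin f m n = 0)"

definition Lambda_class :: "real \<Rightarrow> (real \<times> real \<Rightarrow> real) set" where
  "Lambda_class p = {f \<in> Lp0_space p. \<exists>lam. has_lacunary_fourier_series f lam}"

text \<open>
  The differences are pointwise series. For \<open>f\<close> in \<open>Lp_space p\<close> with \<open>p \<ge> 1\<close> and positive order
  they converge absolutely almost everywhere, since the binomial coefficients are absolutely
  summable; the value of \<open>suminf\<close> on the exceptional null set does not affect any norm.
\<close>

definition diff_x :: "real \<Rightarrow> real \<Rightarrow> (real \<times> real \<Rightarrow> real) \<Rightarrow> real \<times> real \<Rightarrow> real" where
  "diff_x \<alpha> h f = (\<lambda>(x, y). \<Sum>\<nu>. (-1)^\<nu> * (\<alpha> gchoose \<nu>) * f (x + (\<alpha> - real \<nu>) * h, y))"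

definition diff_y :: "real \<Rightarrow> real \<Rightarrow> (real \<times> real \<Rightarrow> real) \<Rightarrow> real \<times> real \<Rightarrow> real" where
  "diff_y \<alpha> h f = (\<lambda>(x, y). \<Sum>\<nu>. (-1)^\<nu> * (\<alpha> gchoose \<nu>) * f (x, y + (\<alpha> - real \<nu>) * h))"

text \<open>
  A supremum in the reals: for \<open>f\<close> in \<open>Lp_space p\<close> with \<open>p \<ge> 1\<close> and positive orders the norms
  are bounded by a multiple of \<open>Lp_norm p f\<close>.
\<close>

definition mixed_modulus ::
    "real \<Rightarrow> real \<Rightarrow> real \<Rightarrow> (real \<times> real \<Rightarrow> real) \<Rightarrow> real \<Rightarrow> real \<Rightarrow> real" where
  "mixed_modulus p \<alpha>\<^sub>1 \<alpha>\<^sub>2 f \<delta>\<^sub>1 \<delta>\<^sub>2 =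
     (SUP (h\<^sub>1, h\<^sub>2) \<in> {-\<delta>\<^sub>1..\<delta>\<^sub>1} \<times> {-\<delta>\<^sub>2..\<delta>\<^sub>2}. Lp_norm p (diff_x \<alpha>\<^sub>1 h\<^sub>1 (diff_y \<alpha>\<^sub>2 h\<^sub>2 f)))"

end

theory Submission
  imports Defs
begin

text \<open>
  For a lacunary sum \<open>g\<close> with terms \<open>c i j * cos (2 ^ i x + \<theta> i) * cos (2 ^ j y + \<phi> j)\<close>, all norms
  \<open>Lp_norm p g\<close> are comparable to the \<open>l\<^sup>2\<close> norm of \<open>c\<close>. The upper bound for even exponents holds
  because a number has boundedly many representations as a sum of \<open>k\<close> powers of two, and the lower
  bound follows by pairing \<open>g\<close> with itself. By duality, a function in \<open>Lambda_class p\<close> is the limit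
  in norm of the partial sums of its Fourier series. A difference of order \<open>\<alpha>\<close> with step \<open>h\<close> is
  bounded on the space and multiplies the coefficient of frequency \<open>2 ^ i\<close> by
  \<open>\<bar>2 sin (2 ^ i h / 2)\<bar> powr \<alpha>\<close>, up to a phase. Averaging over the steps, the squared modulus at
  \<open>(t\<^sub>1, t\<^sub>2)\<close> is comparable to the sum of
  \<open>lam i j ^ 2 * min 1 (2 ^ i t\<^sub>1) powr (2 \<alpha>\<^sub>1) * min 1 (2 ^ j t\<^sub>2) powr (2 \<alpha>\<^sub>2)\<close>. Integrating
  \<open>t powr (- 2 \<alpha> - 1) * min 1 (2 ^ i t) powr (2 \<beta>)\<close> over \<open>{\<delta><..<1}\<close> gives a multiple of
  \<open>\<delta> powr (- 2 \<alpha>) * min 1 (2 ^ i \<delta>) powr (2 \<alpha>)\<close> up to constants, which is the claim termwise.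
\<close>

subsection \<open>Translation invariance on the torus\<close>

text \<open>The Fourier series is formal, so \<open>f\<close> is accessible only through its
  coefficients. A trigonometric polynomial meets finitely many of them and cannot tell
  \<open>f\<close> from a long enough partial sum; duality turns this into an estimate of the error
  in norm. Phases are carried along because a fractional difference rotates every frequency by its
  own angle. The norm estimates are uniform in the phases, so only the moduli of the multipliers
  enter. The obstacle in bounding the modulus from below is that one step may annihilate many
  frequencies: for h = 2 pi / 2 ^ k all factors sin (2 ^ i h / 2) with i at least k vanish. A single
  pair of steps has to serve all frequencies at once; the averages supply it, in one variable after
  the other. Sums over all pairs (i, j) are never formed. They are replaced by sums over finite sets
  and by common upper bounds of these, and in the integral one finite set is fixed for all
  arguments, so that only finite sums are integrated.\<close>

definition doubly_periodic :: "(real \<times> real \<Rightarrow> 'a) \<Rightarrow> bool" where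
  "doubly_periodic u \<longleftrightarrow> (\<forall>x y. u (x + 2*pi, y) = u (x, y) \<and> u (x, y + 2*pi) = u (x, y))"

abbreviation T2 :: "(real \<times> real) measure" where
  "T2 \<equiv> lebesgue_on period_square"

lemma measurable_lebesgue_translation:
  "(\<lambda>z. z + a) \<in> lebesgue \<rightarrow>\<^sub>M (lebesgue :: 'a::euclidean_space measure)"
  using lebesgue_affine_measurable[of "\<lambda>_. 1" a]
  by (simp add: euclidean_representation add.commute)

lemma nn_integral_lebesgue_translation:
  fixes a :: "'a::euclidean_space"
  assumes [measurable]: "f \<in> borel_measurable lebesgue"
  shows "(\<integral>\<^sup>+z. f (z + a) \<partial>lebesgue) = (\<integral>\<^sup>+z. f z \<partial>lebesgue)"
proof -
  have [measurable]: "(\<lambda>z. a + z) \<in> lebesgue \<rightarrow>\<^sub>M lebesgue"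
    using measurable_lebesgue_translation[of a] by (simp add: add.commute)
  have "lebesgue = density (distr lebesgue lebesgue (\<lambda>z. a + z)) (\<lambda>_. 1)"
    using lebesgue_affine_euclidean[of "\<lambda>_. 1" a] by (simp add: euclidean_representation)
  then have "lebesgue = distr lebesgue lebesgue (\<lambda>z. a + z)"
    by (simp add: density_1)
  then have "(\<integral>\<^sup>+z. f z \<partial>lebesgue) = (\<integral>\<^sup>+z. f z \<partial>distr lebesgue lebesgue (\<lambda>z. a + z))"
    by simp
  also have "\<dots> = (\<integral>\<^sup>+z. f (a + z) \<partial>lebesgue)"
    by (rule nn_integral_distr) auto
  finally show ?thesis by (simp add: add.commute)
qed

text \<open>One direction at a time: \<open>l\<close> is the coordinate along \<open>e\<close>, and \<open>P\<close> constrains the others.\<close>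

lemma nn_integral_strip_translation:
  fixes u :: "'a::euclidean_space \<Rightarrow> ennreal" and l :: "'a \<Rightarrow> real"
  assumes u[measurable]: "u \<in> borel_measurable lebesgue"
    and l[measurable]: "l \<in> borel_measurable lebesgue" and P[measurable]: "Measurable.pred lebesgue P"
    and le: "\<And>z t. l (z + t *\<^sub>R e) = l z + t" and Pe: "\<And>z t. P (z + t *\<^sub>R e) = P z"
    and per: "\<And>z. u (z + c *\<^sub>R e) = u z" and c: "c > 0"
  shows "(\<integral>\<^sup>+z. u (z + a *\<^sub>R e) * indicator {z. 0 \<le> l z \<and> l z < c \<and> P z} z \<partial>lebesgue)
       = (\<integral>\<^sup>+z. u z * indicator {z. 0 \<le> l z \<and> l z < c \<and> P z} z \<partial>lebesgue)"
proof -
  have uint: "u (z + (a + c * of_int k) *\<^sub>R e) = u (z + a *\<^sub>R e)" for z a k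
  proof (induction k rule: int_induct[of _ 0])
    case base show ?case by simp
  next
    case (step1 i)
    have "z + (a + c * of_int (i + 1)) *\<^sub>R e = (z + (a + c * of_int i) *\<^sub>R e) + c *\<^sub>R e"
      by (simp add: algebra_simps)
    with step1 per show ?case by metis
  next
    case (step2 i)
    have "z + (a + c * of_int i) *\<^sub>R e = (z + (a + c * of_int (i - 1)) *\<^sub>R e) + c *\<^sub>R e"
      by (simp add: algebra_simps)
    with step2 per show ?case by metis
  qed
  define b where "b = a - c * of_int \<lfloor>a / c\<rfloor>"
  have b0: "0 \<le> b" and bc: "b < c"
  proof -
    have "of_int \<lfloor>a / c\<rfloor> \<le> a / c" "a / c < of_int \<lfloor>a / c\<rfloor> + 1" by linarith+
    then have "of_int \<lfloor>a / c\<rfloor> * c \<le> a" "a < (of_int \<lfloor>a / c\<rfloor> + 1) * c"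
      using c by (simp_all only: pos_le_divide_eq pos_divide_less_eq)
    then show "0 \<le> b" "b < c"
      unfolding b_def by (simp_all add: algebra_simps)
  qed
  have ab: "u (z + a *\<^sub>R e) = u (z + b *\<^sub>R e)" for z
    using uint[of z b "\<lfloor>a / c\<rfloor>"] by (simp add: b_def)
  let ?I = "\<lambda>s t. (\<lambda>z. u z * indicator {z. s \<le> l z \<and> l z < t \<and> P z} z)"
  have mI[measurable]: "?I s t \<in> borel_measurable lebesgue" for s t
    by measurable
  have shift: "(\<integral>\<^sup>+z. ?I s t (z + d *\<^sub>R e) \<partial>lebesgue) = (\<integral>\<^sup>+z. ?I s t z \<partial>lebesgue)" for s t d
    by (rule nn_integral_lebesgue_translation[OF mI])
  \<comment> \<open>Shifting by \<open>b\<close>, the remainder of \<open>a\<close> modulo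
    \<open>c\<close>, moves the strip [0, c) to [b, c + b); its overhang beyond \<open>c\<close> is
    brought back to [0, b) by one period.\<close>
  have "(\<integral>\<^sup>+z. u (z + a *\<^sub>R e) * indicator {z. 0 \<le> l z \<and> l z < c \<and> P z} z \<partial>lebesgue)
      = (\<integral>\<^sup>+z. ?I b (c + b) (z + b *\<^sub>R e) \<partial>lebesgue)"
    by (intro nn_integral_cong) (auto simp: ab le Pe indicator_def)
  also have "\<dots> = (\<integral>\<^sup>+z. ?I b (c + b) z \<partial>lebesgue)" by (rule shift)
  also have "\<dots> = (\<integral>\<^sup>+z. ?I b c z + ?I c (c + b) z \<partial>lebesgue)"
    by (intro nn_integral_cong) (use b0 bc in \<open>auto simp: indicator_def\<close>)
  also have "\<dots> = (\<integral>\<^sup>+z. ?I b c z \<partial>lebesgue) + (\<integral>\<^sup>+z. ?I c (c + b) z \<partial>lebesgue)"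
    by (rule nn_integral_add) auto
  also have "(\<integral>\<^sup>+z. ?I c (c + b) z \<partial>lebesgue) = (\<integral>\<^sup>+z. ?I c (c + b) (z + c *\<^sub>R e) \<partial>lebesgue)"
    by (rule shift[symmetric])
  also have "\<dots> = (\<integral>\<^sup>+z. ?I 0 b z \<partial>lebesgue)"
    by (intro nn_integral_cong) (auto simp: per le Pe indicator_def)
  also have "(\<integral>\<^sup>+z. ?I b c z \<partial>lebesgue) + (\<integral>\<^sup>+z. ?I 0 b z \<partial>lebesgue)
     = (\<integral>\<^sup>+z. ?I b c z + ?I 0 b z \<partial>lebesgue)"
    by (rule nn_integral_add[symmetric]) auto
  also have "\<dots> = (\<integral>\<^sup>+z. ?I 0 c z \<partial>lebesgue)"
    by (intro nn_integral_cong) (use b0 bc in \<open>auto simp: indicator_def\<close>)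
  finally show ?thesis .
qed

lemma period_square_lmeasurable: "period_square \<in> lmeasurable"
proof -
  have "period_square = cbox (0,0) (2*pi,2*pi)" by (auto simp: cbox_Pair_eq)
  then show ?thesis by simp
qed

lemma period_square_sets [measurable]: "period_square \<in> sets lebesgue"
  using period_square_lmeasurable by auto

lemma measure_period_square: "measure lebesgue period_square = 4 * pi\<^sup>2"
proof -
  have "period_square = cbox (0,0) (2*pi,2*pi)" by (auto simp: cbox_Pair_eq)
  then show ?thesis
    by (simp add: content_Pair power2_eq_square)
qed

lemma emeasure_period_square: "emeasure lebesgue period_square = 4 * pi\<^sup>2"
  using measure_period_square emeasure_eq_measure2[OF period_square_lmeasurable]
  by (simp add: emeasure_eq_measure2 fmeasurableD2)

text \<open>The closed square contains both members of each pair of identified edges, whereas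
  cutting and moving strips needs a fundamental domain without overlaps; the two sets differ by a
  null set.\<close>

lemma AE_half_open_square:
  "AE z in lebesgue. z \<in> period_square \<longleftrightarrow> 0 \<le> fst z \<and> fst z < 2*pi \<and> 0 \<le> snd z \<and> snd z < 2*pi"
proof -
  have "negligible {z::real\<times>real. (1,0) \<bullet> z = 2*pi}" "negligible {z::real\<times>real. (0,1) \<bullet> z = 2*pi}"
    by (rule negligible_hyperplane; simp)+
  then have "negligible ({z. fst z = 2*pi} \<union> {z::real\<times>real. snd z = 2*pi})"
    by (simp add: inner_prod_def)
  then have "AE z in lebesgue. z \<notin> {z. fst z = 2*pi} \<union> {z::real\<times>real. snd z = 2*pi}"
    by (intro AE_not_in) (simp add: negligible_iff_null_sets)
  then show ?thesis
    by eventually_elim (auto simp: mem_Times_iff)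
qed

lemma nn_integral_T2_translation:
  fixes u :: "real \<times> real \<Rightarrow> ennreal"
  assumes u[measurable]: "u \<in> borel_measurable lebesgue" and per: "doubly_periodic u"
  shows "(\<integral>\<^sup>+z. u (z + a) \<partial>T2) = (\<integral>\<^sup>+z. u z \<partial>T2)"
proof -
  let ?H = "{z::real\<times>real. 0 \<le> fst z \<and> fst z < 2*pi \<and> 0 \<le> snd z \<and> snd z < 2*pi}"
  have T2: "(\<integral>\<^sup>+z. v z \<partial>T2) = (\<integral>\<^sup>+z. v z * indicator ?H z \<partial>lebesgue)" for v
    by (subst nn_integral_restrict_space, simp, rule nn_integral_cong_AE,
        use AE_half_open_square in eventually_elim) (auto simp: indicator_def)
  have perx: "u (z + (2*pi) *\<^sub>R (1,0)) = u z" and pery: "u (z + (2*pi) *\<^sub>R (0,1)) = u z" for z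
    using per by (cases z; simp add: doubly_periodic_def)+
  have fst_meas: "fst \<in> borel_measurable (lebesgue :: (real\<times>real) measure)"
    and snd_meas: "snd \<in> borel_measurable (lebesgue :: (real\<times>real) measure)"
    by (intro measurable_completion; simp add: borel_measurable_continuous_onI continuous_on_fst continuous_on_snd continuous_on_id)+
  note [measurable] = fst_meas snd_meas
  have predx: "Measurable.pred lebesgue (\<lambda>z::real\<times>real. 0 \<le> snd z \<and> snd z < 2*pi)"
    and predy: "Measurable.pred lebesgue (\<lambda>z::real\<times>real. 0 \<le> fst z \<and> fst z < 2*pi)"
    by measurable
  \<comment> \<open>The vertical part of the shift is absorbed into \<open>u'\<close>, which allows
    the horizontal part to be removed first and the vertical one afterwards.\<close>
  define u' where "u' z = u (z + snd a *\<^sub>R (0,1))" for z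
  have u'[measurable]: "u' \<in> borel_measurable lebesgue"
    unfolding u'_def by (rule measurable_compose[OF measurable_lebesgue_translation u])
  have per': "u' (z + (2*pi) *\<^sub>R (1,0)) = u' z" for z
    using perx[of "z + snd a *\<^sub>R (0,1)"] by (simp add: u'_def algebra_simps)
  have Hy: "?H = {z. 0 \<le> snd z \<and> snd z < 2*pi \<and> (0 \<le> fst z \<and> fst z < 2*pi)}"
    by auto
  have a: "u (z + a) = u' (z + fst a *\<^sub>R (1,0))" for z
    by (cases z; cases a) (simp add: u'_def)
  have "(\<integral>\<^sup>+z. u (z + a) * indicator ?H z \<partial>lebesgue) = (\<integral>\<^sup>+z. u' z * indicator ?H z \<partial>lebesgue)"
    unfolding a
    by (rule nn_integral_strip_translation[OF u' fst_meas predx _ _ per']) auto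
  also have "\<dots> = (\<integral>\<^sup>+z. u z * indicator ?H z \<partial>lebesgue)"
    unfolding u'_def Hy
    by (rule nn_integral_strip_translation[OF u snd_meas predy _ _ pery]) auto
  finally show ?thesis by (simp add: T2)
qed

subsection \<open>Orthogonality and powers of lacunary exponential sums\<close>

lemma integrable_T2_continuous:
  fixes g :: "real \<times> real \<Rightarrow> 'a::euclidean_space"
  assumes "continuous_on UNIV g"
  shows "integrable T2 g"
proof -
  have sq: "cbox (0,0) (2*pi,2*pi) = period_square" by (auto simp: cbox_Pair_eq)
  have "g absolutely_integrable_on cbox (0,0) (2*pi,2*pi)"
    by (rule absolutely_integrable_continuous[OF continuous_on_subset[OF assms subset_UNIV]])
  then have "g absolutely_integrable_on period_square" unfolding sq .
  then show ?thesis
    unfolding set_integrable_def by (subst integrable_restrict_space) simp_all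
qed

lemma measure_T2: "measure T2 (space T2) = 4 * pi\<^sup>2"
  by (simp add: measure_restrict_space measure_period_square)

text \<open>A half-period shift changes the sign of the integrand.\<close>

lemma integral_T2_Re_cis:
  "(LINT z|T2. Re (w * cis (of_int m * fst z + of_int n * snd z)))
     = (if m = 0 \<and> n = 0 then 4 * pi\<^sup>2 * Re w else 0)"
proof (cases "m = 0 \<and> n = 0")
  case True
  then show ?thesis using measure_T2 by simp
next
  case False
  define u where "u z = Re (w * cis (of_int m * fst z + of_int n * snd z))" for z :: "real \<times> real"
  obtain a :: "real \<times> real" where a: "u (z + a) = - u z" for z
  proof (cases "m = 0")
    case True
    have "u (z + (0, pi / n)) = - u z" for z
      using False True unfolding u_def by (simp add: distrib_left cis_mult[symmetric])
    then show ?thesis using that by blast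
  next
    case m: False
    have "u (z + (pi / m, 0)) = - u z" for z
    proof -
      have "real_of_int m * (fst z + pi / real_of_int m) + real_of_int n * snd z
          = (real_of_int m * fst z + real_of_int n * snd z) + pi"
        using m by (simp add: field_simps)
      then show ?thesis unfolding u_def by (simp add: cis_mult[symmetric])
    qed
    then show ?thesis using that by blast
  qed
  have cont: "continuous_on UNIV u"
    unfolding u_def by (intro continuous_intros)
  have bound: "\<bar>u z\<bar> \<le> norm w" for z
    unfolding u_def using abs_Re_le_cmod[of "w * cis (of_int m * fst z + of_int n * snd z)"]
    by (simp add: norm_mult)
  have shift2pi: "cis (t + 2 * pi * of_int k) = cis t" for t k
    using cis_multiple_2pi[of k] by (simp add: cis_mult[symmetric])
  have per: "doubly_periodic u"
  proof -
    have "of_int m * (x + 2*pi) + of_int n * y = (of_int m * x + of_int n * y) + 2 * pi * of_int m"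
      "of_int m * x + of_int n * (y + 2*pi) = (of_int m * x + of_int n * y) + 2 * pi * of_int n" for x y :: real
      by (simp_all add: algebra_simps)
    then show ?thesis unfolding doubly_periodic_def u_def fst_conv snd_conv by (simp only: shift2pi simp_thms)
  qed
  \<comment> \<open>Translation invariance is available for nonnegative integrands; the constant
    \<open>norm w\<close> makes them so and cancels in the end.\<close>
  have conv: "(\<integral>\<^sup>+z. ennreal (norm w + v z) \<partial>T2) = ennreal (LINT z|T2. norm w + v z)"
    if "continuous_on UNIV v" "\<And>z. \<bar>v z\<bar> \<le> norm w" for v :: "real \<times> real \<Rightarrow> real"
  proof (rule nn_integral_eq_integral)
    show "integrable T2 (\<lambda>z. norm w + v z)"
      by (intro integrable_T2_continuous continuous_intros that)
    show "AE z in T2. 0 \<le> norm w + v z"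
      by (rule AE_I2) (use that(2) in \<open>smt (verit)\<close>)
  qed
  have "(\<integral>\<^sup>+z. ennreal (norm w + u (z + a)) \<partial>T2) = (\<integral>\<^sup>+z. ennreal (norm w + u z) \<partial>T2)"
  proof (rule nn_integral_T2_translation)
    have "(\<lambda>z. ennreal (norm w + u z)) \<in> borel_measurable borel"
      by (intro measurable_compose[OF _ measurable_ennreal] borel_measurable_continuous_onI continuous_intros cont)
    then show "(\<lambda>z. ennreal (norm w + u z)) \<in> borel_measurable lebesgue"
      by (intro measurable_completion) simp
    show "doubly_periodic (\<lambda>z. ennreal (norm w + u z))"
      using per by (simp add: doubly_periodic_def)
  qed
  then have "(\<integral>\<^sup>+z. ennreal (norm w + - u z) \<partial>T2) = (\<integral>\<^sup>+z. ennreal (norm w + u z) \<partial>T2)"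
    by (simp add: a)
  moreover have "(\<integral>\<^sup>+z. ennreal (norm w + - u z) \<partial>T2) = ennreal (LINT z|T2. norm w + - u z)"
    by (intro conv continuous_intros cont) (use bound in auto)
  moreover have "(\<integral>\<^sup>+z. ennreal (norm w + u z) \<partial>T2) = ennreal (LINT z|T2. norm w + u z)"
    by (intro conv continuous_intros cont bound)
  moreover have "0 \<le> (LINT z|T2. norm w + - u z)" "0 \<le> (LINT z|T2. norm w + u z)"
    by (intro integral_nonneg_AE AE_I2; use bound in \<open>smt (verit)\<close>)+
  ultimately have "(LINT z|T2. norm w + - u z) = (LINT z|T2. norm w + u z)"
    by simp
  moreover have "(LINT z|T2. norm w + - u z) = (LINT z|T2. norm w) + (LINT z|T2. - u z)"
    by (intro Bochner_Integration.integral_add integrable_T2_continuous continuous_intros cont)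
  moreover have "(LINT z|T2. norm w + u z) = (LINT z|T2. norm w) + (LINT z|T2. u z)"
    by (intro Bochner_Integration.integral_add integrable_T2_continuous continuous_intros cont)
  ultimately have "(LINT z|T2. u z) = 0" by simp
  then show ?thesis using False unfolding u_def by argo
qed

section \<open>Representations by sums of powers of two\<close>

primrec pow2_sums :: "nat \<Rightarrow> nat set" where
  "pow2_sums 0 = {0}"
| "pow2_sums (Suc k) = {m + 2 ^ i |m i. m \<in> pow2_sums k}"

text \<open>Take \<open>2 ^ j\<close> as the largest of the terms. Then \<open>m\<close> lies
  between \<open>2 ^ j\<close> and \<open>Suc k * 2 ^ j\<close>, which leaves few candidates for
  \<open>j\<close> once \<open>m\<close> is known.\<close>

lemma pow2_sums_largest_term:
  "m \<in> pow2_sums (Suc k) \<Longrightarrow> \<exists>j m'. m' \<in> pow2_sums k \<and> m = m' + 2 ^ j \<and> m \<le> Suc k * 2 ^ j"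
proof (induction k arbitrary: m)
  case 0
  then show ?case by auto
next
  case (Suc k)
  then obtain m1 i where m1: "m1 \<in> pow2_sums (Suc k)" "m = m1 + 2 ^ i" by auto
  from Suc.IH[OF m1(1)] obtain j m' where j: "m' \<in> pow2_sums k" "m1 = m' + 2 ^ j" "m1 \<le> Suc k * 2 ^ j"
    by blast
  show ?case
  proof (cases "j \<le> i")
    case True
    then have "(2::nat) ^ j \<le> 2 ^ i" by simp
    then have "Suc k * 2 ^ j \<le> Suc k * 2 ^ i" by (rule mult_le_mono2)
    with j(3) have "m \<le> Suc (Suc k) * 2 ^ i" unfolding m1(2) by simp
    with m1 show ?thesis by blast
  next
    case False
    then have "(2::nat) ^ i \<le> 2 ^ j" by (intro power_increasing) auto
    with j(3) have "m \<le> Suc (Suc k) * 2 ^ j" unfolding m1(2) mult_Suc by linarith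
    moreover have "m' + 2 ^ i \<in> pow2_sums (Suc k)" using j(1) by auto
    moreover have "m = (m' + 2 ^ i) + 2 ^ j" using m1(2) j(2) by simp
    ultimately show ?thesis by blast
  qed
qed

text \<open>Any two admissible powers differ at most by the factor \<open>k\<close>, so the
  exponents exceed the smallest one by some d with 2 ^ d at most \<open>k\<close>, in particular d <
  \<open>k\<close>.\<close>

lemma card_comparable_pow2:
  "finite {j. 2 ^ j \<le> N \<and> N \<le> k * 2 ^ j} \<and> card {j. 2 ^ j \<le> N \<and> N \<le> k * (2::nat) ^ j} \<le> k" (is "finite ?J \<and> _")
proof (cases "?J = {}")
  case True
  show ?thesis unfolding True by simp
next
  case False
  define j0 where "j0 = (LEAST j. j \<in> ?J)"
  from False obtain j1 where j1: "j1 \<in> ?J" by blast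
  have j0: "j0 \<in> ?J" unfolding j0_def by (rule LeastI[of "\<lambda>j. j \<in> ?J", OF j1])
  have "?J \<subseteq> {j0..<j0 + k}"
  proof
    fix j assume j: "j \<in> ?J"
    then have le: "j0 \<le> j" unfolding j0_def by (rule Least_le[of "\<lambda>j. j \<in> ?J"])
    have "2 ^ (j - j0) * 2 ^ j0 = (2::nat) ^ j" using le by (simp flip: power_add)
    also have "\<dots> \<le> k * 2 ^ j0" using j j0 by simp
    finally have "2 ^ (j - j0) \<le> k" by simp
    then have "j - j0 < k" using less_exp order_less_le_trans by blast
    then show "j \<in> {j0..<j0 + k}" using le by auto
  qed
  then show ?thesis using finite_subset card_mono[of "{j0..<j0 + k}" ?J] by auto
qed

text \<open>In N = m + 2 ^ i compare i with the exponent j of a dominant term of m. If j is at most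
  i, then 2 ^ i is comparable to N. Otherwise 2 ^ j is, and removing it leaves i as the last
  exponent of N - 2 ^ j in a sum with one term fewer, to which the induction hypothesis applies.
  Comparable powers are bounded in number, hence so are the choices of i.\<close>

lemma card_pow2_sums_last_term:
  "\<exists>B. \<forall>N. finite {i. \<exists>m\<in>pow2_sums k. N = m + 2 ^ i} \<and> card {i. \<exists>m\<in>pow2_sums k. N = m + 2 ^ i} \<le> B"
proof (induction k)
  case 0
  have "finite {i. N = (2::nat) ^ i} \<and> card {i. N = (2::nat) ^ i} \<le> 1" for N
  proof (cases "\<exists>i. N = 2 ^ i")
    case True
    then obtain i where "N = 2 ^ i" by blast
    then have "{i. N = (2::nat) ^ i} = {i}" by auto
    then show ?thesis by simp
  next
    case False
    then have "{i. N = (2::nat) ^ i} = {}" by auto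
    then show ?thesis by simp
  qed
  then show ?case by auto
next
  case (Suc k)
  define R where "R k N = {i. \<exists>m\<in>pow2_sums k. N = m + 2 ^ i}" for k N
  obtain B where B: "\<And>N. finite (R k N)" "\<And>N. card (R k N) \<le> B"
    using Suc unfolding R_def by blast
  define J where "J N = {j. 2 ^ j \<le> N \<and> N \<le> Suc (Suc k) * (2::nat) ^ j}" for N
  have J: "finite (J N)" "card (J N) \<le> Suc (Suc k)" for N
    unfolding J_def using card_comparable_pow2 by blast+
  have sub: "R (Suc k) N \<subseteq> J N \<union> (\<Union>j\<in>J N. R k (N - 2 ^ j))" for N
  proof
    fix i assume "i \<in> R (Suc k) N"
    then obtain m where m: "m \<in> pow2_sums (Suc k)" "N = m + 2 ^ i" unfolding R_def by blast
    from pow2_sums_largest_term[OF m(1)] obtain j m' where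
      j: "m' \<in> pow2_sums k" "m = m' + 2 ^ j" "m \<le> Suc k * 2 ^ j" by blast
    show "i \<in> J N \<union> (\<Union>j\<in>J N. R k (N - 2 ^ j))"
    proof (cases "j \<le> i")
      case True
      then have "(2::nat) ^ j \<le> 2 ^ i" by simp
      then have "Suc k * 2 ^ j \<le> Suc k * 2 ^ i" by (rule mult_le_mono2)
      with j(3) have "i \<in> J N" unfolding J_def m(2) by simp
      then show ?thesis by blast
    next
      case False
      then have "(2::nat) ^ i \<le> 2 ^ j" by (intro power_increasing) auto
      with j(3) have "N \<le> Suc (Suc k) * 2 ^ j" unfolding m(2) mult_Suc by linarith
      moreover have "2 ^ j \<le> N" unfolding m(2) j(2) by simp
      ultimately have "j \<in> J N" unfolding J_def by blast
      moreover have "i \<in> R k (N - 2 ^ j)" unfolding R_def using j m by auto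
      ultimately show ?thesis by blast
    qed
  qed
  have "finite (R (Suc k) N) \<and> card (R (Suc k) N) \<le> Suc (Suc k) + Suc (Suc k) * B" for N
  proof
    have fin: "finite (J N \<union> (\<Union>j\<in>J N. R k (N - 2 ^ j)))" using J B by auto
    then show "finite (R (Suc k) N)" using sub finite_subset by blast
    have "card (R (Suc k) N) \<le> card (J N \<union> (\<Union>j\<in>J N. R k (N - 2 ^ j)))"
      by (rule card_mono[OF fin sub])
    also have "\<dots> \<le> card (J N) + card (\<Union>j\<in>J N. R k (N - 2 ^ j))" by (rule card_Un_le)
    also have "card (\<Union>j\<in>J N. R k (N - 2 ^ j)) \<le> (\<Sum>j\<in>J N. card (R k (N - 2 ^ j)))"
      by (rule card_UN_le[OF J(1)])
    also have "\<dots> \<le> (\<Sum>j\<in>J N. B)" by (rule sum_mono) (rule B)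
    also have "\<dots> \<le> Suc (Suc k) * B" using mult_le_mono1[OF J(2)[of N], of B] by simp
    finally show "card (R (Suc k) N) \<le> Suc (Suc k) + Suc (Suc k) * B" using J(2)[of N] by linarith
  qed
  then show ?case unfolding R_def by blast
qed

text \<open>The sign of the second frequency is split off as \<open>\<sigma>\<close>. Thus
  frequencies remain pairs of natural numbers, to which the counting of sums of powers of two
  applies, while products of cosines, which need both signs, are covered by the values 1 and
  -1.\<close>

definition trig_exp :: "real \<Rightarrow> nat \<times> nat \<Rightarrow> real \<times> real \<Rightarrow> complex" where
  "trig_exp \<sigma> q z = cis (real (fst q) * fst z + \<sigma> * real (snd q) * snd z)"

lemma trig_exp_add: "trig_exp \<sigma> (q + r) z = trig_exp \<sigma> q z * trig_exp \<sigma> r z"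
  by (simp add: trig_exp_def cis_mult algebra_simps)

abbreviation pow2_pair :: "nat \<times> nat \<Rightarrow> nat \<times> nat" where
  "pow2_pair s \<equiv> (2 ^ fst s, 2 ^ snd s)"

text \<open>
  In the induction step the coefficient at \<open>r\<close> of the product is a sum over the pairs \<open>(s, q)\<close>
  with \<open>pow2_pair s + q = r\<close>. Their number is bounded independently of \<open>r\<close>, so by
  Cauchy-Schwarz the \<open>l\<^sup>2\<close> norm of the coefficients grows by a bounded factor only.
\<close>

lemma lacunary_power_expansion:
  "\<exists>B\<ge>0. \<forall>S c. finite S \<longrightarrow> (\<exists>A a. finite A \<and> A \<subseteq> pow2_sums k \<times> pow2_sums k
     \<and> (\<forall>z. (\<Sum>s\<in>S. c s * trig_exp \<sigma> (pow2_pair s) z) ^ k = (\<Sum>q\<in>A. a q * trig_exp \<sigma> q z))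
     \<and> (\<Sum>q\<in>A. (norm (a q))\<^sup>2) \<le> B * (\<Sum>s\<in>S. (norm (c s))\<^sup>2) ^ k)"
proof (induction k)
  case 0
  show ?case
  proof (rule exI[of _ 1], intro conjI allI impI)
    fix S :: "(nat \<times> nat) set" and c :: "nat \<times> nat \<Rightarrow> complex"
    show "\<exists>A a. finite A \<and> A \<subseteq> pow2_sums 0 \<times> pow2_sums 0
     \<and> (\<forall>z. (\<Sum>s\<in>S. c s * trig_exp \<sigma> (pow2_pair s) z) ^ 0 = (\<Sum>q\<in>A. a q * trig_exp \<sigma> q z))
     \<and> (\<Sum>q\<in>A. (norm (a q))\<^sup>2) \<le> 1 * (\<Sum>s\<in>S. (norm (c s))\<^sup>2) ^ 0"
      by (rule exI[of _ "{(0,0)}"], rule exI[of _ "\<lambda>_. 1"]) (simp add: trig_exp_def)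
  qed simp
next
  case (Suc k)
  then obtain B where B: "B \<ge> 0" and IH: "\<And>S c. finite S \<Longrightarrow> \<exists>A a. finite A \<and> A \<subseteq> pow2_sums k \<times> pow2_sums k
     \<and> (\<forall>z. (\<Sum>s\<in>S. c s * trig_exp \<sigma> (pow2_pair s) z) ^ k = (\<Sum>q\<in>A. a q * trig_exp \<sigma> q z))
     \<and> (\<Sum>q\<in>A. (norm (a q))\<^sup>2) \<le> B * (\<Sum>s\<in>S. (norm (c s))\<^sup>2) ^ k" by blast
  define R where "R N = {i. \<exists>m\<in>pow2_sums k. N = m + 2 ^ i}" for N
  obtain D where D: "\<And>N. finite (R N)" "\<And>N. card (R N) \<le> D"
    using card_pow2_sums_last_term[of k] unfolding R_def by blast
  show ?case
  proof (rule exI[of _ "real (D * D) * B"], intro conjI allI impI)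
    show "0 \<le> real (D * D) * B" using B by simp
    fix S :: "(nat \<times> nat) set" and c :: "nat \<times> nat \<Rightarrow> complex" assume S: "finite S"
    from IH[OF S, of c] obtain A a where A: "finite A" "A \<subseteq> pow2_sums k \<times> pow2_sums k"
      and pk: "\<And>z. (\<Sum>s\<in>S. c s * trig_exp \<sigma> (pow2_pair s) z) ^ k = (\<Sum>q\<in>A. a q * trig_exp \<sigma> q z)"
      and l2: "(\<Sum>q\<in>A. (norm (a q))\<^sup>2) \<le> B * (\<Sum>s\<in>S. (norm (c s))\<^sup>2) ^ k" by blast
    define g where "g x = pow2_pair (fst x) + snd x" for x :: "(nat \<times> nat) \<times> (nat \<times> nat)"
    define f where "f x = c (fst x) * a (snd x)" for x :: "(nat \<times> nat) \<times> (nat \<times> nat)"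
    define A' where "A' = g ` (S \<times> A)"
    define F where "F r = {x \<in> S \<times> A. g x = r}" for r
    define a' where "a' r = sum f (F r)" for r
    have fin: "finite (S \<times> A)" using S A by simp
    have finF: "finite (F r)" for r unfolding F_def using fin by simp
    have cardF: "card (F r) \<le> D * D" for r
    proof -
      \<comment> \<open>Over a fixed \<open>r\<close> the second component is \<open>r\<close> minus
        the frequency of the first, so it suffices to count \<open>s\<close>; each of its two
        coordinates is a last exponent and has at most \<open>D\<close> values.\<close>
      have inj: "inj_on fst (F r)"
        by (auto simp: inj_on_def F_def g_def)
      have sub: "fst ` F r \<subseteq> R (fst r) \<times> R (snd r)"
        using A(2) by (fastforce simp: F_def R_def g_def)
      have "card (F r) = card (fst ` F r)" using inj by (simp add: card_image)
      also have "\<dots> \<le> card (R (fst r) \<times> R (snd r))"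
        by (rule card_mono[OF _ sub]) (simp add: D)
      also have "\<dots> \<le> D * D" by (simp add: card_cartesian_product mult_le_mono D)
      finally show ?thesis .
    qed
    show "\<exists>A a. finite A \<and> A \<subseteq> pow2_sums (Suc k) \<times> pow2_sums (Suc k)
     \<and> (\<forall>z. (\<Sum>s\<in>S. c s * trig_exp \<sigma> (pow2_pair s) z) ^ Suc k = (\<Sum>q\<in>A. a q * trig_exp \<sigma> q z))
     \<and> (\<Sum>q\<in>A. (norm (a q))\<^sup>2) \<le> real (D * D) * B * (\<Sum>s\<in>S. (norm (c s))\<^sup>2) ^ Suc k"
    proof (rule exI[of _ A'], rule exI[of _ a'], intro conjI allI)
      show "finite A'" unfolding A'_def using fin by simp
      show "A' \<subseteq> pow2_sums (Suc k) \<times> pow2_sums (Suc k)"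
        unfolding A'_def g_def using A(2) by (fastforce simp: add.commute)
      fix z
      have "(\<Sum>s\<in>S. c s * trig_exp \<sigma> (pow2_pair s) z) ^ Suc k
          = (\<Sum>s\<in>S. c s * trig_exp \<sigma> (pow2_pair s) z) * (\<Sum>q\<in>A. a q * trig_exp \<sigma> q z)"
        by (simp add: pk)
      also have "\<dots> = (\<Sum>x\<in>S \<times> A. f x * trig_exp \<sigma> (g x) z)"
        unfolding sum_product sum.cartesian_product f_def g_def trig_exp_add case_prod_unfold
        by (intro sum.cong refl) (simp add: mult_ac)
      also have "\<dots> = (\<Sum>r\<in>A'. \<Sum>x\<in>F r. f x * trig_exp \<sigma> (g x) z)"
        unfolding A'_def F_def by (rule sum.image_gen[OF fin])
      also have "\<dots> = (\<Sum>r\<in>A'. a' r * trig_exp \<sigma> r z)"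
        unfolding a'_def sum_distrib_right by (intro sum.cong refl) (simp add: F_def)
      finally show "(\<Sum>s\<in>S. c s * trig_exp \<sigma> (pow2_pair s) z) ^ Suc k = (\<Sum>r\<in>A'. a' r * trig_exp \<sigma> r z)" .
    next
      have a'le: "(norm (a' r))\<^sup>2 \<le> real (D * D) * (\<Sum>x\<in>F r. (norm (f x))\<^sup>2)" for r
      proof -
        have "(norm (a' r))\<^sup>2 \<le> (\<Sum>x\<in>F r. norm (f x))\<^sup>2"
          unfolding a'_def by (intro power_mono norm_sum norm_ge_zero)
        also have "\<dots> \<le> real (card (F r)) * (\<Sum>x\<in>F r. (norm (f x))\<^sup>2)"
          using sum_squared_le_sum_of_squares[of "\<lambda>x. norm (f x)" "F r"] by (simp add: mult.commute)
        also have "\<dots> \<le> real (D * D) * (\<Sum>x\<in>F r. (norm (f x))\<^sup>2)"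
          by (intro mult_right_mono of_nat_mono cardF sum_nonneg) auto
        finally show ?thesis .
      qed
      have "(\<Sum>r\<in>A'. (norm (a' r))\<^sup>2) \<le> (\<Sum>r\<in>A'. real (D * D) * (\<Sum>x\<in>F r. (norm (f x))\<^sup>2))"
        by (rule sum_mono) (rule a'le)
      also have "\<dots> = real (D * D) * (\<Sum>x\<in>S \<times> A. (norm (f x))\<^sup>2)"
        unfolding sum_distrib_left[symmetric] A'_def F_def by (simp add: sum.image_gen[OF fin, symmetric])
      also have "(\<Sum>x\<in>S \<times> A. (norm (f x))\<^sup>2) = (\<Sum>s\<in>S. (norm (c s))\<^sup>2) * (\<Sum>q\<in>A. (norm (a q))\<^sup>2)"
        by (simp add: sum_product sum.cartesian_product f_def case_prod_unfold norm_mult power_mult_distrib)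
      also have "real (D * D) * \<dots> \<le> real (D * D) * ((\<Sum>s\<in>S. (norm (c s))\<^sup>2) * (B * (\<Sum>s\<in>S. (norm (c s))\<^sup>2) ^ k))"
        by (intro mult_left_mono l2 sum_nonneg) auto
      also have "\<dots> = real (D * D) * B * (\<Sum>s\<in>S. (norm (c s))\<^sup>2) ^ Suc k"
        by (simp add: mult_ac)
      finally show "(\<Sum>r\<in>A'. (norm (a' r))\<^sup>2) \<le> real (D * D) * B * (\<Sum>s\<in>S. (norm (c s))\<^sup>2) ^ Suc k" .
    qed
  qed
qed

subsection \<open>Norms of lacunary cosine polynomials\<close>

lemma continuous_on_trig_exp [continuous_intros]: "continuous_on A (trig_exp \<sigma> q)"
  unfolding trig_exp_def by (intro continuous_intros)

text \<open>Parseval's identity; \<open>s \<noteq> 0\<close> keeps the frequencies of distinct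
  indices distinct.\<close>

lemma integral_T2_norm_trig_poly:
  assumes A: "finite A" and s: "s \<noteq> 0"
  shows "(LINT z|T2. (norm (\<Sum>q\<in>A. a q * trig_exp (of_int s) q z))\<^sup>2) = 4 * pi\<^sup>2 * (\<Sum>q\<in>A. (norm (a q))\<^sup>2)"
proof -
  define m where "m q r = int (fst q) - int (fst r)" for q r :: "nat \<times> nat"
  define n where "n q r = s * (int (snd q) - int (snd r))" for q r :: "nat \<times> nat"
  define f where "f q r z = Re (a q * cnj (a r) * cis (of_int (m q r) * fst z + of_int (n q r) * snd z))"
    for q r and z :: "real \<times> real"
  have cont: "continuous_on UNIV (f q r)" for q r
    unfolding f_def by (intro continuous_intros)
  have e: "trig_exp (of_int s) q z * cnj (trig_exp (of_int s) r z)
      = cis (of_int (m q r) * fst z + of_int (n q r) * snd z)" for q r z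
    by (simp add: trig_exp_def cis_cnj cis_mult m_def n_def algebra_simps)
  have "(norm (\<Sum>q\<in>A. a q * trig_exp (of_int s) q z))\<^sup>2 = (\<Sum>q\<in>A. \<Sum>r\<in>A. f q r z)" for z
  proof -
    have "complex_of_real ((norm (\<Sum>q\<in>A. a q * trig_exp (of_int s) q z))\<^sup>2)
       = (\<Sum>q\<in>A. \<Sum>r\<in>A. a q * cnj (a r) * (trig_exp (of_int s) q z * cnj (trig_exp (of_int s) r z)))"
      unfolding complex_norm_square sum_product cnj_sum complex_cnj_mult
      by (intro sum.cong refl) (simp only: mult_ac)
    then have "(norm (\<Sum>q\<in>A. a q * trig_exp (of_int s) q z))\<^sup>2
       = Re (\<Sum>q\<in>A. \<Sum>r\<in>A. a q * cnj (a r) * (trig_exp (of_int s) q z * cnj (trig_exp (of_int s) r z)))"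
      by (metis Re_complex_of_real)
    then show ?thesis unfolding e Re_sum f_def .
  qed
  then have "(LINT z|T2. (norm (\<Sum>q\<in>A. a q * trig_exp (of_int s) q z))\<^sup>2) = (LINT z|T2. (\<Sum>q\<in>A. \<Sum>r\<in>A. f q r z))"
    by simp
  also have "\<dots> = (\<Sum>q\<in>A. \<Sum>r\<in>A. LINT z|T2. f q r z)"
    by (simp add: Bochner_Integration.integral_sum integrable_T2_continuous cont)
  also have "\<dots> = (\<Sum>q\<in>A. \<Sum>r\<in>A. if q = r then 4 * pi\<^sup>2 * (norm (a q))\<^sup>2 else 0)"
  proof (intro sum.cong refl)
    fix q r
    have "m q r = 0 \<and> n q r = 0 \<longleftrightarrow> q = r"
      using s by (cases q; cases r) (auto simp: m_def n_def)
    moreover have "Re (a q * cnj (a q)) = (norm (a q))\<^sup>2"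
      by (metis Re_complex_of_real complex_norm_square)
    ultimately show "(LINT z|T2. f q r z) = (if q = r then 4 * pi\<^sup>2 * (norm (a q))\<^sup>2 else 0)"
      unfolding f_def integral_T2_Re_cis by auto
  qed
  also have "\<dots> = 4 * pi\<^sup>2 * (\<Sum>q\<in>A. (norm (a q))\<^sup>2)"
    using A by (simp add: sum.delta' sum_distrib_left)
  finally show ?thesis .
qed

text \<open>The modulus to the power \<open>2 * k\<close> is the squared modulus of the
  \<open>k\<close>-th power, so Parseval's identity applies to the expansion of that power.\<close>

lemma lacunary_exp_power_bound:
  assumes s: "s \<noteq> 0"
  shows "\<exists>B\<ge>0. \<forall>S c. finite S \<longrightarrow>
    (LINT z|T2. (norm (\<Sum>q\<in>S. c q * trig_exp (of_int s) (pow2_pair q) z)) ^ (2 * k))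
      \<le> B * (\<Sum>q\<in>S. (norm (c q))\<^sup>2) ^ k"
proof -
  obtain B where B: "B \<ge> 0" and exp: "\<And>S c. finite S \<Longrightarrow> \<exists>A a. finite A \<and> A \<subseteq> pow2_sums k \<times> pow2_sums k
     \<and> (\<forall>z. (\<Sum>q\<in>S. c q * trig_exp (of_int s) (pow2_pair q) z) ^ k = (\<Sum>q\<in>A. a q * trig_exp (of_int s) q z))
     \<and> (\<Sum>q\<in>A. (norm (a q))\<^sup>2) \<le> B * (\<Sum>q\<in>S. (norm (c q))\<^sup>2) ^ k"
    using lacunary_power_expansion[of k "of_int s"] by blast
  show ?thesis
  proof (rule exI[of _ "4 * pi\<^sup>2 * B"], intro conjI allI impI)
    show "0 \<le> 4 * pi\<^sup>2 * B" using B by simp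
    fix S :: "(nat \<times> nat) set" and c :: "nat \<times> nat \<Rightarrow> complex" assume S: "finite S"
    obtain A a where A: "finite A"
      and pk: "\<And>z. (\<Sum>q\<in>S. c q * trig_exp (of_int s) (pow2_pair q) z) ^ k = (\<Sum>q\<in>A. a q * trig_exp (of_int s) q z)"
      and l2: "(\<Sum>q\<in>A. (norm (a q))\<^sup>2) \<le> B * (\<Sum>q\<in>S. (norm (c q))\<^sup>2) ^ k"
      using exp[OF S, of c] by blast
    have "(LINT z|T2. (norm (\<Sum>q\<in>S. c q * trig_exp (of_int s) (pow2_pair q) z)) ^ (2 * k))
        = (LINT z|T2. (norm (\<Sum>q\<in>A. a q * trig_exp (of_int s) q z))\<^sup>2)"
      by (simp add: pk[symmetric] norm_power power_mult[symmetric] mult.commute)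
    also have "\<dots> = 4 * pi\<^sup>2 * (\<Sum>q\<in>A. (norm (a q))\<^sup>2)"
      by (rule integral_T2_norm_trig_poly[OF A s])
    also have "\<dots> \<le> 4 * pi\<^sup>2 * (B * (\<Sum>q\<in>S. (norm (c q))\<^sup>2) ^ k)"
      by (intro mult_left_mono l2) auto
    finally show "(LINT z|T2. (norm (\<Sum>q\<in>S. c q * trig_exp (of_int s) (pow2_pair q) z)) ^ (2 * k))
        \<le> 4 * pi\<^sup>2 * B * (\<Sum>q\<in>S. (norm (c q))\<^sup>2) ^ k" by (simp add: mult.assoc)
  qed
qed

text \<open>The phases depend on the frequency in one variable only, which is exactly what a
  fractional difference produces. Allowing them makes this class closed under differences in both
  variables.\<close>

definition lac_poly ::
    "(nat \<times> nat \<Rightarrow> real) \<Rightarrow> (nat \<Rightarrow> real) \<Rightarrow> (nat \<Rightarrow> real) \<Rightarrow> (nat \<times> nat) set \<Rightarrow> real \<times> real \<Rightarrow> real" where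
  "lac_poly c \<theta> \<phi> S z = (\<Sum>(i, j)\<in>S. c (i, j) * (cos (2 ^ i * fst z + \<theta> i) * cos (2 ^ j * snd z + \<phi> j)))"

lemma continuous_on_lac_poly [continuous_intros]: "continuous_on A (lac_poly c \<theta> \<phi> S)"
  unfolding lac_poly_def case_prod_unfold by (intro continuous_intros)

text \<open>cos P cos Q is the mean of the real parts of cis (P + Q) and cis (P - Q). This splits
  the sum into two exponential sums, one for each sign of the second frequency, whose coefficients
  have modulus \<open>\<bar>c s\<bar>\<close> whatever the phases are.\<close>

lemma lac_poly_power_bound:
  "\<exists>B\<ge>0. \<forall>S c \<theta> \<phi>. finite S \<longrightarrow>
    (LINT z|T2. \<bar>lac_poly c \<theta> \<phi> S z\<bar> ^ (2 * k)) \<le> B * (\<Sum>s\<in>S. (c s)\<^sup>2) ^ k"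
proof -
  define F where "F s c \<theta> \<phi> S z = (\<Sum>q\<in>S. (of_real (c q) * cis (\<theta> (fst q) + of_int s * \<phi> (snd q))) *
      trig_exp (of_int s) (pow2_pair q) z)" for s c \<theta> \<phi> S z
  have nF: "\<exists>B\<ge>0. \<forall>S c \<theta> \<phi>. finite S \<longrightarrow> (LINT z|T2. (norm (F s c \<theta> \<phi> S z)) ^ (2 * k)) \<le> B * (\<Sum>q\<in>S. (c q)\<^sup>2) ^ k"
    if "s \<noteq> 0" for s
  proof -
    from lacunary_exp_power_bound[OF that, of k] obtain B where "B \<ge> 0" and
      B: "\<And>S c. finite S \<Longrightarrow> (LINT z|T2. (norm (\<Sum>q\<in>S. c q * trig_exp (of_int s) (pow2_pair q) z)) ^ (2 * k))
      \<le> B * (\<Sum>q\<in>S. (norm (c q))\<^sup>2) ^ k" by blast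
    have "(LINT z|T2. (norm (F s c \<theta> \<phi> S z)) ^ (2 * k)) \<le> B * (\<Sum>q\<in>S. (c q)\<^sup>2) ^ k" if "finite S" for S c \<theta> \<phi>
      using B[OF that, of "\<lambda>q. of_real (c q) * cis (\<theta> (fst q) + of_int s * \<phi> (snd q))"]
      unfolding F_def by (simp add: norm_mult)
    with \<open>B \<ge> 0\<close> show ?thesis by blast
  qed
  obtain B1 where B1: "B1 \<ge> 0" "\<And>S c \<theta> \<phi>. finite S \<Longrightarrow> (LINT z|T2. (norm (F 1 c \<theta> \<phi> S z)) ^ (2 * k)) \<le> B1 * (\<Sum>q\<in>S. (c q)\<^sup>2) ^ k"
    using nF[of 1] by auto
  obtain B2 where B2: "B2 \<ge> 0" "\<And>S c \<theta> \<phi>. finite S \<Longrightarrow> (LINT z|T2. (norm (F (-1) c \<theta> \<phi> S z)) ^ (2 * k)) \<le> B2 * (\<Sum>q\<in>S. (c q)\<^sup>2) ^ k"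
    using nF[of "-1"] by auto
  have contF: "continuous_on UNIV (F s c \<theta> \<phi> S)" for s c \<theta> \<phi> S
    unfolding F_def by (intro continuous_intros)
  have lac: "lac_poly c \<theta> \<phi> S z = (Re (F 1 c \<theta> \<phi> S z) + Re (F (-1) c \<theta> \<phi> S z)) / 2" for c \<theta> \<phi> S z
  proof -
    have "c q * (cos (2 ^ fst q * fst z + \<theta> (fst q)) * cos (2 ^ snd q * snd z + \<phi> (snd q)))
       = (Re ((of_real (c q) * cis (\<theta> (fst q) + of_int 1 * \<phi> (snd q))) * trig_exp (of_int 1) (pow2_pair q) z)
       + Re ((of_real (c q) * cis (\<theta> (fst q) + of_int (-1) * \<phi> (snd q))) * trig_exp (of_int (-1)) (pow2_pair q) z)) / 2" for q
    proof -
      have 1: "(of_real (c q) * cis (\<theta> (fst q) + of_int t * \<phi> (snd q))) * trig_exp (of_int t) (pow2_pair q) z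
         = of_real (c q) * cis ((2 ^ fst q * fst z + \<theta> (fst q)) + of_int t * (2 ^ snd q * snd z + \<phi> (snd q)))" for t
        unfolding trig_exp_def mult.assoc cis_mult by (simp add: algebra_simps)
      define P where "P = 2 ^ fst q * fst z + \<theta> (fst q)"
      define Q where "Q = 2 ^ snd q * snd z + \<phi> (snd q)"
      show ?thesis unfolding 1 P_def[symmetric] Q_def[symmetric]
        by (simp add: cos_add cos_diff field_simps)
    qed
    then show ?thesis
      unfolding lac_poly_def case_prod_unfold prod.collapse F_def Re_sum sum.distrib[symmetric] sum_divide_distrib
      by (intro sum.cong refl)
  qed
  have bound: "\<bar>lac_poly c \<theta> \<phi> S z\<bar> ^ (2 * k) \<le> (norm (F 1 c \<theta> \<phi> S z)) ^ (2 * k) + (norm (F (-1) c \<theta> \<phi> S z)) ^ (2 * k)"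
    for c \<theta> \<phi> S z
  proof -
    have "\<bar>lac_poly c \<theta> \<phi> S z\<bar> \<le> max (norm (F 1 c \<theta> \<phi> S z)) (norm (F (-1) c \<theta> \<phi> S z))"
    proof -
      have mx: "\<bar>(x + y) / 2\<bar> \<le> max X Y" if "\<bar>x\<bar> \<le> X" "\<bar>y\<bar> \<le> Y" for x y X Y :: real
        using that by (auto simp: max_def abs_le_iff field_simps)
      show ?thesis unfolding lac by (intro mx abs_Re_le_cmod)
    qed
    then have "\<bar>lac_poly c \<theta> \<phi> S z\<bar> ^ (2 * k) \<le> (max (norm (F 1 c \<theta> \<phi> S z)) (norm (F (-1) c \<theta> \<phi> S z))) ^ (2 * k)"
      by (intro power_mono) auto
    also have "\<dots> \<le> (norm (F 1 c \<theta> \<phi> S z)) ^ (2 * k) + (norm (F (-1) c \<theta> \<phi> S z)) ^ (2 * k)"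
      by (auto simp: max_def)
    finally show ?thesis .
  qed
  have "(LINT z|T2. \<bar>lac_poly c \<theta> \<phi> S z\<bar> ^ (2 * k)) \<le> (B1 + B2) * (\<Sum>s\<in>S. (c s)\<^sup>2) ^ k" if S: "finite S" for c \<theta> \<phi> S
  proof -
    have "(LINT z|T2. \<bar>lac_poly c \<theta> \<phi> S z\<bar> ^ (2 * k))
       \<le> (LINT z|T2. (norm (F 1 c \<theta> \<phi> S z)) ^ (2 * k) + (norm (F (-1) c \<theta> \<phi> S z)) ^ (2 * k))"
      by (intro integral_mono integrable_T2_continuous continuous_intros contF bound)
    also have "\<dots> = (LINT z|T2. (norm (F 1 c \<theta> \<phi> S z)) ^ (2 * k)) + (LINT z|T2. (norm (F (-1) c \<theta> \<phi> S z)) ^ (2 * k))"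
      by (intro Bochner_Integration.integral_add integrable_T2_continuous continuous_intros contF)
    also have "\<dots> \<le> B1 * (\<Sum>s\<in>S. (c s)\<^sup>2) ^ k + B2 * (\<Sum>s\<in>S. (c s)\<^sup>2) ^ k"
      by (intro add_mono B1(2) B2(2) S)
    finally show ?thesis by (simp add: algebra_simps)
  qed
  then show ?thesis using B1(1) B2(1) by (intro exI[of _ "B1 + B2"]) auto
qed

lemma Lp_norm_T2: "Lp_norm p f = (LINT z|T2. \<bar>f z\<bar> powr p) powr (1 / p)"
proof -
  have "(LINT z:period_square|lebesgue. \<bar>f z\<bar> powr p) = (LINT z|T2. \<bar>f z\<bar> powr p)"
    unfolding set_lebesgue_integral_def by (subst integral_restrict_space) simp_all
  then show ?thesis unfolding Lp_norm_def by simp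
qed

lemma Lp_norm_nonneg: "Lp_norm p f \<ge> 0"
  unfolding Lp_norm_T2 by simp

lemma continuous_on_abs_powr:
  fixes f :: "'a::topological_space \<Rightarrow> real"
  assumes "continuous_on A f" "p > 0"
  shows "continuous_on A (\<lambda>z. \<bar>f z\<bar> powr p)"
  using assms by (intro continuous_on_powr' continuous_on_rabs continuous_on_const) auto

text \<open>By homogeneity the coefficients may have \<open>l\<^sup>2\<close> norm 1. Then x powr q
  is at most 1 + x ^ (2 k) for an even exponent 2 k that is at least q, and the constant 1
  integrates to the area \<open>4 * pi\<^sup>2\<close>.\<close>

lemma Lp_norm_lac_poly_le:
  assumes q: "q > 0"
  shows "\<exists>C>0. \<forall>S c \<theta> \<phi>. finite S \<longrightarrow> Lp_norm q (lac_poly c \<theta> \<phi> S) \<le> C * sqrt (\<Sum>s\<in>S. (c s)\<^sup>2)"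
proof -
  define k where "k = nat \<lceil>q\<rceil>"
  have k: "q \<le> real (2 * k)" unfolding k_def using q by linarith
  obtain B where B: "B \<ge> 0" "\<And>S c \<theta> \<phi>. finite S \<Longrightarrow>
    (LINT z|T2. \<bar>lac_poly c \<theta> \<phi> S z\<bar> ^ (2 * k)) \<le> B * (\<Sum>s\<in>S. (c s)\<^sup>2) ^ k"
    using lac_poly_power_bound[of k] by blast
  have unit: "(LINT z|T2. \<bar>lac_poly c \<theta> \<phi> S z\<bar> powr q) \<le> 4 * pi\<^sup>2 + B"
    if S: "finite S" and c: "(\<Sum>s\<in>S. (c s)\<^sup>2) = 1" for S c \<theta> \<phi>
  proof -
    have "(LINT z|T2. \<bar>lac_poly c \<theta> \<phi> S z\<bar> powr q) \<le> (LINT z|T2. 1 + \<bar>lac_poly c \<theta> \<phi> S z\<bar> ^ (2 * k))"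
    proof (rule integral_mono)
      show "integrable T2 (\<lambda>z. \<bar>lac_poly c \<theta> \<phi> S z\<bar> powr q)"
        by (intro integrable_T2_continuous continuous_on_abs_powr continuous_on_lac_poly q)
      show "integrable T2 (\<lambda>z. 1 + \<bar>lac_poly c \<theta> \<phi> S z\<bar> ^ (2 * k))"
        by (intro integrable_T2_continuous continuous_intros)
      fix z
      show "\<bar>lac_poly c \<theta> \<phi> S z\<bar> powr q \<le> 1 + \<bar>lac_poly c \<theta> \<phi> S z\<bar> ^ (2 * k)" (is "?x powr q \<le> _")
      proof (cases "?x \<le> 1")
        case True
        then have "?x powr q \<le> 1" using q by (simp add: powr_le1)
        then show ?thesis by (smt (verit) zero_le_power abs_ge_zero)
      next
        case False
        then have "?x powr q \<le> ?x powr real (2 * k)" using k by (intro powr_mono) auto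
        also have "\<dots> = ?x ^ (2 * k)" using False by (intro powr_realpow) auto
        finally show ?thesis by simp
      qed
    qed
    also have "\<dots> = (LINT z|T2. 1) + (LINT z|T2. \<bar>lac_poly c \<theta> \<phi> S z\<bar> ^ (2 * k))"
      by (intro Bochner_Integration.integral_add integrable_T2_continuous continuous_intros)
    also have "\<dots> \<le> 4 * pi\<^sup>2 + B"
      using B(2)[OF S, of c \<theta> \<phi>] c measure_T2 by simp
    finally show ?thesis .
  qed
  define C where "C = (4 * pi\<^sup>2 + B) powr (1 / q)"
  have pB: "4 * pi\<^sup>2 + B > 0" using B(1) by (intro add_pos_nonneg) auto
  have "Lp_norm q (lac_poly c \<theta> \<phi> S) \<le> C * sqrt (\<Sum>s\<in>S. (c s)\<^sup>2)" if S: "finite S" for S c \<theta> \<phi>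
  proof (cases "(\<Sum>s\<in>S. (c s)\<^sup>2) = 0")
    case True
    then have "\<forall>s\<in>S. c s = 0" using S by (simp add: sum_nonneg_eq_0_iff)
    then have "lac_poly c \<theta> \<phi> S z = 0" for z unfolding lac_poly_def by (intro sum.neutral) auto
    then show ?thesis using True q by (simp add: Lp_norm_T2)
  next
    case False
    define L where "L = sqrt (\<Sum>s\<in>S. (c s)\<^sup>2)"
    have L: "L > 0" unfolding L_def using False
      by (simp add: order_less_le sum_nonneg)
    have L2: "L\<^sup>2 = (\<Sum>s\<in>S. (c s)\<^sup>2)" unfolding L_def by (simp add: sum_nonneg)
    have "(\<Sum>s\<in>S. (c s / L)\<^sup>2) = 1"
      using L L2 False by (simp add: power_divide sum_divide_distrib[symmetric])
    from unit[OF S this, of \<theta> \<phi>] have u: "(LINT z|T2. \<bar>lac_poly (\<lambda>s. c s / L) \<theta> \<phi> S z\<bar> powr q) \<le> 4 * pi\<^sup>2 + B" .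
    have sc: "lac_poly c \<theta> \<phi> S z = L * lac_poly (\<lambda>s. c s / L) \<theta> \<phi> S z" for z
      unfolding lac_poly_def sum_distrib_left using L by (intro sum.cong) auto
    have "Lp_norm q (lac_poly c \<theta> \<phi> S) = (L powr q * (LINT z|T2. \<bar>lac_poly (\<lambda>s. c s / L) \<theta> \<phi> S z\<bar> powr q)) powr (1 / q)"
      unfolding Lp_norm_T2 sc abs_mult using L by (simp add: powr_mult)
    also have "\<dots> = L * (LINT z|T2. \<bar>lac_poly (\<lambda>s. c s / L) \<theta> \<phi> S z\<bar> powr q) powr (1 / q)"
      using L q by (subst powr_mult) (simp_all add: powr_powr)
    also have "\<dots> \<le> L * C"
      unfolding C_def using L q u by (intro mult_left_mono powr_mono2) auto
    finally show ?thesis by (simp add: L_def mult.commute)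
  qed
  moreover have "C > 0" unfolding C_def using pB by (intro powr_gt_zero[THEN iffD2]) auto
  ultimately show ?thesis by blast
qed

section \<open>Hoelder's inequality, orthogonality of cosines and the lower estimate\<close>

lemma Holder_T2:
  assumes pq: "p > 1" "q > 1" "1 / p + 1 / q = 1"
    and [measurable]: "f \<in> borel_measurable T2" "g \<in> borel_measurable T2"
    and f: "integrable T2 (\<lambda>z. \<bar>f z\<bar> powr p)" and g: "integrable T2 (\<lambda>z. \<bar>g z\<bar> powr q)"
  shows "integrable T2 (\<lambda>z. f z * g z)"
    and "\<bar>LINT z|T2. f z * g z\<bar> \<le> Lp_norm p f * Lp_norm q g"
proof -
  have young: "a * b \<le> a powr p / p + b powr q / q" if "a \<ge> 0" "b \<ge> 0" for a b :: real
    using Youngs_inequality[OF pq that] .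
  show int: "integrable T2 (\<lambda>z. f z * g z)"
  proof (rule Bochner_Integration.integrable_bound)
    show "integrable T2 (\<lambda>z. \<bar>f z\<bar> powr p / p + \<bar>g z\<bar> powr q / q)"
      using f g by auto
    show "AE z in T2. norm (f z * g z) \<le> norm (\<bar>f z\<bar> powr p / p + \<bar>g z\<bar> powr q / q)"
    proof (rule AE_I2)
      fix z
      have "\<bar>f z\<bar> * \<bar>g z\<bar> \<le> \<bar>f z\<bar> powr p / p + \<bar>g z\<bar> powr q / q" by (rule young) auto
      then show "norm (f z * g z) \<le> norm (\<bar>f z\<bar> powr p / p + \<bar>g z\<bar> powr q / q)"
        unfolding real_norm_def abs_mult by linarith
    qed
  qed measurable
  define A where "A = (LINT z|T2. \<bar>f z\<bar> powr p)"
  define B where "B = (LINT z|T2. \<bar>g z\<bar> powr q)"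
  have A0: "A \<ge> 0" and B0: "B \<ge> 0" unfolding A_def B_def by simp_all
  have le: "\<bar>LINT z|T2. f z * g z\<bar> \<le> (LINT z|T2. \<bar>f z * g z\<bar>)"
    using integral_norm_bound[of T2 "\<lambda>z. f z * g z"] by simp
  show "\<bar>LINT z|T2. f z * g z\<bar> \<le> Lp_norm p f * Lp_norm q g"
  proof (cases "A = 0 \<or> B = 0")
    case True
    have "AE z in T2. f z * g z = 0"
    proof (cases "A = 0")
      case True
      then have "AE z in T2. \<bar>f z\<bar> powr p = 0"
        using integral_nonneg_eq_0_iff_AE[OF f] unfolding A_def by simp
      then show ?thesis by eventually_elim auto
    next
      case False
      with True have "AE z in T2. \<bar>g z\<bar> powr q = 0"
        using integral_nonneg_eq_0_iff_AE[OF g] unfolding B_def by simp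
      then show ?thesis by eventually_elim auto
    qed
    then have "(LINT z|T2. f z * g z) = (LINT z|T2. 0)"
      by (intro integral_cong_AE) auto
    then show ?thesis by (simp add: Lp_norm_nonneg)
  next
    case False
    then have A: "A > 0" and B: "B > 0" using A0 B0 by auto
    define a where "a = A powr (1 / p)"
    define b where "b = B powr (1 / q)"
    have ab: "a > 0" "b > 0" unfolding a_def b_def using A B by auto
    have ap: "a powr p = A" and bq: "b powr q = B"
      unfolding a_def b_def using A B pq by (simp_all add: powr_powr)
    have pt: "\<bar>f z * g z\<bar> \<le> a * b * (\<bar>f z\<bar> powr p / (p * A) + \<bar>g z\<bar> powr q / (q * B))" for z
    proof -
      have "(\<bar>f z\<bar> / a) * (\<bar>g z\<bar> / b) \<le> (\<bar>f z\<bar> / a) powr p / p + (\<bar>g z\<bar> / b) powr q / q"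
        by (rule young) (use ab in auto)
      also have "\<dots> = \<bar>f z\<bar> powr p / (p * A) + \<bar>g z\<bar> powr q / (q * B)"
        using ab by (simp add: powr_divide ap bq mult.commute)
      finally have "a * b * ((\<bar>f z\<bar> / a) * (\<bar>g z\<bar> / b)) \<le> a * b * (\<bar>f z\<bar> powr p / (p * A) + \<bar>g z\<bar> powr q / (q * B))"
        using ab by (intro mult_left_mono) auto
      then show ?thesis using ab by (simp add: abs_mult)
    qed
    have "(LINT z|T2. \<bar>f z * g z\<bar>) \<le> (LINT z|T2. a * b * (\<bar>f z\<bar> powr p / (p * A) + \<bar>g z\<bar> powr q / (q * B)))"
      by (intro integral_mono pt integrable_abs int) (use f g in auto)
    also have "\<dots> = a * b * (A / (p * A) + B / (q * B))"
      using f g by (simp add: A_def B_def)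
    also have "\<dots> = a * b" using A B pq by (simp add: field_simps)
    finally show ?thesis
      unfolding a_def b_def A_def B_def Lp_norm_T2 by (rule order_trans[OF le])
  qed
qed

lemma integral_T2_cos_cos:
  "(LINT z|T2. cos (of_int a * fst z + \<theta>) * cos (of_int b * snd z + \<phi>))
     = (if a = 0 \<and> b = 0 then 4 * pi\<^sup>2 * (cos \<theta> * cos \<phi>) else 0)"
proof -
  have eq: "cos (of_int a * fst z + \<theta>) * cos (of_int b * snd z + \<phi>)
    = Re (cis (\<theta> + \<phi>) / 2 * cis (of_int a * fst z + of_int b * snd z))
    + Re (cis (\<theta> - \<phi>) / 2 * cis (of_int a * fst z + of_int (- b) * snd z))" for z
  proof -
    define P where "P = of_int a * fst z + \<theta>"
    define Q where "Q = of_int b * snd z + \<phi>"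
    have 1: "cis (\<theta> + \<phi>) / 2 * cis (of_int a * fst z + of_int b * snd z) = cis (P + Q) / 2"
      and 2: "cis (\<theta> - \<phi>) / 2 * cis (of_int a * fst z + of_int (- b) * snd z) = cis (P - Q) / 2"
      unfolding P_def Q_def by (simp_all add: cis_mult algebra_simps)
    show ?thesis unfolding 1 2 unfolding P_def[symmetric] Q_def[symmetric]
      by (simp add: cos_add cos_diff field_simps)
  qed
  have "(LINT z|T2. cos (of_int a * fst z + \<theta>) * cos (of_int b * snd z + \<phi>))
    = (LINT z|T2. Re (cis (\<theta> + \<phi>) / 2 * cis (of_int a * fst z + of_int b * snd z)))
    + (LINT z|T2. Re (cis (\<theta> - \<phi>) / 2 * cis (of_int a * fst z + of_int (- b) * snd z)))"
    unfolding eq by (intro Bochner_Integration.integral_add integrable_T2_continuous continuous_intros) auto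
  also have "\<dots> = (if a = 0 \<and> b = 0 then 4 * pi\<^sup>2 * (cos \<theta> * cos \<phi>) else 0)"
    unfolding integral_T2_Re_cis by (simp add: cos_add cos_diff field_simps)
  finally show ?thesis .
qed

text \<open>In each variable the product of two cosines splits into the difference and the sum of
  the frequencies. The sums are positive, so of the four resulting terms only the one with both
  differences can have a nonzero integral; its weight 1 / 4 turns the area into
  \<open>pi\<^sup>2\<close>.\<close>

lemma integral_T2_cos_products:
  fixes m n m' n' :: nat
  assumes "m > 0" "n > 0"
  shows "(LINT z|T2. (cos (real m * fst z + \<theta>) * cos (real n * snd z + \<phi>))
            * (cos (real m' * fst z + \<theta>') * cos (real n' * snd z + \<phi>')))
     = (if m = m' \<and> n = n' then pi\<^sup>2 * (cos (\<theta> - \<theta>') * cos (\<phi> - \<phi>')) else 0)"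
proof -
  define f where "f a b s t z = cos (of_int a * fst z + s) * cos (of_int b * snd z + t)"
    for a b :: int and s t :: real and z :: "real \<times> real"
  define am where "am = int m - int m'"
  define ap where "ap = int m + int m'"
  define bm where "bm = int n - int n'"
  define bp where "bp = int n + int n'"
  have prod: "cos x * cos y = (cos (x - y) + cos (x + y)) / 2" for x y :: real
    by (simp add: cos_add cos_diff)
  have e1: "cos (real m * x + \<theta>) * cos (real m' * x + \<theta>')
     = (cos (of_int am * x + (\<theta> - \<theta>')) + cos (of_int ap * x + (\<theta> + \<theta>'))) / 2" for x
    unfolding prod am_def ap_def by (simp add: algebra_simps)
  have e2: "cos (real n * x + \<phi>) * cos (real n' * x + \<phi>')
     = (cos (of_int bm * x + (\<phi> - \<phi>')) + cos (of_int bp * x + (\<phi> + \<phi>'))) / 2" for x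
    unfolding prod bm_def bp_def by (simp add: algebra_simps)
  have eq: "(cos (real m * fst z + \<theta>) * cos (real n * snd z + \<phi>))
            * (cos (real m' * fst z + \<theta>') * cos (real n' * snd z + \<phi>'))
    = (f am bm (\<theta> - \<theta>') (\<phi> - \<phi>') z + f am bp (\<theta> - \<theta>') (\<phi> + \<phi>') z
     + f ap bm (\<theta> + \<theta>') (\<phi> - \<phi>') z + f ap bp (\<theta> + \<theta>') (\<phi> + \<phi>') z) / 4" for z
  proof -
    have "(cos (real m * fst z + \<theta>) * cos (real n * snd z + \<phi>))
            * (cos (real m' * fst z + \<theta>') * cos (real n' * snd z + \<phi>'))
     = (cos (real m * fst z + \<theta>) * cos (real m' * fst z + \<theta>'))
            * (cos (real n * snd z + \<phi>) * cos (real n' * snd z + \<phi>'))"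
      by (simp only: mult_ac)
    then show ?thesis unfolding e1 e2 f_def by (simp add: field_simps)
  qed
  have cont: "continuous_on UNIV (f a b s t)" for a b s t
    unfolding f_def by (intro continuous_intros)
  have int: "(LINT z|T2. f a b s t z) = (if a = 0 \<and> b = 0 then 4 * pi\<^sup>2 * (cos s * cos t) else 0)" for a b s t
    unfolding f_def by (rule integral_T2_cos_cos)
  have nz: "ap \<noteq> 0" "bp \<noteq> 0" unfolding ap_def bp_def using assms by auto
  have z: "am = 0 \<and> bm = 0 \<longleftrightarrow> m = m' \<and> n = n'" unfolding am_def bm_def by auto
  have "(LINT z|T2. (f am bm (\<theta> - \<theta>') (\<phi> - \<phi>') z + f am bp (\<theta> - \<theta>') (\<phi> + \<phi>') z
     + f ap bm (\<theta> + \<theta>') (\<phi> - \<phi>') z + f ap bp (\<theta> + \<theta>') (\<phi> + \<phi>') z) / 4)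
     = ((LINT z|T2. f am bm (\<theta> - \<theta>') (\<phi> - \<phi>') z) + (LINT z|T2. f am bp (\<theta> - \<theta>') (\<phi> + \<phi>') z)
     + (LINT z|T2. f ap bm (\<theta> + \<theta>') (\<phi> - \<phi>') z) + (LINT z|T2. f ap bp (\<theta> + \<theta>') (\<phi> + \<phi>') z)) / 4"
    by (simp add: integrable_T2_continuous cont)
  then show ?thesis unfolding eq int using nz z by simp
qed

lemma integral_T2_lac_poly_sq:
  assumes S: "finite S"
  shows "(LINT z|T2. lac_poly c \<theta> \<phi> S z * lac_poly c \<theta> \<phi> S z) = pi\<^sup>2 * (\<Sum>s\<in>S. (c s)\<^sup>2)"
proof -
  define g where "g s z = cos (real (2 ^ fst s) * fst z + \<theta> (fst s)) * cos (real (2 ^ snd s) * snd z + \<phi> (snd s))"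
    for s :: "nat \<times> nat" and z :: "real \<times> real"
  have cont: "continuous_on UNIV (\<lambda>z. g s z * g t z)" for s t
    unfolding g_def by (intro continuous_intros)
  have lac: "lac_poly c \<theta> \<phi> S z = (\<Sum>s\<in>S. c s * g s z)" for z
    by (simp add: lac_poly_def g_def case_prod_unfold)
  have "(LINT z|T2. lac_poly c \<theta> \<phi> S z * lac_poly c \<theta> \<phi> S z)
     = (LINT z|T2. (\<Sum>s\<in>S. \<Sum>t\<in>S. c s * c t * (g s z * g t z)))"
    unfolding lac sum_product by (intro Bochner_Integration.integral_cong refl sum.cong) (simp only: mult_ac)
  also have "\<dots> = (\<Sum>s\<in>S. \<Sum>t\<in>S. c s * c t * (LINT z|T2. g s z * g t z))"
    by (simp add: integrable_T2_continuous cont)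
  also have "\<dots> = (\<Sum>s\<in>S. \<Sum>t\<in>S. if s = t then pi\<^sup>2 * (c s)\<^sup>2 else 0)"
  proof (intro sum.cong refl)
    fix s t
    have "(LINT z|T2. g s z * g t z) = (if s = t then pi\<^sup>2 else 0)"
      unfolding g_def by (subst integral_T2_cos_products) (auto simp: prod_eq_iff)
    then show "c s * c t * (LINT z|T2. g s z * g t z) = (if s = t then pi\<^sup>2 * (c s)\<^sup>2 else 0)"
      by (simp add: power2_eq_square)
  qed
  also have "\<dots> = pi\<^sup>2 * (\<Sum>s\<in>S. (c s)\<^sup>2)"
    using S by (simp add: sum.delta' sum_distrib_left)
  finally show ?thesis .
qed

lemma borel_measurable_T2_continuous:
  fixes g :: "real \<times> real \<Rightarrow> real"
  shows "continuous_on UNIV g \<Longrightarrow> g \<in> borel_measurable T2"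
  by (rule borel_measurable_integrable[OF integrable_T2_continuous])

lemma integrable_T2_abs_powr_continuous:
  fixes g :: "real \<times> real \<Rightarrow> real"
  shows "continuous_on UNIV g \<Longrightarrow> p > 0 \<Longrightarrow> integrable T2 (\<lambda>z. \<bar>g z\<bar> powr p)"
  by (intro integrable_T2_continuous continuous_on_abs_powr)

lemma conjugate_exponent:
  fixes p :: real
  assumes "p > 1"
  obtains q where "q > 1" "1 / p + 1 / q = 1"
proof
  show "p / (p - 1) > 1" "1 / p + 1 / (p / (p - 1)) = 1"
    using assms by (simp_all add: field_simps)
qed

text \<open>Hoelder's inequality bounds the squared \<open>l\<^sup>2\<close> norm by the norm for
  \<open>p\<close> times the norm for the conjugate exponent; the upper estimate for the latter
  allows one factor of the \<open>l\<^sup>2\<close> norm to be cancelled.\<close>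

lemma Lp_norm_lac_poly_ge:
  assumes p: "p > 1"
  shows "\<exists>C>0. \<forall>S c \<theta> \<phi>. finite S \<longrightarrow> sqrt (\<Sum>s\<in>S. (c s)\<^sup>2) \<le> C * Lp_norm p (lac_poly c \<theta> \<phi> S)"
proof -
  obtain q where q: "q > 1" "1 / p + 1 / q = 1" using conjugate_exponent[OF p] .
  obtain C where C: "C > 0" "\<And>S c \<theta> \<phi>. finite S \<Longrightarrow> Lp_norm q (lac_poly c \<theta> \<phi> S) \<le> C * sqrt (\<Sum>s\<in>S. (c s)\<^sup>2)"
    using Lp_norm_lac_poly_le[of q] q by auto
  have "sqrt (\<Sum>s\<in>S. (c s)\<^sup>2) \<le> C / pi\<^sup>2 * Lp_norm p (lac_poly c \<theta> \<phi> S)" if S: "finite S" for S c \<theta> \<phi>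
  proof -
    define L where "L = sqrt (\<Sum>s\<in>S. (c s)\<^sup>2)"
    have L: "L \<ge> 0" "L\<^sup>2 = (\<Sum>s\<in>S. (c s)\<^sup>2)" unfolding L_def by (simp_all add: sum_nonneg)
    have m: "lac_poly c \<theta> \<phi> S \<in> borel_measurable T2"
      by (intro borel_measurable_T2_continuous continuous_on_lac_poly)
    have int: "integrable T2 (\<lambda>z. \<bar>lac_poly c \<theta> \<phi> S z\<bar> powr r)" if "r > 0" for r
      by (intro integrable_T2_abs_powr_continuous continuous_on_lac_poly that)
    have "pi\<^sup>2 * L\<^sup>2 = (LINT z|T2. lac_poly c \<theta> \<phi> S z * lac_poly c \<theta> \<phi> S z)"
      using integral_T2_lac_poly_sq[OF S] L by simp
    also have "\<dots> \<le> Lp_norm p (lac_poly c \<theta> \<phi> S) * Lp_norm q (lac_poly c \<theta> \<phi> S)"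
      by (rule order_trans[OF abs_ge_self Holder_T2(2)[OF p q m m int int]]) (use p q in auto)
    also have "\<dots> \<le> Lp_norm p (lac_poly c \<theta> \<phi> S) * (C * L)"
      unfolding L_def by (intro mult_left_mono C S Lp_norm_nonneg)
    finally have "L * (pi\<^sup>2 * L) \<le> L * (C * Lp_norm p (lac_poly c \<theta> \<phi> S))"
      by (simp add: power2_eq_square mult_ac)
    then have "L = 0 \<or> pi\<^sup>2 * L \<le> C * Lp_norm p (lac_poly c \<theta> \<phi> S)"
      using L(1) by (auto simp: mult_le_cancel_left)
    then have "pi\<^sup>2 * L \<le> C * Lp_norm p (lac_poly c \<theta> \<phi> S)"
      using C(1) Lp_norm_nonneg[of p "lac_poly c \<theta> \<phi> S"] by auto
    then show ?thesis unfolding L_def[symmetric] by (simp add: pos_le_divide_eq mult.commute)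
  qed
  moreover have "C / pi\<^sup>2 > 0" using C(1) by simp
  ultimately show ?thesis by blast
qed

subsection \<open>Trigonometric polynomials and duality\<close>

text \<open>Phases make the sines available without separate rules, and integer frequencies of
  either sign give closure under products. Both are needed for Stone-Weierstrass.\<close>

inductive_set trig_polys :: "(real \<times> real \<Rightarrow> real) set" where
  base: "(\<lambda>z. cos (of_int m * fst z + \<theta>) * cos (of_int n * snd z + \<phi>)) \<in> trig_polys"
| add: "f \<in> trig_polys \<Longrightarrow> g \<in> trig_polys \<Longrightarrow> (\<lambda>z. f z + g z) \<in> trig_polys"
| scale: "f \<in> trig_polys \<Longrightarrow> (\<lambda>z. c * f z) \<in> trig_polys"

lemma trig_polys_const: "(\<lambda>z. c) \<in> trig_polys"
  using trig_polys.scale[OF trig_polys.base[of 0 0 0 0], of c] by simp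

lemma trig_polys_base_mult:
  "(\<lambda>z. (cos (of_int m * fst z + \<theta>) * cos (of_int n * snd z + \<phi>))
      * (cos (of_int m' * fst z + \<theta>') * cos (of_int n' * snd z + \<phi>'))) \<in> trig_polys"
proof -
  define B where "B a s b t z = cos (of_int a * fst z + s) * cos (of_int b * snd z + t)"
    for a b :: int and s t :: real and z :: "real \<times> real"
  have prod: "cos x * cos y = (cos (x - y) + cos (x + y)) / 2" for x y :: real
    by (simp add: cos_add cos_diff)
  have e: "cos (of_int m * x + \<theta>) * cos (of_int m' * x + \<theta>')
     = (cos (of_int (m - m') * x + (\<theta> - \<theta>')) + cos (of_int (m + m') * x + (\<theta> + \<theta>'))) / 2"
    for m m' :: int and x \<theta> \<theta>' :: real
    unfolding prod by (simp add: algebra_simps)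
  have "(\<lambda>z. (cos (of_int m * fst z + \<theta>) * cos (of_int n * snd z + \<phi>))
      * (cos (of_int m' * fst z + \<theta>') * cos (of_int n' * snd z + \<phi>')))
    = (\<lambda>z. (1/4) * ((B (m - m') (\<theta> - \<theta>') (n - n') (\<phi> - \<phi>') z + B (m - m') (\<theta> - \<theta>') (n + n') (\<phi> + \<phi>') z)
     + (B (m + m') (\<theta> + \<theta>') (n - n') (\<phi> - \<phi>') z + B (m + m') (\<theta> + \<theta>') (n + n') (\<phi> + \<phi>') z)))"
  proof
    fix z :: "real \<times> real"
    have "(cos (of_int m * fst z + \<theta>) * cos (of_int n * snd z + \<phi>))
      * (cos (of_int m' * fst z + \<theta>') * cos (of_int n' * snd z + \<phi>'))
      = (cos (of_int m * fst z + \<theta>) * cos (of_int m' * fst z + \<theta>'))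
      * (cos (of_int n * snd z + \<phi>) * cos (of_int n' * snd z + \<phi>'))"
      by (simp only: mult_ac)
    then show "(cos (of_int m * fst z + \<theta>) * cos (of_int n * snd z + \<phi>))
      * (cos (of_int m' * fst z + \<theta>') * cos (of_int n' * snd z + \<phi>'))
     = (1/4) * ((B (m - m') (\<theta> - \<theta>') (n - n') (\<phi> - \<phi>') z + B (m - m') (\<theta> - \<theta>') (n + n') (\<phi> + \<phi>') z)
     + (B (m + m') (\<theta> + \<theta>') (n - n') (\<phi> - \<phi>') z + B (m + m') (\<theta> + \<theta>') (n + n') (\<phi> + \<phi>') z))"
      unfolding e B_def by (simp add: field_simps)
  qed
  also have "\<dots> \<in> trig_polys"
    unfolding B_def by (intro trig_polys.scale trig_polys.add trig_polys.base)
  finally show ?thesis .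
qed

lemma trig_polys_mult:
  assumes "f \<in> trig_polys" "g \<in> trig_polys"
  shows "(\<lambda>z. f z * g z) \<in> trig_polys"
  using assms(1)
proof induction
  case (base m \<theta> n \<phi>)
  show ?case using assms(2)
  proof induction
    case (base m' \<theta>' n' \<phi>')
    show ?case by (rule trig_polys_base_mult)
  next
    case (add f g)
    from trig_polys.add[OF add.IH] show ?case by (simp add: distrib_left)
  next
    case (scale f c)
    from trig_polys.scale[OF scale.IH, of c] show ?case by (simp only: mult_ac)
  qed
next
  case (add f g)
  from trig_polys.add[OF add.IH] show ?case by (simp add: distrib_right)
next
  case (scale f c)
  from trig_polys.scale[OF scale.IH, of c] show ?case by (simp only: mult_ac)
qed

lemma continuous_on_trig_polys: "f \<in> trig_polys \<Longrightarrow> continuous_on A f"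
  by (induction rule: trig_polys.induct) (intro continuous_intros | assumption)+

lemma trig_polys_bounded: "f \<in> trig_polys \<Longrightarrow> \<exists>R. \<forall>z. \<bar>f z\<bar> \<le> R"
proof (induction rule: trig_polys.induct)
  case (base m \<theta> n \<phi>)
  have "\<bar>cos (of_int m * fst z + \<theta>) * cos (of_int n * snd z + \<phi>)\<bar> \<le> 1 * 1" for z :: "real \<times> real"
    unfolding abs_mult by (intro mult_mono) auto
  then show ?case by (intro exI[of _ 1]) auto
next
  case (add f g)
  then obtain R R' where "\<forall>z. \<bar>f z\<bar> \<le> R" "\<forall>z. \<bar>g z\<bar> \<le> R'" by blast
  then have "\<forall>z. \<bar>f z + g z\<bar> \<le> R + R'"
    by (intro allI order_trans[OF abs_triangle_ineq] add_mono) auto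
  then show ?case by blast
next
  case (scale f c)
  then obtain R where "\<forall>z. \<bar>f z\<bar> \<le> R" by blast
  then have "\<forall>z. \<bar>c * f z\<bar> \<le> \<bar>c\<bar> * R" by (simp add: abs_mult mult_left_mono)
  then show ?case by blast
qed

lemma trig_polys_polynomial:
  assumes "real_polynomial_function (q :: real \<Rightarrow> real)" "f \<in> trig_polys"
  shows "(\<lambda>z. q (f z)) \<in> trig_polys"
  using assms(1)
proof induction
  case (linear q)
  then obtain c where "q = (\<lambda>x. x * c)" by (auto simp: real_bounded_linear)
  then show ?case using trig_polys.scale[OF assms(2), of c] by (simp add: mult.commute)
qed (auto intro: trig_polys_const trig_polys.add trig_polys_mult)

text \<open>Cosine and sine of a coordinate determine it up to full periods, and coordinates in the
  open interval differ by less than one. The sine enters as a cosine with phase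
  \<open>- pi / 2\<close>.\<close>

lemma trig_polys_separate:
  assumes z: "z \<in> {0<..<2*pi} \<times> {0<..<2*pi}" and w: "w \<in> {0<..<2*pi} \<times> {0<..<2*pi}" and ne: "z \<noteq> w"
  shows "\<exists>f\<in>trig_polys. f z \<noteq> f w"
proof (rule ccontr)
  assume "\<not> (\<exists>f\<in>trig_polys. f z \<noteq> f w)"
  then have eq: "f z = f w" if "f \<in> trig_polys" for f using that by blast
  have uniq: "x = y" if "cos x = cos y" "sin x = sin y" "0 < x" "x < 2*pi" "0 < y" "y < 2*pi" for x y
  proof -
    from that(1,2) obtain n :: int where n: "x = y + 2 * pi * of_int n"
      using sin_cos_eq_iff by (metis mult.commute mult.left_commute)
    have "2 * pi * \<bar>of_int n\<bar> = \<bar>x - y\<bar>" using n by (simp add: abs_mult)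
    also have "\<dots> < 2 * pi * 1" using that by linarith
    finally have "\<bar>real_of_int n\<bar> < 1" by (simp only: mult_less_cancel_left_pos[OF pi_gt_zero] mult.assoc) auto
    then have "n = 0" by linarith
    then show ?thesis using n by simp
  qed
  have sin_shift: "cos (x + - pi / 2) = sin x" for x :: real
    using cos_add[of x "- pi / 2"] by simp
  have "cos (fst z) = cos (fst w)" using eq[OF trig_polys.base[of 1 0 0 0]] by simp
  moreover have "sin (fst z) = sin (fst w)"
    using eq[OF trig_polys.base[of 1 "- pi/2" 0 0]]
    unfolding of_int_1 of_int_0 mult_1_left mult_zero_left sin_shift by simp
  ultimately have 1: "fst z = fst w" using z w by (intro uniq[of "fst z" "fst w"] uniq[of "snd z" "snd w"]) (simp_all add: mem_Times_iff)
  have "cos (snd z) = cos (snd w)" using eq[OF trig_polys.base[of 0 0 1 0]] by simp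
  moreover have "sin (snd z) = sin (snd w)"
    using eq[OF trig_polys.base[of 0 0 1 "- pi/2"]]
    unfolding of_int_1 of_int_0 mult_1_left mult_zero_left sin_shift by simp
  ultimately have 2: "snd z = snd w" using z w by (intro uniq[of "fst z" "fst w"] uniq[of "snd z" "snd w"]) (simp_all add: mem_Times_iff)
  show False using 1 2 ne by (simp add: prod_eq_iff)
qed

text \<open>
  Trigonometric polynomials do not separate opposite sides of the square, so Stone-Weierstrass is
  applied in a slightly smaller one; composing with a polynomial close to the truncation at \<open>M\<close>
  restores a bound on the whole plane.
\<close>

lemma trig_poly_approximation:
  assumes g: "continuous_on UNIV g" and M: "\<And>z. \<bar>g z\<bar> \<le> M" and e: "e > 0"
  shows "\<exists>T\<in>trig_polys. (\<forall>z\<in>{e..2*pi-e} \<times> {e..2*pi-e}. \<bar>T z - g z\<bar> < e) \<and> (\<forall>z. \<bar>T z\<bar> \<le> M + e)"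
proof -
  let ?S = "{e..2*pi-e} \<times> {e..2*pi-e}"
  interpret function_ring_on trig_polys ?S
  proof
    show "compact ?S" by (intro compact_Times compact_Icc)
    show "\<exists>f\<in>trig_polys. f x \<noteq> f y" if "x \<in> ?S" "y \<in> ?S" "x \<noteq> y" for x y
      by (rule trig_polys_separate) (use that e in auto)
  qed (auto intro: continuous_on_trig_polys trig_polys.add trig_polys_mult trig_polys_const)
  have e2: "e / 2 > 0" using e by simp
  obtain T0 where T0: "T0 \<in> trig_polys" "\<forall>z\<in>?S. \<bar>g z - T0 z\<bar> < e / 2"
    using Stone_Weierstrass_basic[OF continuous_on_subset[OF g subset_UNIV] e2] by blast
  obtain R where R: "\<And>z. \<bar>T0 z\<bar> \<le> R" using trig_polys_bounded[OF T0(1)] by blast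
  define k where "k t = max (- M) (min M t)" for t :: real
  have "continuous_on {-R..R} k" unfolding k_def by (intro continuous_intros)
  then obtain q where q: "real_polynomial_function q" "\<And>t. t \<in> {-R..R} \<Longrightarrow> \<bar>k t - q t\<bar> < e / 2"
    using Stone_Weierstrass_real_polynomial_function[OF compact_Icc _ e2] by metis
  show ?thesis
  proof (rule bexI[of _ "\<lambda>z. q (T0 z)"], intro conjI ballI allI)
    show "(\<lambda>z. q (T0 z)) \<in> trig_polys" by (rule trig_polys_polynomial[OF q(1) T0(1)])
    have qk: "\<bar>k (T0 z) - q (T0 z)\<bar> < e / 2" for z
      using R[of z] by (intro q(2)) (auto simp: abs_le_iff)
    have M0: "M \<ge> 0" using M[of undefined] by linarith
    show "\<bar>q (T0 z)\<bar> \<le> M + e" for z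
    proof -
      have "\<bar>k (T0 z)\<bar> \<le> M" unfolding k_def using M0 by (auto simp: max_def min_def)
      then show ?thesis using qk[of z] e by linarith
    qed
    show "\<bar>q (T0 z) - g z\<bar> < e" if "z \<in> ?S" for z
    proof -
      have "\<bar>g z - T0 z\<bar> < e / 2" using T0(2) that by blast
      moreover have "\<bar>k (T0 z) - g z\<bar> \<le> \<bar>g z - T0 z\<bar>"
        using M[of z] unfolding k_def by (auto simp: max_def min_def)
      ultimately show ?thesis using qk[of z] by linarith
    qed
  qed
qed

lemma AE_T2_interior: "AE z in T2. 0 < fst z \<and> fst z < 2*pi \<and> 0 < snd z \<and> snd z < 2*pi"
proof -
  have 1: "{z::real\<times>real. (1,0) \<bullet> z = c} = {z. fst z = c}" "{z::real\<times>real. (0,1) \<bullet> z = c} = {z. snd z = c}" for c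
    by (auto simp: inner_prod_def)
  have "negligible {z::real\<times>real. (1,0) \<bullet> z = c}" "negligible {z::real\<times>real. (0,1) \<bullet> z = c}" for c
    by (rule negligible_hyperplane, simp add: zero_prod_def)+
  then have "negligible (({z. fst z = 0} \<union> {z. fst z = 2*pi}) \<union> ({z. snd z = 0} \<union> {z::real\<times>real. snd z = 2*pi}))"
    unfolding 1 by (intro negligible_Un)
  then have "AE z in lebesgue. z \<notin> ({z. fst z = 0} \<union> {z. fst z = 2*pi}) \<union> ({z. snd z = 0} \<union> {z::real\<times>real. snd z = 2*pi})"
    by (intro AE_not_in) (simp add: negligible_iff_null_sets)
  then have "AE z in lebesgue. z \<in> period_square \<longrightarrow> 0 < fst z \<and> fst z < 2*pi \<and> 0 < snd z \<and> snd z < 2*pi"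
    by eventually_elim (auto simp: mem_Times_iff order_less_le)
  then show ?thesis by (subst AE_restrict_space_iff) auto
qed

text \<open>A measurable function is the limit almost everywhere of continuous ones, and truncation
  at \<open>M\<close> preserves this. The \<open>n\<close>-th truncated function is approximated up
  to \<open>e n\<close> on the square shrunk by \<open>e n\<close>, which eventually contains any
  given interior point. The common bound is kept for dominated convergence.\<close>

lemma bounded_measurable_trig_approx:
  assumes h: "h \<in> borel_measurable T2" and M: "\<And>z. \<bar>h z\<bar> \<le> M"
  shows "\<exists>T. (\<forall>n::nat. T n \<in> trig_polys) \<and> (\<forall>n z. \<bar>T n z\<bar> \<le> M + 1) \<and> (AE z in T2. (\<lambda>n. T n z) \<longlonglongrightarrow> h z)"
proof -
  have "h measurable_on period_square"
    using h by (subst measurable_on_iff_borel_measurable) auto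
  then obtain N g where N: "negligible N" and g: "\<And>n. continuous_on UNIV (g n)"
    and lim: "\<And>z. z \<notin> N \<Longrightarrow> (\<lambda>n. g n z) \<longlonglongrightarrow> (if z \<in> period_square then h z else 0)"
    unfolding measurable_on_def by metis
  define k where "k t = max (- M) (min M t)" for t :: real
  have M0: "M \<ge> 0" using M[of undefined] by linarith
  have k: "continuous_on UNIV k" "\<bar>k t\<bar> \<le> M" for t
    unfolding k_def using M0 by (intro continuous_intros, auto simp: max_def min_def)
  have kh: "k (h z) = h z" for z unfolding k_def using M[of z] by (auto simp: max_def min_def)
  define e where "e n = inverse (real (Suc n))" for n
  have e: "e n > 0" "e n \<le> 1" for n unfolding e_def by (auto simp: field_simps)
  have e0: "e \<longlonglongrightarrow> 0" unfolding e_def by (rule LIMSEQ_inverse_real_of_nat)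
  have "\<exists>T\<in>trig_polys. (\<forall>z\<in>{e n..2*pi-e n} \<times> {e n..2*pi-e n}. \<bar>T z - k (g n z)\<bar> < e n)
      \<and> (\<forall>z. \<bar>T z\<bar> \<le> M + e n)" for n
    by (rule trig_poly_approximation) (auto intro: continuous_on_compose2[OF k(1) g] k(2) e(1))
  then obtain T where T: "\<And>n. T n \<in> trig_polys"
    "\<And>n z. z\<in>{e n..2*pi-e n} \<times> {e n..2*pi-e n} \<Longrightarrow> \<bar>T n z - k (g n z)\<bar> < e n"
    "\<And>n z. \<bar>T n z\<bar> \<le> M + e n" by metis
  have "AE z in lebesgue. z \<notin> N" using N by (intro AE_not_in) (simp add: negligible_iff_null_sets)
  then have "AE z in lebesgue. z \<in> period_square \<longrightarrow> z \<notin> N" by eventually_elim simp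
  then have "AE z in T2. z \<notin> N" by (simp add: AE_restrict_space_iff)
  then have "AE z in T2. (\<lambda>n. T n z) \<longlonglongrightarrow> h z"
    using AE_T2_interior
  proof eventually_elim
    case (elim z)
    then have "z \<in> period_square" by (auto simp: mem_Times_iff)
    then have "(\<lambda>n. g n z) \<longlonglongrightarrow> h z" using lim[OF elim(1)] by simp
    then have "(\<lambda>n. k (g n z)) \<longlonglongrightarrow> k (h z)"
      by (rule continuous_on_tendsto_compose[OF k(1)]) auto
    then have kg: "(\<lambda>n. k (g n z)) \<longlonglongrightarrow> h z" by (simp add: kh)
    define d where "d = min (min (fst z) (2*pi - fst z)) (min (snd z) (2*pi - snd z))"
    have "d > 0" using elim(2) unfolding d_def by auto
    then have "eventually (\<lambda>n. e n < d) sequentially" by (rule order_tendstoD(2)[OF e0])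
    then have "eventually (\<lambda>n. norm (T n z - k (g n z)) \<le> e n) sequentially"
    proof eventually_elim
      case (elim n)
      then have "z \<in> {e n..2*pi-e n} \<times> {e n..2*pi-e n}" unfolding d_def by (auto simp: mem_Times_iff)
      from T(2)[OF this] show ?case by simp
    qed
    then have "(\<lambda>n. T n z - k (g n z)) \<longlonglongrightarrow> 0" by (rule Lim_null_comparison[OF _ e0])
    from tendsto_add[OF this kg] show ?case by simp
  qed
  moreover have "\<bar>T n z\<bar> \<le> M + 1" for n z using T(3)[where n=n and z=z] e(2)[of n] by linarith
  ultimately show ?thesis using T(1) by blast
qed

lemma finite_measure_T2: "finite_measure T2"
  by (rule finite_measureI) (simp add: emeasure_restrict_space emeasure_period_square)

lemma borel_measurable_trig_polys: "f \<in> trig_polys \<Longrightarrow> f \<in> borel_measurable T2"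
  by (intro borel_measurable_T2_continuous continuous_on_trig_polys)

section \<open>Norms determined by pairing with trigonometric polynomials\<close>

lemma integrable_T2_of_abs_powr:
  fixes g :: "real \<times> real \<Rightarrow> real"
  assumes "p \<ge> 1" and [measurable]: "g \<in> borel_measurable T2" and "integrable T2 (\<lambda>z. \<bar>g z\<bar> powr p)"
  shows "integrable T2 g"
proof (rule Bochner_Integration.integrable_bound)
  interpret finite_measure T2 by (rule finite_measure_T2)
  show "integrable T2 (\<lambda>z. 1 + \<bar>g z\<bar> powr p)" using assms(3) by simp
  show "AE z in T2. norm (g z) \<le> norm (1 + \<bar>g z\<bar> powr p)"
  proof (rule AE_I2)
    fix z
    have "\<bar>g z\<bar> \<le> 1 + \<bar>g z\<bar> powr p"
    proof (cases "\<bar>g z\<bar> \<le> 1")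
      case False
      then have "\<bar>g z\<bar> powr 1 \<le> \<bar>g z\<bar> powr p" using assms(1) by (intro powr_mono) auto
      then show ?thesis using False by simp
    qed (smt (verit) powr_ge_zero)
    then show "norm (g z) \<le> norm (1 + \<bar>g z\<bar> powr p)" by simp
  qed
qed measurable

text \<open>Along uniformly bounded trigonometric polynomials converging to \<open>h\<close> almost
  everywhere, both sides of the hypothesis converge by dominated convergence, the measure being
  finite.\<close>

lemma integral_T2_bounded_duality:
  fixes g h :: "real \<times> real \<Rightarrow> real"
  assumes q: "q > 0" and g: "integrable T2 g" and K: "K \<ge> 0"
    and dual: "\<And>T. T \<in> trig_polys \<Longrightarrow> \<bar>LINT z|T2. g z * T z\<bar> \<le> K * Lp_norm q T"
    and h[measurable]: "h \<in> borel_measurable T2" and M: "\<And>z. \<bar>h z\<bar> \<le> M"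
  shows "\<bar>LINT z|T2. g z * h z\<bar> \<le> K * Lp_norm q h"
proof -
  interpret finite_measure T2 by (rule finite_measure_T2)
  obtain T where T: "\<And>n::nat. T n \<in> trig_polys" and TM: "\<And>n z. \<bar>T n z\<bar> \<le> M + 1"
    and Th: "AE z in T2. (\<lambda>n. T n z) \<longlonglongrightarrow> h z"
    using bounded_measurable_trig_approx[OF h M] by blast
  have [measurable]: "T n \<in> borel_measurable T2" for n by (rule borel_measurable_trig_polys[OF T])
  have [measurable]: "g \<in> borel_measurable T2" using g by (rule borel_measurable_integrable)
  have l1: "(\<lambda>n. LINT z|T2. g z * T n z) \<longlonglongrightarrow> (LINT z|T2. g z * h z)"
  proof (rule integral_dominated_convergence[where w = "\<lambda>z. \<bar>g z\<bar> * (M + 1)"])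
    show "AE z in T2. (\<lambda>n. g z * T n z) \<longlonglongrightarrow> g z * h z"
      using Th by eventually_elim (intro tendsto_intros)
    show "AE z in T2. norm (g z * T n z) \<le> \<bar>g z\<bar> * (M + 1)" for n
      by (rule AE_I2) (auto simp: abs_mult intro!: mult_left_mono TM)
    show "integrable T2 (\<lambda>z. \<bar>g z\<bar> * (M + 1))" using g by (intro integrable_mult_left integrable_abs)
  qed measurable
  have l2: "(\<lambda>n. LINT z|T2. \<bar>T n z\<bar> powr q) \<longlonglongrightarrow> (LINT z|T2. \<bar>h z\<bar> powr q)"
  proof (rule integral_dominated_convergence[where w = "\<lambda>z. (M + 1) powr q"])
    show "AE z in T2. (\<lambda>n. \<bar>T n z\<bar> powr q) \<longlonglongrightarrow> \<bar>h z\<bar> powr q"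
      using Th by eventually_elim (rule tendsto_powr', (intro tendsto_intros | use q in simp)+)
    show "AE z in T2. norm (\<bar>T n z\<bar> powr q) \<le> (M + 1) powr q" for n
      using q by (intro AE_I2) (auto intro!: powr_mono2 TM)
    show "(\<lambda>z. \<bar>h z\<bar> powr q) \<in> borel_measurable T2" by measurable
    show "(\<lambda>z. \<bar>T n z\<bar> powr q) \<in> borel_measurable T2" for n by measurable
    show "integrable T2 (\<lambda>z. (M + 1) powr q)" by simp
  qed
  have "(\<lambda>n. Lp_norm q (T n)) \<longlonglongrightarrow> Lp_norm q h"
    unfolding Lp_norm_T2 by (rule tendsto_powr'[OF l2 tendsto_const]) (use q in auto)
  then have KT: "(\<lambda>n. K * Lp_norm q (T n)) \<longlonglongrightarrow> K * Lp_norm q h" by (intro tendsto_intros)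
  show ?thesis
    by (rule LIMSEQ_le[OF tendsto_rabs[OF l1] KT]) (use dual[OF T] in auto)
qed

text \<open>The extremal test function is sgn g |g| powr (p - 1). Truncated to the set where |g| is
  at most \<open>M\<close> it is bounded, hence admissible, and gives
  \<open>A M \<le> K * A M powr (1 / q)\<close>, that is \<open>A M powr (1 / p) \<le> K\<close>.
  The truncation is then removed by letting \<open>M\<close> tend to infinity.\<close>

lemma Lp_norm_le_by_duality:
  fixes g :: "real \<times> real \<Rightarrow> real"
  assumes p: "p > 1" and q: "q > 1" and pq: "1 / p + 1 / q = 1"
    and [measurable]: "g \<in> borel_measurable T2" and gp: "integrable T2 (\<lambda>z. \<bar>g z\<bar> powr p)" and K: "K \<ge> 0"
    and dual: "\<And>T. T \<in> trig_polys \<Longrightarrow> \<bar>LINT z|T2. g z * T z\<bar> \<le> K * Lp_norm q T"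
  shows "Lp_norm p g \<le> K"
proof -
  have g: "integrable T2 g" by (rule integrable_T2_of_abs_powr[OF _ _ gp]) (use p in auto)
  have pq': "(p - 1) * q = p" using p q pq by (simp add: field_simps)
  have q0: "q > 0" using q by simp
  define A where "A M = (LINT z|T2. \<bar>g z\<bar> powr p * indicator {..M} \<bar>g z\<bar>)" for M :: real
  have A0: "A M \<ge> 0" for M unfolding A_def by simp
  have A_le: "A M \<le> K powr p" if M: "M \<ge> 0" for M
  proof -
    define h where "h z = sgn (g z) * \<bar>g z\<bar> powr (p - 1) * indicator {..M} \<bar>g z\<bar>" for z
    have hm: "h \<in> borel_measurable T2" unfolding h_def by measurable
    have hb: "\<bar>h z\<bar> \<le> M powr (p - 1)" for z
      unfolding h_def using p by (auto simp: abs_mult indicator_def abs_sgn_eq intro!: powr_mono2)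
    have gh: "g z * h z = \<bar>g z\<bar> powr p * indicator {..M} \<bar>g z\<bar>" for z
    proof -
      have "g z * sgn (g z) = \<bar>g z\<bar>" by (simp add: abs_sgn)
      moreover have "\<bar>g z\<bar> * \<bar>g z\<bar> powr (p - 1) = \<bar>g z\<bar> powr p" using p
        by (cases "g z = 0") (simp_all add: powr_mult_base)
      ultimately show ?thesis unfolding h_def by (metis mult.assoc)
    qed
    have hq: "\<bar>h z\<bar> powr q = \<bar>g z\<bar> powr p * indicator {..M} \<bar>g z\<bar>" for z
      unfolding h_def using p q by (auto simp: abs_mult abs_sgn_eq indicator_def powr_powr pq')
    have "A M \<le> K * A M powr (1 / q)"
      using integral_T2_bounded_duality[OF q0 g K dual hm hb] unfolding gh hq Lp_norm_T2 A_def[symmetric]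
      using A0[of M] by simp
    then have "A M powr (1 / p) \<le> K"
    proof (cases "A M = 0")
      case False
      then have pos: "A M > 0" using A0[of M] by simp
      have "A M = A M powr (1 / p) * A M powr (1 / q)"
        using pos pq by (simp add: powr_add[symmetric])
      then have "A M powr (1 / p) * A M powr (1 / q) \<le> K * A M powr (1 / q)"
        using \<open>A M \<le> K * A M powr (1 / q)\<close> by linarith
      then show ?thesis using pos by (simp add: mult_le_cancel_right)
    qed (use K p in auto)
    then have "(A M powr (1 / p)) powr p \<le> K powr p" using p by (intro powr_mono2) auto
    then show ?thesis using A0[of M] p by (simp add: powr_powr)
  qed
  have "(\<lambda>n::nat. A (real n)) \<longlonglongrightarrow> (LINT z|T2. \<bar>g z\<bar> powr p)"
    unfolding A_def
  proof (rule integral_dominated_convergence[where w = "\<lambda>z. \<bar>g z\<bar> powr p"])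
    show "AE z in T2. (\<lambda>n::nat. \<bar>g z\<bar> powr p * indicator {..real n} \<bar>g z\<bar>) \<longlonglongrightarrow> \<bar>g z\<bar> powr p"
    proof (rule AE_I2)
      fix z
      obtain N where N: "\<bar>g z\<bar> \<le> real N" using real_arch_simple by blast
      have "eventually (\<lambda>n. \<bar>g z\<bar> powr p * indicator {..real n} \<bar>g z\<bar> = \<bar>g z\<bar> powr p) sequentially"
        using eventually_ge_at_top[of N] by eventually_elim (use N in \<open>auto simp: indicator_def\<close>)
      then show "(\<lambda>n::nat. \<bar>g z\<bar> powr p * indicator {..real n} \<bar>g z\<bar>) \<longlonglongrightarrow> \<bar>g z\<bar> powr p"
        by (rule tendsto_eventually)
    qed
  qed (use gp in \<open>auto simp: indicator_def\<close>)
  then have "(LINT z|T2. \<bar>g z\<bar> powr p) \<le> K powr p"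
    by (rule LIMSEQ_le_const2) (use A_le in auto)
  then have "Lp_norm p g \<le> (K powr p) powr (1 / p)"
    unfolding Lp_norm_T2 using p by (intro powr_mono2) auto
  also have "\<dots> = K" using p K by (simp add: powr_powr)
  finally show ?thesis .
qed

subsection \<open>Lacunary Fourier series\<close>

lemma borel_measurable_T2I: "f \<in> borel_measurable lebesgue \<Longrightarrow> f \<in> borel_measurable T2"
  by (rule measurable_restrict_space1)

lemma integrable_T2_iff:
  fixes g :: "real \<times> real \<Rightarrow> real"
  shows "integrable T2 g \<longleftrightarrow> set_integrable lebesgue period_square g"
  unfolding set_integrable_def by (subst integrable_restrict_space) simp_all

lemma Lp_space_iff:
  "f \<in> Lp_space p \<longleftrightarrow> f \<in> borel_measurable lebesgue \<and> doubly_periodic f \<and> integrable T2 (\<lambda>z. \<bar>f z\<bar> powr p)"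
  unfolding Lp_space_def doubly_periodic_def integrable_T2_iff by auto

text \<open>The Fourier coefficients \<open>fourier_coeff u v f m n\<close> without the norming factor.\<close>

definition pairing :: "(real \<Rightarrow> real) \<Rightarrow> (real \<Rightarrow> real) \<Rightarrow> (real \<times> real \<Rightarrow> real) \<Rightarrow> nat \<Rightarrow> nat \<Rightarrow> real" where
  "pairing u v f m n = (LINT z|T2. f z * (u (real m * fst z) * v (real n * snd z)))"

lemma fourier_coeff_pairing:
  "fourier_coeff u v f m n = (if m = 0 then 1 / 2 else 1) * (if n = 0 then 1 / 2 else 1) / pi\<^sup>2 * pairing u v f m n"
proof -
  have "(LINT z:period_square|lebesgue. f z * u (real m * fst z) * v (real n * snd z))
     = (LINT z|T2. f z * u (real m * fst z) * v (real n * snd z))"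
    unfolding set_lebesgue_integral_def by (subst integral_restrict_space) simp_all
  then show ?thesis unfolding fourier_coeff_def pairing_def by (simp add: mult.assoc)
qed

lemma integrable_T2_mult_bounded:
  fixes f u :: "real \<times> real \<Rightarrow> real"
  assumes f: "integrable T2 f" and u: "continuous_on UNIV u" and B: "\<And>z. \<bar>u z\<bar> \<le> B"
  shows "integrable T2 (\<lambda>z. f z * u z)"
proof (rule Bochner_Integration.integrable_bound)
  show "integrable T2 (\<lambda>z. B * f z)" using f by simp
  have [measurable]: "f \<in> borel_measurable T2" "u \<in> borel_measurable T2"
    using f u by (auto intro: borel_measurable_T2_continuous)
  show "(\<lambda>z. f z * u z) \<in> borel_measurable T2" by measurable
  show "AE z in T2. norm (f z * u z) \<le> norm (B * f z)"
  proof (rule AE_I2)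
    fix z
    have "\<bar>f z\<bar> * \<bar>u z\<bar> \<le> \<bar>f z\<bar> * \<bar>B\<bar>" using B[of z] by (intro mult_left_mono) auto
    then show "norm (f z * u z) \<le> norm (B * f z)" by (simp add: abs_mult mult.commute)
  qed
qed

text \<open>The addition theorem expands the base function into four products of cosines and sines,
  and the three that contain a sine pair to zero. Phases thus enter only through the factor
  \<open>cos \<theta> * cos \<phi>\<close>.\<close>

lemma integral_T2_mult_base:
  assumes f: "integrable T2 f"
    and 0: "\<And>a b. pairing cos sin f a b = 0" "\<And>a b. pairing sin cos f a b = 0" "\<And>a b. pairing sin sin f a b = 0"
  shows "(LINT z|T2. f z * (cos (of_int m * fst z + \<theta>) * cos (of_int n * snd z + \<phi>)))
       = cos \<theta> * cos \<phi> * pairing cos cos f (nat \<bar>m\<bar>) (nat \<bar>n\<bar>)"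
proof -
  define a b where "a = nat \<bar>m\<bar>" and "b = nat \<bar>n\<bar>"
  define g where "g u v z = f z * (u (real a * fst z) * v (real b * snd z))" for u v :: "real \<Rightarrow> real" and z
  \<comment> \<open>Coefficients are indexed by natural frequencies: the cosine ignores the sign of
    \<open>m\<close>, and the sine passes it to its coefficient.\<close>
  have e: "cos (of_int m * x + \<theta>) = cos \<theta> * cos (real (nat \<bar>m\<bar>) * x) + (- sgn (of_int m) * sin \<theta>) * sin (real (nat \<bar>m\<bar>) * x)"
    for m and x \<theta> :: real
    by (cases m "0::int" rule: linorder_cases) (simp_all add: cos_add)
  have int: "integrable T2 (g u v)" if "u \<in> {cos, sin}" "v \<in> {cos, sin}" for u v
    unfolding g_def
  proof (rule integrable_T2_mult_bounded[OF f])
    show "continuous_on UNIV (\<lambda>z. u (real a * fst z) * v (real b * snd z))"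
      using that by (auto intro!: continuous_intros)
    show "\<bar>u (real a * fst z) * v (real b * snd z)\<bar> \<le> 1 * 1" for z
      unfolding abs_mult using that by (intro mult_mono) auto
  qed
  have eq: "f z * (cos (of_int m * fst z + \<theta>) * cos (of_int n * snd z + \<phi>))
     = (cos \<theta> * cos \<phi>) * g cos cos z + (cos \<theta> * (- sgn (of_int n) * sin \<phi>)) * g cos sin z
     + ((- sgn (of_int m) * sin \<theta>) * cos \<phi>) * g sin cos z
     + ((- sgn (of_int m) * sin \<theta>) * (- sgn (of_int n) * sin \<phi>)) * g sin sin z" for z
    unfolding e g_def a_def b_def by (simp only: distrib_left distrib_right mult_ac add_ac)
  have "(LINT z|T2. f z * (cos (of_int m * fst z + \<theta>) * cos (of_int n * snd z + \<phi>)))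
     = (cos \<theta> * cos \<phi>) * (LINT z|T2. g cos cos z) + (cos \<theta> * (- sgn (of_int n) * sin \<phi>)) * (LINT z|T2. g cos sin z)
     + ((- sgn (of_int m) * sin \<theta>) * cos \<phi>) * (LINT z|T2. g sin cos z)
     + ((- sgn (of_int m) * sin \<theta>) * (- sgn (of_int n) * sin \<phi>)) * (LINT z|T2. g sin sin z)"
    unfolding eq using int by (simp del: mult_minus_left mult_minus_right)
  also have "\<dots> = cos \<theta> * cos \<phi> * pairing cos cos f a b"
    using 0[of a b] unfolding g_def pairing_def by simp
  finally show ?thesis unfolding a_def b_def .
qed

abbreviation lac_cos :: "(nat \<times> nat \<Rightarrow> real) \<Rightarrow> (nat \<times> nat) set \<Rightarrow> real \<times> real \<Rightarrow> real" where
  "lac_cos c \<equiv> lac_poly c (\<lambda>_. 0) (\<lambda>_. 0)"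

lemma integral_T2_lac_cos_mult:
  "finite S \<Longrightarrow> (LINT z|T2. lac_cos c S z * (cos (real a * fst z + \<theta>) * cos (real b * snd z + \<phi>)))
     = (\<Sum>s\<in>S. if 2 ^ fst s = a \<and> 2 ^ snd s = b then c s * (pi\<^sup>2 * (cos \<theta> * cos \<phi>)) else 0)"
proof -
  assume S: "finite S"
  define g where "g s z = (cos (real (2 ^ fst s) * fst z + 0) * cos (real (2 ^ snd s) * snd z + 0)) *
     (cos (real a * fst z + \<theta>) * cos (real b * snd z + \<phi>))" for s :: "nat \<times> nat" and z :: "real \<times> real"
  have cont: "continuous_on UNIV (g s)" for s unfolding g_def by (intro continuous_intros)
  have "(LINT z|T2. lac_cos c S z * (cos (real a * fst z + \<theta>) * cos (real b * snd z + \<phi>)))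
      = (LINT z|T2. (\<Sum>s\<in>S. c s * g s z))"
    unfolding lac_poly_def g_def sum_distrib_right case_prod_unfold prod.collapse
    by (intro Bochner_Integration.integral_cong refl sum.cong) (simp only: mult_ac of_nat_power of_nat_numeral)
  also have "\<dots> = (\<Sum>s\<in>S. c s * (LINT z|T2. g s z))"
    by (simp add: integrable_T2_continuous cont)
  also have "\<dots> = (\<Sum>s\<in>S. if 2 ^ fst s = a \<and> 2 ^ snd s = b then c s * (pi\<^sup>2 * (cos \<theta> * cos \<phi>)) else 0)"
    unfolding g_def by (subst integral_T2_cos_products) (auto intro!: sum.cong)
  finally show ?thesis .
qed

lemma sin_eq_cos_shift: "sin x = cos (x + - pi / 2)"
  using cos_add[of x "- pi / 2"] by simp

text \<open>A sine is a cosine with phase \<open>- pi / 2\<close>, and the cosine of that phase,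
  which is zero, is a factor of the pairing.\<close>

lemma pairing_lac_cos:
  assumes S: "finite S"
  shows "pairing cos cos (lac_cos c S) a b = (\<Sum>s\<in>S. if 2 ^ fst s = a \<and> 2 ^ snd s = b then c s * pi\<^sup>2 else 0)"
    and "pairing cos sin (lac_cos c S) a b = 0"
    and "pairing sin cos (lac_cos c S) a b = 0"
    and "pairing sin sin (lac_cos c S) a b = 0"
proof -
  note I = integral_T2_lac_cos_mult[OF S, of c a _ b]
  show "pairing cos cos (lac_cos c S) a b = (\<Sum>s\<in>S. if 2 ^ fst s = a \<and> 2 ^ snd s = b then c s * pi\<^sup>2 else 0)"
    using I[of 0 0] unfolding pairing_def cos_zero add_0_right mult_1_right .
  show "pairing cos sin (lac_cos c S) a b = 0"
    using I[of 0 "- pi / 2"] unfolding pairing_def sin_eq_cos_shift by (simp add: sum.neutral)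
  show "pairing sin cos (lac_cos c S) a b = 0"
    using I[of "- pi / 2" 0] unfolding pairing_def sin_eq_cos_shift by (simp add: sum.neutral)
  show "pairing sin sin (lac_cos c S) a b = 0"
    using I[of "- pi / 2" "- pi / 2"] unfolding pairing_def sin_eq_cos_shift by (simp add: sum.neutral)
qed

lemma lacunary_pairing:
  assumes "has_lacunary_fourier_series f lam"
  shows "pairing cos cos f (2 ^ i) (2 ^ j) = pi\<^sup>2 * lam i j"
    and "\<nexists>i j. m = 2 ^ i \<and> n = 2 ^ j \<Longrightarrow> pairing cos cos f m n = 0"
    and "pairing cos sin f m n = 0" "pairing sin cos f m n = 0" "pairing sin sin f m n = 0"
proof -
  have z: "fourier_coeff u v f m n = 0 \<longleftrightarrow> pairing u v f m n = 0" for u v m n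
    unfolding fourier_coeff_pairing by simp
  show "pairing cos cos f (2 ^ i) (2 ^ j) = pi\<^sup>2 * lam i j"
    using assms unfolding has_lacunary_fourier_series_def fourier_coeff_pairing by (auto simp: field_simps)
  show "\<nexists>i j. m = 2 ^ i \<and> n = 2 ^ j \<Longrightarrow> pairing cos cos f m n = 0"
    "pairing cos sin f m n = 0" "pairing sin cos f m n = 0" "pairing sin sin f m n = 0"
    using assms unfolding has_lacunary_fourier_series_def z by blast+
qed

text \<open>A trigonometric polynomial has finitely many frequencies. As soon as \<open>S\<close>
  contains those of lacunary form, \<open>f\<close> and its partial sum over \<open>S\<close> have
  the same coefficients at all of them.\<close>

lemma lacunary_pairing_trig_poly:
  assumes f: "integrable T2 f" and lac: "has_lacunary_fourier_series f lam" and T: "T \<in> trig_polys"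
  shows "\<exists>S0. finite S0 \<and> (\<forall>S. finite S \<and> S0 \<subseteq> S \<longrightarrow>
     (LINT z|T2. f z * T z) = (LINT z|T2. lac_cos (case_prod lam) S z * T z))"
  using T
proof induction
  case (base m \<theta> n \<phi>)
  let ?c = "case_prod lam"
  have F: "(LINT z|T2. f z * (cos (of_int m * fst z + \<theta>) * cos (of_int n * snd z + \<phi>)))
       = cos \<theta> * cos \<phi> * pairing cos cos f (nat \<bar>m\<bar>) (nat \<bar>n\<bar>)"
    by (rule integral_T2_mult_base[OF f]) (use lacunary_pairing[OF lac] in auto)
  have G: "(LINT z|T2. lac_cos ?c S z * (cos (of_int m * fst z + \<theta>) * cos (of_int n * snd z + \<phi>)))
       = cos \<theta> * cos \<phi> * pairing cos cos (lac_cos ?c S) (nat \<bar>m\<bar>) (nat \<bar>n\<bar>)" if "finite S" for S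
    by (rule integral_T2_mult_base) (use pairing_lac_cos[OF that] in \<open>auto intro: integrable_T2_continuous continuous_on_lac_poly\<close>)
  show ?case
  proof (cases "\<exists>i j. nat \<bar>m\<bar> = 2 ^ i \<and> nat \<bar>n\<bar> = 2 ^ j")
    case True
    then obtain i j where ij: "nat \<bar>m\<bar> = 2 ^ i" "nat \<bar>n\<bar> = 2 ^ j" by blast
    have "pairing cos cos (lac_cos ?c S) (2 ^ i) (2 ^ j) = pi\<^sup>2 * lam i j" if S: "finite S" "(i, j) \<in> S" for S
    proof -
      have "pairing cos cos (lac_cos ?c S) (2 ^ i) (2 ^ j) = (\<Sum>s\<in>S. if s = (i, j) then ?c s * pi\<^sup>2 else 0)"
        unfolding pairing_lac_cos[OF S(1)] by (intro sum.cong refl) (auto simp: prod_eq_iff)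
      then show ?thesis using S by (simp add: sum.delta)
    qed
    then show ?thesis
      unfolding F ij lacunary_pairing(1)[OF lac]
      by (intro exI[of _ "{(i, j)}"]) (simp add: G[unfolded ij])
  next
    case False
    then have "pairing cos cos (lac_cos ?c S) (nat \<bar>m\<bar>) (nat \<bar>n\<bar>) = 0" if S: "finite S" for S
      unfolding pairing_lac_cos[OF S] by (intro sum.neutral ballI) metis
    moreover have "pairing cos cos f (nat \<bar>m\<bar>) (nat \<bar>n\<bar>) = 0"
      by (rule lacunary_pairing(2)[OF lac]) (use False in blast)
    ultimately show ?thesis unfolding F using G by (intro exI[of _ "{}"]) simp
  qed
next
  case (add g h)
  let ?c = "case_prod lam"
  obtain S1 where S1: "finite S1" "\<And>S. finite S \<Longrightarrow> S1 \<subseteq> S \<Longrightarrow> (LINT z|T2. f z * g z) = (LINT z|T2. lac_cos ?c S z * g z)"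
    using add.IH(1) by blast
  obtain S2 where S2: "finite S2" "\<And>S. finite S \<Longrightarrow> S2 \<subseteq> S \<Longrightarrow> (LINT z|T2. f z * h z) = (LINT z|T2. lac_cos ?c S z * h z)"
    using add.IH(2) by blast
  have int: "integrable T2 (\<lambda>z. u z * t z)" if "integrable T2 u" "t \<in> trig_polys" for u t :: "real \<times> real \<Rightarrow> real"
    using trig_polys_bounded[OF that(2)] continuous_on_trig_polys[OF that(2)] integrable_T2_mult_bounded[OF that(1)] by metis
  have il: "integrable T2 (lac_cos ?c S)" for S by (intro integrable_T2_continuous continuous_on_lac_poly)
  have "(LINT z|T2. f z * (g z + h z)) = (LINT z|T2. lac_cos ?c S z * (g z + h z))"
    if "finite S" "S1 \<union> S2 \<subseteq> S" for S
    using S1(2)[of S] S2(2)[of S] that int[OF f add.hyps(1)] int[OF f add.hyps(2)]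
      int[OF il add.hyps(1)] int[OF il add.hyps(2)]
    by (simp add: distrib_left)
  then show ?case using S1(1) S2(1) by (intro exI[of _ "S1 \<union> S2"]) blast
next
  case (scale g c)
  have "(LINT z|T2. u z * (c * g z)) = c * (LINT z|T2. u z * g z)" for u :: "real \<times> real \<Rightarrow> real"
    by (simp add: mult.left_commute)
  note c = this
  obtain S0 where S0: "finite S0" "\<And>S. finite S \<Longrightarrow> S0 \<subseteq> S \<Longrightarrow>
     (LINT z|T2. f z * g z) = (LINT z|T2. lac_cos (case_prod lam) S z * g z)"
    using scale.IH by blast
  show ?case
    unfolding c by (intro exI[of _ S0] conjI allI impI S0(1) arg_cong[where f = "(*) c"] S0(2)) auto
qed

section \<open>Convergence of the partial sums in norm\<close>

lemma abs_add_powr_le: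
  fixes a b p :: real
  assumes "p \<ge> 0"
  shows "\<bar>a + b\<bar> powr p \<le> 2 powr p * (\<bar>a\<bar> powr p + \<bar>b\<bar> powr p)"
proof -
  have "\<bar>a + b\<bar> powr p \<le> (2 * max \<bar>a\<bar> \<bar>b\<bar>) powr p" using assms by (intro powr_mono2) auto
  also have "\<dots> = 2 powr p * max \<bar>a\<bar> \<bar>b\<bar> powr p" by (simp add: powr_mult)
  also have "max \<bar>a\<bar> \<bar>b\<bar> powr p \<le> \<bar>a\<bar> powr p + \<bar>b\<bar> powr p" by (auto simp: max_def)
  finally show ?thesis by simp
qed

lemma Lp_space_add:
  assumes p: "p \<ge> 0" and f: "f \<in> Lp_space p" and g: "g \<in> Lp_space p"
  shows "(\<lambda>z. f z + g z) \<in> Lp_space p"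
  unfolding Lp_space_iff
proof (intro conjI)
  have [measurable]: "f \<in> borel_measurable lebesgue" "g \<in> borel_measurable lebesgue"
    using f g by (auto simp: Lp_space_iff)
  show m: "(\<lambda>z. f z + g z) \<in> borel_measurable lebesgue" by measurable
  show "doubly_periodic (\<lambda>z. f z + g z)" using f g by (auto simp: Lp_space_iff doubly_periodic_def)
  have [measurable]: "(\<lambda>z. f z + g z) \<in> borel_measurable T2" using m by (rule borel_measurable_T2I)
  show "integrable T2 (\<lambda>z. \<bar>f z + g z\<bar> powr p)"
  proof (rule Bochner_Integration.integrable_bound)
    show "integrable T2 (\<lambda>z. 2 powr p * (\<bar>f z\<bar> powr p + \<bar>g z\<bar> powr p))"
      using f g by (auto simp: Lp_space_iff)
    show "AE z in T2. norm (\<bar>f z + g z\<bar> powr p) \<le> norm (2 powr p * (\<bar>f z\<bar> powr p + \<bar>g z\<bar> powr p))"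
      using abs_add_powr_le[OF p] by (intro AE_I2) simp
  qed measurable
qed

lemma Lp_space_minus: "f \<in> Lp_space p \<Longrightarrow> (\<lambda>z. - f z) \<in> Lp_space p"
  unfolding Lp_space_iff by (auto simp: doubly_periodic_def)

lemma Lp_space_diff:
  "p \<ge> 0 \<Longrightarrow> f \<in> Lp_space p \<Longrightarrow> g \<in> Lp_space p \<Longrightarrow> (\<lambda>z. f z - g z) \<in> Lp_space p"
  using Lp_space_add[OF _ _ Lp_space_minus] by simp

lemma lac_poly_in_Lp_space:
  assumes "p > 0"
  shows "lac_poly c \<theta> \<phi> S \<in> Lp_space p"
  unfolding Lp_space_iff
proof (intro conjI)
  show "lac_poly c \<theta> \<phi> S \<in> borel_measurable lebesgue"
    by (intro measurable_completion) (simp add: borel_measurable_continuous_onI continuous_on_lac_poly)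
  show "integrable T2 (\<lambda>z. \<bar>lac_poly c \<theta> \<phi> S z\<bar> powr p)"
    by (intro integrable_T2_abs_powr_continuous continuous_on_lac_poly assms)
  have "cos (2 ^ i * (x + 2 * pi) + t) = cos (2 ^ i * x + t)" for i :: nat and x t
  proof -
    have "2 ^ i * (x + 2 * pi) + t = (2 ^ i * x + t) + 2 * pi * real_of_int (2 ^ i)"
      by (simp add: algebra_simps)
    moreover have "cos (u + 2 * pi * real_of_int k) = cos u" for u k
      unfolding cos_add[of u] sin_int_2pin cos_int_2pin by simp
    ultimately show ?thesis by metis
  qed
  then show "doubly_periodic (lac_poly c \<theta> \<phi> S)"
    by (simp add: doubly_periodic_def lac_poly_def)
qed

text \<open>Pairing \<open>f\<close> with its own partial sums bounds the squares of the
  coefficients, as in Bessel's inequality but with the norms for \<open>p\<close> and the conjugate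
  exponent. For the convergence, pair the error with a trigonometric polynomial: \<open>f\<close>
  may be replaced by a longer partial sum, so the error acts like a lacunary sum over the added
  indices, whose norm is controlled by the tail of the squares.\<close>

lemma lacunary_approximation:
  assumes p: "p > 1" and f: "f \<in> Lambda_class p"
  shows "\<exists>lam B. (\<forall>S. finite S \<longrightarrow> (\<Sum>s\<in>S. (lam s)\<^sup>2) \<le> B) \<and>
    (\<forall>e>0. \<exists>S0. finite S0 \<and> (\<forall>S. finite S \<and> S0 \<subseteq> S \<longrightarrow> Lp_norm p (\<lambda>z. f z - lac_cos lam S z) \<le> e))"
proof -
  from f obtain lam where fp: "f \<in> Lp_space p" and lac: "has_lacunary_fourier_series f lam"
    by (auto simp: Lambda_class_def Lp0_space_def)
  define c where "c = case_prod lam"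
  have fm: "f \<in> borel_measurable T2" and fi: "integrable T2 (\<lambda>z. \<bar>f z\<bar> powr p)"
    using fp by (auto simp: Lp_space_iff intro: borel_measurable_T2I)
  have fint: "integrable T2 f" using integrable_T2_of_abs_powr[OF _ fm fi] p by simp
  have p0: "p > 0" using p by simp
  obtain q where q: "q > 1" "1 / p + 1 / q = 1" using conjugate_exponent[OF p] .
  obtain C where C: "C > 0" "\<And>S c \<theta> \<phi>. finite S \<Longrightarrow> Lp_norm q (lac_poly c \<theta> \<phi> S) \<le> C * sqrt (\<Sum>s\<in>S. (c s)\<^sup>2)"
    using Lp_norm_lac_poly_le[of q] q by auto
  obtain D where D: "D > 0" "\<And>S c \<theta> \<phi>. finite S \<Longrightarrow> Lp_norm p (lac_poly c \<theta> \<phi> S) \<le> D * sqrt (\<Sum>s\<in>S. (c s)\<^sup>2)"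
    using Lp_norm_lac_poly_le[OF p0] by auto
  have lm: "lac_cos c S \<in> borel_measurable T2" for S
    by (intro borel_measurable_T2_continuous continuous_on_lac_poly)
  have li: "integrable T2 (\<lambda>z. \<bar>lac_cos c S z\<bar> powr r)" if "r > 0" for r S
    by (intro integrable_T2_abs_powr_continuous continuous_on_lac_poly that)
  have bound: "(\<Sum>s\<in>S. (c s)\<^sup>2) \<le> (C * Lp_norm p f / pi\<^sup>2)\<^sup>2" if S: "finite S" for S
  proof -
    define L where "L = sqrt (\<Sum>s\<in>S. (c s)\<^sup>2)"
    have L: "L \<ge> 0" "L\<^sup>2 = (\<Sum>s\<in>S. (c s)\<^sup>2)" unfolding L_def by (simp_all add: sum_nonneg)
    have int: "integrable T2 (\<lambda>z. f z * (cos (real a * fst z) * cos (real b * snd z)))" for a b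
    proof (rule integrable_T2_mult_bounded[OF fint])
      show "\<bar>cos (real a * fst z) * cos (real b * snd z)\<bar> \<le> 1 * 1" for z :: "real \<times> real"
        unfolding abs_mult by (intro mult_mono) auto
    qed (intro continuous_intros)
    have "(LINT z|T2. f z * lac_cos c S z)
        = (LINT z|T2. (\<Sum>s\<in>S. c s * (f z * (cos (real (2 ^ fst s) * fst z) * cos (real (2 ^ snd s) * snd z)))))"
      unfolding lac_poly_def sum_distrib_left case_prod_unfold prod.collapse add_0_right
      by (intro Bochner_Integration.integral_cong refl sum.cong) (simp only: mult_ac of_nat_power of_nat_numeral)
    also have "\<dots> = (\<Sum>s\<in>S. LINT z|T2. c s * (f z * (cos (real (2 ^ fst s) * fst z) * cos (real (2 ^ snd s) * snd z))))"
      by (intro Bochner_Integration.integral_sum integrable_mult_right int)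
    also have "\<dots> = (\<Sum>s\<in>S. c s * pairing cos cos f (2 ^ fst s) (2 ^ snd s))"
      unfolding pairing_def by (simp only: integral_mult_right_zero)
    also have "\<dots> = pi\<^sup>2 * L\<^sup>2"
      unfolding lacunary_pairing(1)[OF lac] L sum_distrib_left c_def
      by (intro sum.cong refl) (simp add: case_prod_unfold power2_eq_square)
    finally have "pi\<^sup>2 * L\<^sup>2 \<le> Lp_norm p f * Lp_norm q (lac_cos c S)"
      using Holder_T2(2)[OF p q fm lm fi li[of q S]] q by auto
    also have "\<dots> \<le> Lp_norm p f * (C * L)"
      unfolding L_def by (intro mult_left_mono C S Lp_norm_nonneg)
    finally have "L * (pi\<^sup>2 * L) \<le> L * (C * Lp_norm p f)"
      by (simp add: power2_eq_square mult_ac)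
    then have "L = 0 \<or> pi\<^sup>2 * L \<le> C * Lp_norm p f"
      using L(1) by (auto simp: mult_le_cancel_left)
    then have "pi\<^sup>2 * L \<le> C * Lp_norm p f"
      using C(1) Lp_norm_nonneg[of p f] by auto
    then have "L \<le> C * Lp_norm p f / pi\<^sup>2" by (simp add: pos_le_divide_eq mult.commute)
    then show ?thesis unfolding L(2)[symmetric] using L(1) by (intro power_mono)
  qed
  define A where "A = (SUP S\<in>{S. finite S}. \<Sum>s\<in>S. (c s)\<^sup>2)"
  have bdd: "bdd_above ((\<lambda>S. \<Sum>s\<in>S. (c s)\<^sup>2) ` {S. finite S})"
    using bound by (intro bdd_aboveI2) auto
  have le_A: "(\<Sum>s\<in>S. (c s)\<^sup>2) \<le> A" if "finite S" for S
    unfolding A_def by (rule cSUP_upper[OF _ bdd]) (use that in simp)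
  have conv: "\<exists>S0. finite S0 \<and> (\<forall>S. finite S \<and> S0 \<subseteq> S \<longrightarrow> Lp_norm p (\<lambda>z. f z - lac_cos c S z) \<le> e)" if e: "e > 0" for e
  proof -
    have ne: "{S :: (nat \<times> nat) set. finite S} \<noteq> {}" by auto
    \<comment> \<open>Beyond \<open>S0\<close> the squares then add up to at most
      \<open>(e / D)\<^sup>2\<close>, and the factor \<open>D\<close> of the upper norm estimate
      turns this into \<open>e\<close>.\<close>
    have "A - (e / D)\<^sup>2 < A" using e D by simp
    then obtain S0 where S0: "finite S0" "A - (e / D)\<^sup>2 < (\<Sum>s\<in>S0. (c s)\<^sup>2)"
      using less_cSUP_iff[OF ne bdd, of "A - (e / D)\<^sup>2", folded A_def] by blast
    have "Lp_norm p (\<lambda>z. f z - lac_cos c S z) \<le> e" if S: "finite S" "S0 \<subseteq> S" for S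
    proof (rule Lp_norm_le_by_duality[OF p q])
      have d: "(\<lambda>z. f z - lac_cos c S z) \<in> Lp_space p"
        by (intro Lp_space_diff fp lac_poly_in_Lp_space) (use p in auto)
      then show "(\<lambda>z. f z - lac_cos c S z) \<in> borel_measurable T2" "integrable T2 (\<lambda>z. \<bar>f z - lac_cos c S z\<bar> powr p)"
        by (auto simp: Lp_space_iff intro: borel_measurable_T2I)
      show "e \<ge> 0" using e by simp
      fix T assume T: "T \<in> trig_polys"
      obtain S1 where S1: "finite S1" "\<And>S. finite S \<Longrightarrow> S1 \<subseteq> S \<Longrightarrow> (LINT z|T2. f z * T z) = (LINT z|T2. lac_cos c S z * T z)"
        using lacunary_pairing_trig_poly[OF fint lac T] unfolding c_def by blast
      \<comment> \<open>\<open>S'\<close> depends on the test polynomial \<open>T\<close>, but the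
        bound for the tail over \<open>S' - S\<close> does not.\<close>
      define S' where "S' = S \<union> S1"
      have S': "finite S'" "S1 \<subseteq> S'" "S \<subseteq> S'" unfolding S'_def using S S1 by auto
      have int: "integrable T2 (\<lambda>z. u z * T z)" if "integrable T2 u" for u :: "real \<times> real \<Rightarrow> real"
        using trig_polys_bounded[OF T] continuous_on_trig_polys[OF T] integrable_T2_mult_bounded[OF that] by metis
      have il: "integrable T2 (lac_cos c S)" for S by (intro integrable_T2_continuous continuous_on_lac_poly)
      have split: "lac_cos c S' z - lac_cos c S z = lac_cos c (S' - S) z" for z
        unfolding lac_poly_def by (rule sum_diff[OF S'(1,3), symmetric])
      have "(LINT z|T2. (f z - lac_cos c S z) * T z) = (LINT z|T2. f z * T z) - (LINT z|T2. lac_cos c S z * T z)"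
        using int[OF fint] int[OF il] by (simp add: left_diff_distrib)
      also have "\<dots> = (LINT z|T2. (lac_cos c S' z - lac_cos c S z) * T z)"
        unfolding S1(2)[OF S'(1,2)] using int[OF il] by (simp add: left_diff_distrib)
      also have "\<dots> = (LINT z|T2. lac_cos c (S' - S) z * T z)" unfolding split ..
      finally have "\<bar>LINT z|T2. (f z - lac_cos c S z) * T z\<bar> \<le> Lp_norm p (lac_cos c (S' - S)) * Lp_norm q T"
        using Holder_T2(2)[OF p q lm borel_measurable_trig_polys[OF T] li integrable_T2_abs_powr_continuous[OF continuous_on_trig_polys[OF T]]]
          p q by simp
      also have "Lp_norm p (lac_cos c (S' - S)) \<le> e"
      proof -
        have "(\<Sum>s\<in>S' - S. (c s)\<^sup>2) = (\<Sum>s\<in>S'. (c s)\<^sup>2) - (\<Sum>s\<in>S. (c s)\<^sup>2)"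
          by (rule sum_diff[OF S'(1,3)])
        also have "\<dots> \<le> A - (\<Sum>s\<in>S0. (c s)\<^sup>2)"
          by (intro diff_mono le_A S' sum_mono2 S) auto
        also have "\<dots> \<le> (e / D)\<^sup>2" using S0(2) by simp
        finally have "sqrt (\<Sum>s\<in>S' - S. (c s)\<^sup>2) \<le> e / D"
          using e D by (intro real_le_lsqrt) auto
        then have "D * sqrt (\<Sum>s\<in>S' - S. (c s)\<^sup>2) \<le> e" using D by (simp add: field_simps)
        then show ?thesis using D(2)[of "S' - S" c "\<lambda>_. 0" "\<lambda>_. 0"] S' by simp
      qed
      finally show "\<bar>LINT z|T2. (f z - lac_cos c S z) * T z\<bar> \<le> e * Lp_norm q T"
        by (simp add: mult_right_mono Lp_norm_nonneg)
    qed
    then show ?thesis using S0(1) by blast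
  qed
  show ?thesis using bound conv by blast
qed

subsection \<open>Series of translates\<close>

text \<open>By convexity the graph lies above its tangent at \<open>m\<close>; here this is Young's
  inequality for \<open>x\<close> and \<open>m powr (p - 1)\<close>, where equality holds at
  \<open>x = m\<close>.\<close>

lemma powr_tangent_le:
  fixes x m p :: real
  assumes p: "p > 1" and x: "x \<ge> 0" and m: "m \<ge> 0"
  shows "m powr p + p * m powr (p - 1) * (x - m) \<le> x powr p"
proof (cases "m = 0")
  case False
  define q where "q = p / (p - 1)"
  have q: "q > 1" "1 / p + 1 / q = 1" and pq: "(p - 1) * q = p"
    unfolding q_def using p by (simp_all add: field_simps)
  have "x * m powr (p - 1) \<le> x powr p / p + (m powr (p - 1)) powr q / q"
    by (rule Youngs_inequality[OF p q x]) simp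
  also have "(m powr (p - 1)) powr q = m powr p" by (simp add: powr_powr pq)
  finally have "p * (x * m powr (p - 1)) \<le> p * (x powr p / p + m powr p / q)"
    using p by (intro mult_left_mono) auto
  also have "\<dots> = x powr p + (p - 1) * m powr p"
    unfolding q_def using p by (simp add: field_simps)
  finally have "p * (x * m powr (p - 1)) \<le> x powr p + (p - 1) * m powr p" .
  moreover have "m powr (p - 1) * m = m powr p" using m False by (simp add: powr_mult_base mult.commute)
  moreover have "p * m powr (p - 1) * (x - m) = p * (x * m powr (p - 1)) - p * (m powr (p - 1) * m)"
    by (simp add: algebra_simps)
  ultimately show ?thesis by (simp add: left_diff_distrib)
qed (use p in simp)

text \<open>Jensen's inequality for the weights \<open>\<bar>c n\<bar>\<close> of total mass
  \<open>C\<close>. The tangent is taken at the weighted mean \<open>m = A / C\<close>, so that its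
  linear part cancels upon summation.\<close>

lemma Jensen_series_powr:
  fixes c v :: "nat \<Rightarrow> real"
  assumes p: "p > 1" and c: "summable (\<lambda>n. \<bar>c n\<bar>)" and v: "summable (\<lambda>n. \<bar>c n\<bar> * \<bar>v n\<bar> powr p)"
  shows "summable (\<lambda>n. \<bar>c n * v n\<bar>)"
    and "\<bar>\<Sum>n. c n * v n\<bar> powr p \<le> (\<Sum>n. \<bar>c n\<bar>) powr (p - 1) * (\<Sum>n. \<bar>c n\<bar> * \<bar>v n\<bar> powr p)"
proof -
  have le1: "\<bar>x\<bar> \<le> 1 + \<bar>x\<bar> powr p" for x :: real
  proof (cases "\<bar>x\<bar> \<le> 1")
    case False
    then have "\<bar>x\<bar> powr 1 \<le> \<bar>x\<bar> powr p" using p by (intro powr_mono) auto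
    then show ?thesis using False by simp
  qed (smt (verit) powr_ge_zero)
  show s: "summable (\<lambda>n. \<bar>c n * v n\<bar>)"
  proof (rule summable_comparison_test')
    show "summable (\<lambda>n. \<bar>c n\<bar> + \<bar>c n\<bar> * \<bar>v n\<bar> powr p)" by (intro summable_add c v)
    have "\<bar>c n\<bar> * \<bar>v n\<bar> \<le> \<bar>c n\<bar> * (1 + \<bar>v n\<bar> powr p)" for n by (intro mult_left_mono le1) auto
    then show "norm \<bar>c n * v n\<bar> \<le> \<bar>c n\<bar> + \<bar>c n\<bar> * \<bar>v n\<bar> powr p" for n
      by (simp add: abs_mult distrib_left)
  qed
  define C where "C = (\<Sum>n. \<bar>c n\<bar>)"
  define A where "A = (\<Sum>n. \<bar>c n\<bar> * \<bar>v n\<bar>)"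
  define B where "B = (\<Sum>n. \<bar>c n\<bar> * \<bar>v n\<bar> powr p)"
  have sA: "summable (\<lambda>n. \<bar>c n\<bar> * \<bar>v n\<bar>)" using s by (simp add: abs_mult)
  have A0: "A \<ge> 0" unfolding A_def by (intro suminf_nonneg sA) auto
  have "\<bar>\<Sum>n. c n * v n\<bar> \<le> A"
    unfolding A_def using summable_rabs[OF s] by (simp add: abs_mult)
  then have 1: "\<bar>\<Sum>n. c n * v n\<bar> powr p \<le> A powr p" using p by (intro powr_mono2) auto
  have "A powr p \<le> C powr (p - 1) * B"
  proof (cases "C = 0")
    case True
    then have "c n = 0" for n
      using suminf_eq_zero_iff[OF c] unfolding C_def by auto
    then show ?thesis unfolding A_def B_def by simp
  next
    case False
    then have C: "C > 0" unfolding C_def using suminf_nonneg[OF c] by auto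
    define m where "m = A / C"
    have m: "m \<ge> 0" unfolding m_def using A0 C by simp
    define k where "k = p * m powr (p - 1)"
    have sum1: "(\<lambda>n. \<bar>c n\<bar> * (m powr p + k * (\<bar>v n\<bar> - m))) sums (C * m powr p + k * (A - m * C))"
    proof -
      have "(\<lambda>n. \<bar>c n\<bar> * m powr p + k * (\<bar>c n\<bar> * \<bar>v n\<bar> - m * \<bar>c n\<bar>)) sums (C * m powr p + k * (A - m * C))"
        unfolding A_def C_def
        by (intro sums_add sums_diff sums_mult sums_mult2 summable_sums c sA)
      then show ?thesis by (simp add: algebra_simps)
    qed
    have "C * m powr p + k * (A - m * C) \<le> B"
      unfolding B_def
    proof (rule sums_le[OF _ sum1 summable_sums[OF v]])
      show "\<bar>c n\<bar> * (m powr p + k * (\<bar>v n\<bar> - m)) \<le> \<bar>c n\<bar> * \<bar>v n\<bar> powr p" for n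
        unfolding k_def by (intro mult_left_mono powr_tangent_le p m) auto
    qed
    moreover have "A - m * C = 0" unfolding m_def using C by simp
    ultimately have "C * m powr p \<le> B" by simp
    then have "C powr (p - 1) * (C * m powr p) \<le> C powr (p - 1) * B" by (intro mult_left_mono) auto
    moreover have "C powr (p - 1) * (C * m powr p) = A powr p"
    proof -
      have "C powr (p - 1) * C = C powr p" using C by (simp add: powr_mult_base mult.commute)
      moreover have "C powr p * m powr p = A powr p"
        unfolding m_def using C A0 by (subst powr_mult[symmetric]) auto
      ultimately show ?thesis by (metis mult.assoc)
    qed
    ultimately show ?thesis by simp
  qed
  with 1 show "\<bar>\<Sum>n. c n * v n\<bar> powr p \<le> (\<Sum>n. \<bar>c n\<bar>) powr (p - 1) * (\<Sum>n. \<bar>c n\<bar> * \<bar>v n\<bar> powr p)"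
    unfolding C_def B_def by linarith
qed

text \<open>Common form of the differences in both variables, so that measurability, convergence and
  norm bounds are proved once for arbitrary absolutely summable weights and arbitrary
  shifts.\<close>

definition translate_series :: "(nat \<Rightarrow> real) \<Rightarrow> (nat \<Rightarrow> real \<times> real) \<Rightarrow> (real \<times> real \<Rightarrow> real) \<Rightarrow> real \<times> real \<Rightarrow> real" where
  "translate_series c a u z = (\<Sum>\<nu>. c \<nu> * u (z + a \<nu>))"

text \<open>Integrate the right side of Jensen's inequality term by term. Translation invariance
  gives all terms the same integral up to the weight, so the total is finite; hence the series of
  powers is finite almost everywhere, which yields both the convergence and the bound.\<close>

lemma translate_series_AE:
  fixes u :: "real \<times> real \<Rightarrow> real"
  assumes p: "p > 1" and c: "summable (\<lambda>n. \<bar>c n\<bar>)"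
    and u[measurable]: "u \<in> borel_measurable lebesgue" and per: "doubly_periodic u"
    and up: "integrable T2 (\<lambda>z. \<bar>u z\<bar> powr p)"
  shows "AE z in T2. summable (\<lambda>n. \<bar>c n * u (z + a n)\<bar>)"
    and "integrable T2 (\<lambda>z. \<bar>translate_series c a u z\<bar> powr p)"
    and "(LINT z|T2. \<bar>translate_series c a u z\<bar> powr p) \<le> (\<Sum>n. \<bar>c n\<bar>) powr p * (LINT z|T2. \<bar>u z\<bar> powr p)"
    and "translate_series c a u \<in> borel_measurable lebesgue"
    and "doubly_periodic (translate_series c a u)"
proof -
  define C where "C = (\<Sum>n. \<bar>c n\<bar>)"
  have C0: "C \<ge> 0" unfolding C_def by (intro suminf_nonneg c) auto
  define I where "I = (LINT z|T2. \<bar>u z\<bar> powr p)"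
  have I0: "I \<ge> 0" unfolding I_def by simp
  have ua[measurable]: "(\<lambda>z. u (z + b)) \<in> borel_measurable lebesgue" for b
    by (rule measurable_compose[OF measurable_lebesgue_translation u])
  have uT[measurable]: "(\<lambda>z. u (z + b)) \<in> borel_measurable T2" for b
    by (rule measurable_restrict_space1[OF ua])
  show m: "translate_series c a u \<in> borel_measurable lebesgue"
    unfolding translate_series_def by measurable
  have mT[measurable]: "translate_series c a u \<in> borel_measurable T2"
    by (rule measurable_restrict_space1[OF m])
  show "doubly_periodic (translate_series c a u)"
  proof -
    have "u ((x + 2 * pi, y) + b) = u ((x, y) + b)" "u ((x, y + 2 * pi) + b) = u ((x, y) + b)" for x y b
      using per[unfolded doubly_periodic_def, rule_format, of "x + fst b" "y + snd b"]
      by (simp_all add: plus_prod_def algebra_simps)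
    then show ?thesis unfolding doubly_periodic_def translate_series_def by simp
  qed
  have shift: "(\<integral>\<^sup>+z. ennreal (\<bar>u (z + b)\<bar> powr p) \<partial>T2) = ennreal I" for b
  proof -
    have "(\<integral>\<^sup>+z. ennreal (\<bar>u (z + b)\<bar> powr p) \<partial>T2) = (\<integral>\<^sup>+z. ennreal (\<bar>u z\<bar> powr p) \<partial>T2)"
    proof (rule nn_integral_T2_translation)
      show "doubly_periodic (\<lambda>z. ennreal (\<bar>u z\<bar> powr p))" using per by (auto simp: doubly_periodic_def)
    qed measurable
    also have "\<dots> = ennreal I" unfolding I_def by (rule nn_integral_eq_integral[OF up]) auto
    finally show ?thesis .
  qed
  have total: "(\<integral>\<^sup>+z. (\<Sum>n. ennreal (\<bar>c n\<bar> * \<bar>u (z + a n)\<bar> powr p)) \<partial>T2) = ennreal (C * I)"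
  proof -
    have "(\<integral>\<^sup>+z. (\<Sum>n. ennreal (\<bar>c n\<bar> * \<bar>u (z + a n)\<bar> powr p)) \<partial>T2)
       = (\<Sum>n. \<integral>\<^sup>+z. ennreal \<bar>c n\<bar> * ennreal (\<bar>u (z + a n)\<bar> powr p) \<partial>T2)"
      by (subst nn_integral_suminf) (simp_all add: ennreal_mult)
    also have "\<dots> = (\<Sum>n. ennreal (\<bar>c n\<bar> * I))"
      by (subst nn_integral_cmult) (simp_all add: shift ennreal_mult I0)
    also have "\<dots> = ennreal (\<Sum>n. \<bar>c n\<bar> * I)"
      by (intro suminf_ennreal2 summable_mult2 c) (use I0 in auto)
    also have "(\<Sum>n. \<bar>c n\<bar> * I) = C * I" unfolding C_def by (rule suminf_mult2[OF c, symmetric])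
    finally show ?thesis .
  qed
  have "AE z in T2. (\<Sum>n. ennreal (\<bar>c n\<bar> * \<bar>u (z + a n)\<bar> powr p)) \<noteq> \<infinity>"
    by (rule nn_integral_PInf_AE) (measurable, simp add: total)
  then have AEs: "AE z in T2. summable (\<lambda>n. \<bar>c n\<bar> * \<bar>u (z + a n)\<bar> powr p)"
    by eventually_elim (auto intro!: summable_suminf_not_top)
  then show "AE z in T2. summable (\<lambda>n. \<bar>c n * u (z + a n)\<bar>)"
    by eventually_elim (rule Jensen_series_powr(1)[OF p c])
  have "(\<integral>\<^sup>+z. ennreal (\<bar>translate_series c a u z\<bar> powr p) \<partial>T2)
      \<le> (\<integral>\<^sup>+z. ennreal (C powr (p - 1)) * (\<Sum>n. ennreal (\<bar>c n\<bar> * \<bar>u (z + a n)\<bar> powr p)) \<partial>T2)"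
  proof (rule nn_integral_mono_AE)
    show "AE z in T2. ennreal (\<bar>translate_series c a u z\<bar> powr p)
       \<le> ennreal (C powr (p - 1)) * (\<Sum>n. ennreal (\<bar>c n\<bar> * \<bar>u (z + a n)\<bar> powr p))"
      using AEs
    proof eventually_elim
      case (elim z)
      have "\<bar>translate_series c a u z\<bar> powr p \<le> C powr (p - 1) * (\<Sum>n. \<bar>c n\<bar> * \<bar>u (z + a n)\<bar> powr p)"
        unfolding translate_series_def C_def by (rule Jensen_series_powr(2)[OF p c elim])
      then have "ennreal (\<bar>translate_series c a u z\<bar> powr p)
         \<le> ennreal (C powr (p - 1) * (\<Sum>n. \<bar>c n\<bar> * \<bar>u (z + a n)\<bar> powr p))" by (rule ennreal_leI)
      also have "\<dots> = ennreal (C powr (p - 1)) * (\<Sum>n. ennreal (\<bar>c n\<bar> * \<bar>u (z + a n)\<bar> powr p))"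
        using elim by (subst ennreal_mult) (auto simp: suminf_ennreal2 suminf_nonneg)
      finally show ?case .
    qed
  qed
  also have "\<dots> = ennreal (C powr (p - 1)) * ennreal (C * I)"
    by (subst nn_integral_cmult) (measurable, simp add: total)
  also have "\<dots> = ennreal (C powr p * I)"
  proof -
    have "C powr (p - 1) * (C * I) = C powr p * I"
      using C0 by (cases "C = 0") (simp_all add: powr_mult_base mult.commute mult.left_commute)
    then show ?thesis using C0 I0 by (simp add: ennreal_mult[symmetric])
  qed
  finally have nn: "(\<integral>\<^sup>+z. ennreal (\<bar>translate_series c a u z\<bar> powr p) \<partial>T2) \<le> ennreal (C powr p * I)" .
  show int: "integrable T2 (\<lambda>z. \<bar>translate_series c a u z\<bar> powr p)"
  proof (rule integrableI_bounded)
    show "(\<integral>\<^sup>+z. ennreal (norm (\<bar>translate_series c a u z\<bar> powr p)) \<partial>T2) < \<infinity>"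
      using nn by (simp add: order_le_less_trans[OF nn])
  qed measurable
  have "ennreal (LINT z|T2. \<bar>translate_series c a u z\<bar> powr p) \<le> ennreal (C powr p * I)"
    using nn by (subst (asm) nn_integral_eq_integral[OF int]) auto
  then show "(LINT z|T2. \<bar>translate_series c a u z\<bar> powr p) \<le> (\<Sum>n. \<bar>c n\<bar>) powr p * (LINT z|T2. \<bar>u z\<bar> powr p)"
    unfolding C_def[symmetric] I_def[symmetric] using I0 by (subst (asm) ennreal_le_iff) auto
qed

subsection \<open>Fractional differences\<close>

text \<open>
  With \<open>b n = \<bar>\<alpha> gchoose n\<bar>\<close>, the recursion gives \<open>\<alpha> * b n = n * b n - (n + 1) * b (n + 1)\<close>
  for \<open>n \<ge> \<alpha>\<close>, a telescoping series.
\<close>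

lemma summable_abs_gbinomial:
  fixes \<alpha> :: real
  assumes \<alpha>: "\<alpha> > 0"
  shows "summable (\<lambda>n. \<bar>\<alpha> gchoose n\<bar>)"
proof -
  define b where "b n = \<bar>\<alpha> gchoose n\<bar>" for n
  obtain N :: nat where N: "\<alpha> \<le> real N" using real_arch_simple by blast
  have tele: "\<alpha> * b n = real n * b n - real (Suc n) * b (Suc n)" if "n \<ge> N" for n
  proof -
    have "real (Suc n) * (\<alpha> gchoose Suc n) = (\<alpha> - real n) * (\<alpha> gchoose n)"
      using gbinomial_mult_1[of \<alpha> n] by (simp add: algebra_simps)
    then have "real (Suc n) * b (Suc n) = \<bar>\<alpha> - real n\<bar> * b n"
      unfolding b_def by (metis abs_mult abs_of_nat)
    moreover have "\<bar>\<alpha> - real n\<bar> = real n - \<alpha>" using N that by simp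
    ultimately show ?thesis by (simp add: algebra_simps)
  qed
  have part: "\<alpha> * (\<Sum>k<m. b (k + N)) = real N * b N - real (m + N) * b (m + N)" for m
    by (induction m) (simp_all add: distrib_left tele)
  have "summable (\<lambda>k. b (k + N))"
  proof (rule summableI_nonneg_bounded)
    show "(\<Sum>k<m. b (k + N)) \<le> real N * b N / \<alpha>" for m
      using part[of m] \<alpha> by (simp add: pos_le_divide_eq mult.commute b_def)
  qed (simp add: b_def)
  then show ?thesis unfolding b_def by (rule summable_iff_shift[THEN iffD1])
qed

text \<open>Inside the disc this is the modulus of Newton's series for (1 - z) powr \<alpha>.
  Absolute summability of the coefficients makes the sum continuous on the closed disc, and
  approaching the boundary along radii extends the identity.\<close>

lemma norm_binomial_series:
  fixes z :: complex
  assumes \<alpha>: "\<alpha> > 0" and z: "norm z \<le> 1"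
  shows "norm (\<Sum>n. of_real ((-1) ^ n * (\<alpha> gchoose n)) * z ^ n) = norm (1 - z) powr \<alpha>"
proof -
  define c where "c n = complex_of_real ((-1) ^ n * (\<alpha> gchoose n))" for n
  define f where "f w = (\<Sum>n. c n * w ^ n)" for w
  have "continuous_on (cball 0 1) f"
  proof (rule uniform_limit_theorem)
    show "uniform_limit (cball 0 1) (\<lambda>n w. \<Sum>i<n. c i * w ^ i) f sequentially"
      unfolding f_def
    proof (rule Weierstrass_m_test)
      show "summable (\<lambda>n. \<bar>\<alpha> gchoose n\<bar>)" by (rule summable_abs_gbinomial[OF \<alpha>])
      show "norm (c n * w ^ n) \<le> \<bar>\<alpha> gchoose n\<bar>" if "w \<in> cball 0 1" for n w
      proof -
        have "norm (c n * w ^ n) = \<bar>\<alpha> gchoose n\<bar> * norm w ^ n"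
          unfolding c_def by (simp add: norm_mult norm_power abs_mult)
        also have "\<dots> \<le> \<bar>\<alpha> gchoose n\<bar> * 1"
          using that by (intro mult_left_mono power_le_one) auto
        finally show ?thesis by simp
      qed
    qed
    show "\<forall>\<^sub>F n in sequentially. continuous_on (cball 0 1) (\<lambda>w. \<Sum>i<n. c i * w ^ i)"
      by (intro always_eventually allI continuous_intros)
  qed simp
  define r where "r k = 1 - inverse (real (Suc k))" for k
  have r01: "0 \<le> r k" "r k < 1" for k unfolding r_def by (auto simp: field_simps)
  have "r \<longlonglongrightarrow> 1 - 0" unfolding r_def by (intro tendsto_diff tendsto_const LIMSEQ_inverse_real_of_nat)
  then have rz: "(\<lambda>k. of_real (r k) * z) \<longlonglongrightarrow> z"
    using tendsto_mult[OF tendsto_of_real tendsto_const, of r 1 sequentially z] by simp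
  have rzn: "norm (of_real (r k) * z) < 1" for k
  proof -
    have "norm (of_real (r k) * z) = r k * norm z" using r01(1)[of k] by (simp add: norm_mult)
    also have "\<dots> \<le> r k * 1" using z r01(1)[of k] by (intro mult_left_mono) auto
    finally show ?thesis using r01(2)[of k] by simp
  qed
  have fr: "norm (f (of_real (r k) * z)) = norm (1 - of_real (r k) * z) powr \<alpha>" for k
  proof -
    let ?w = "of_real (r k) * z"
    have "norm (- ?w) < 1" using rzn[of k] by simp
    from gen_binomial_complex[OF this, of "of_real \<alpha>"]
    have "(\<lambda>n. (of_real \<alpha> gchoose n) * (- ?w) ^ n) sums (1 + - ?w) powr of_real \<alpha>" .
    moreover have "(of_real \<alpha> gchoose n) * (- ?w) ^ n = c n * ?w ^ n" for n
      unfolding c_def power_minus[of ?w] by (simp add: gbinomial_prod_rev)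
    ultimately have "f ?w = (1 - ?w) powr of_real \<alpha>"
      unfolding f_def by (simp add: sums_iff)
    then show ?thesis by (simp add: norm_powr_real_powr')
  qed
  have "(\<lambda>k. f (of_real (r k) * z)) \<longlonglongrightarrow> f z"
    by (rule continuous_on_tendsto_compose[OF \<open>continuous_on (cball 0 1) f\<close> rz])
      (use z in simp, intro always_eventually allI, simp add: less_imp_le[OF rzn])
  then have 1: "(\<lambda>k. norm (1 - of_real (r k) * z) powr \<alpha>) \<longlonglongrightarrow> norm (f z)"
    unfolding fr[symmetric] by (rule tendsto_norm)
  have 2: "(\<lambda>k. norm (1 - of_real (r k) * z) powr \<alpha>) \<longlonglongrightarrow> norm (1 - z) powr \<alpha>"
    by (rule tendsto_powr') (intro tendsto_intros rz | use \<alpha> in simp)+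
  from LIMSEQ_unique[OF 1 2] show ?thesis unfolding f_def c_def .
qed

lemma norm_one_minus_cis: "norm (1 - cis t) = \<bar>2 * sin (t / 2)\<bar>"
proof -
  have "(norm (1 - cis t))\<^sup>2 = (1 - cos t)\<^sup>2 + (sin t)\<^sup>2" by (simp add: cmod_power2)
  also have "\<dots> = 2 - 2 * cos t"
    using sin_cos_squared_add[of t] by (simp add: power2_eq_square algebra_simps)
  also have "cos t = 1 - 2 * (sin (t / 2))\<^sup>2" using cos_double_sin[of "t / 2"] by simp
  finally have "(norm (1 - cis t))\<^sup>2 = \<bar>2 * sin (t / 2)\<bar>\<^sup>2" by (simp add: power_mult_distrib)
  then show ?thesis by (simp only: power2_eq_iff_nonneg norm_ge_zero abs_ge_zero)
qed

text \<open>The sum is the real part of cis (\<phi> + \<alpha> t) times a binomial series in cis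
  (-t), whose modulus is known. Its argument together with \<alpha> t is the phase, which therefore
  does not depend on \<phi>.\<close>

lemma difference_of_cos:
  assumes \<alpha>: "\<alpha> > 0"
  shows "\<exists>\<theta>. \<forall>\<phi>. (\<lambda>\<nu>. (-1) ^ \<nu> * (\<alpha> gchoose \<nu>) * cos (\<phi> + (\<alpha> - real \<nu>) * t))
           sums (\<bar>2 * sin (t / 2)\<bar> powr \<alpha> * cos (\<phi> + \<theta>))"
proof -
  define c where "c n = (-1) ^ n * (\<alpha> gchoose n)" for n
  define S where "S = (\<Sum>n. of_real (c n) * cis (- t) ^ n)"
  have nS: "norm S = \<bar>2 * sin (t / 2)\<bar> powr \<alpha>"
    unfolding S_def c_def by (subst norm_binomial_series[OF \<alpha>]) (simp_all add: norm_one_minus_cis)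
  have "summable (\<lambda>n. of_real (c n) * cis (- t) ^ n)"
    by (rule summable_norm_cancel)
      (use summable_abs_gbinomial[OF \<alpha>] in \<open>simp add: norm_mult norm_power c_def abs_mult\<close>)
  then have S: "(\<lambda>n. of_real (c n) * cis (- t) ^ n) sums S" unfolding S_def by (rule summable_sums)
  have "(\<lambda>\<nu>. c \<nu> * cos (\<phi> + (\<alpha> - real \<nu>) * t)) sums (\<bar>2 * sin (t / 2)\<bar> powr \<alpha> * cos (\<phi> + (\<alpha> * t + Arg S)))" for \<phi>
  proof -
    have "(\<lambda>n. Re (cis (\<phi> + \<alpha> * t) * (of_real (c n) * cis (- t) ^ n))) sums Re (cis (\<phi> + \<alpha> * t) * S)"
      by (intro sums_Re sums_mult S)
    moreover have "Re (cis (\<phi> + \<alpha> * t) * (of_real (c n) * cis (- t) ^ n)) = c n * cos (\<phi> + (\<alpha> - real n) * t)" for n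
    proof -
      have e: "cis (\<phi> + \<alpha> * t) * (of_real (c n) * cis (- t) ^ n) = of_real (c n) * cis (\<phi> + (\<alpha> - real n) * t)"
      proof -
        have "cis (\<phi> + \<alpha> * t) * cis (- t) ^ n = cis (\<phi> + (\<alpha> - real n) * t)"
          unfolding Complex.DeMoivre cis_mult by (rule arg_cong[where f = cis]) (simp add: algebra_simps)
        then show ?thesis by (metis mult.left_commute)
      qed
      show ?thesis unfolding e by simp
    qed
    moreover have "Re (cis (\<phi> + \<alpha> * t) * S) = norm S * cos (\<phi> + (\<alpha> * t + Arg S))"
    proof -
      have "S = of_real (norm S) * cis (Arg S)" using rcis_cmod_Arg[of S] by (simp add: rcis_def)
      then have e: "cis (\<phi> + \<alpha> * t) * S = of_real (norm S) * cis (\<phi> + (\<alpha> * t + Arg S))"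
        by (metis cis_mult mult.left_commute add.assoc)
      show ?thesis unfolding e by simp
    qed
    ultimately show ?thesis unfolding nS by simp
  qed
  then show ?thesis unfolding c_def by blast
qed

text \<open>An elementary substitute for Minkowski's inequality: one factor 2 comes from |u + v|
  being at most twice the maximum, the other from 2 powr (1 / p) being at most 2. A constant larger
  than 1 is harmless, since the theorem is an equivalence up to constants.\<close>

lemma Lp_norm_add_le:
  assumes p: "p \<ge> 1" and u: "u \<in> Lp_space p" and v: "v \<in> Lp_space p"
  shows "Lp_norm p (\<lambda>z. u z + v z) \<le> 4 * (Lp_norm p u + Lp_norm p v)"
proof -
  define a where "a = (LINT z|T2. \<bar>u z\<bar> powr p)"
  define b where "b = (LINT z|T2. \<bar>v z\<bar> powr p)"
  have ab: "a \<ge> 0" "b \<ge> 0" unfolding a_def b_def by simp_all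
  have ui: "integrable T2 (\<lambda>z. \<bar>u z\<bar> powr p)" and vi: "integrable T2 (\<lambda>z. \<bar>v z\<bar> powr p)"
    and uvi: "integrable T2 (\<lambda>z. \<bar>u z + v z\<bar> powr p)"
    using u v Lp_space_add[OF _ u v] p by (auto simp: Lp_space_iff)
  have "(LINT z|T2. \<bar>u z + v z\<bar> powr p) \<le> (LINT z|T2. 2 powr p * (\<bar>u z\<bar> powr p + \<bar>v z\<bar> powr p))"
    using ui vi p by (intro integral_mono uvi abs_add_powr_le) auto
  also have "\<dots> = 2 powr p * (a + b)" using ui vi unfolding a_def b_def by simp
  also have "\<dots> \<le> 2 powr p * (2 * max a b)" by (intro mult_left_mono) auto
  finally have "Lp_norm p (\<lambda>z. u z + v z) \<le> (2 powr p * (2 * max a b)) powr (1 / p)"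
    unfolding Lp_norm_T2 using p by (intro powr_mono2) auto
  also have "\<dots> = (2 powr p) powr (1 / p) * (2 powr (1 / p) * max a b powr (1 / p))"
    using ab by (simp add: powr_mult)
  also have "\<dots> = 2 * (2 powr (1 / p) * max a b powr (1 / p))"
    using p by (simp add: powr_powr)
  also have "\<dots> \<le> 2 * (2 * max a b powr (1 / p))"
  proof -
    have "(2::real) powr (1 / p) \<le> 2 powr 1" using p by (intro powr_mono) (auto simp: field_simps)
    then show ?thesis by (intro mult_left_mono mult_right_mono) auto
  qed
  also have "max a b powr (1 / p) \<le> a powr (1 / p) + b powr (1 / p)" by (auto simp: max_def)
  finally show ?thesis unfolding Lp_norm_T2 a_def b_def by simp
qed

lemma translate_series_in_Lp_space:
  assumes "p > 1" "summable (\<lambda>n. \<bar>c n\<bar>)" "u \<in> Lp_space p"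
  shows "translate_series c a u \<in> Lp_space p"
proof -
  have u: "u \<in> borel_measurable lebesgue" "doubly_periodic u" "integrable T2 (\<lambda>z. \<bar>u z\<bar> powr p)"
    using assms(3) by (auto simp: Lp_space_iff)
  show ?thesis unfolding Lp_space_iff by (intro conjI translate_series_AE[OF assms(1,2) u])
qed

text \<open>The series may be subtracted termwise where both converge, hence almost everywhere; the
  difference is the series of \<open>u - v\<close>, to which the norm bound applies.\<close>

lemma Lp_norm_translate_series_diff:
  assumes p: "p > 1" and c: "summable (\<lambda>n. \<bar>c n\<bar>)" and u: "u \<in> Lp_space p" and v: "v \<in> Lp_space p"
  shows "Lp_norm p (\<lambda>z. translate_series c a u z - translate_series c a v z)
      \<le> (\<Sum>n. \<bar>c n\<bar>) * Lp_norm p (\<lambda>z. u z - v z)"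
proof -
  let ?d = "\<lambda>z. u z - v z"
  have d: "?d \<in> Lp_space p" using p by (intro Lp_space_diff u v) auto
  define C where "C = (\<Sum>n. \<bar>c n\<bar>)"
  have C0: "C \<ge> 0" unfolding C_def by (intro suminf_nonneg c) auto
  have m: "translate_series c a w \<in> borel_measurable T2" if "w \<in> Lp_space p" for w
    using translate_series_in_Lp_space[OF p c that] by (auto simp: Lp_space_iff intro: borel_measurable_T2I)
  note [measurable] = m[OF u] m[OF v] m[OF d]
  have "AE z in T2. summable (\<lambda>n. \<bar>c n * u (z + a n)\<bar>)" "AE z in T2. summable (\<lambda>n. \<bar>c n * v (z + a n)\<bar>)"
    using u v by (auto simp: Lp_space_iff intro: translate_series_AE(1)[OF p c])
  then have "AE z in T2. translate_series c a u z - translate_series c a v z = translate_series c a ?d z"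
  proof eventually_elim
    case (elim z)
    have "(\<lambda>n. c n * u (z + a n) - c n * v (z + a n)) sums (translate_series c a u z - translate_series c a v z)"
      unfolding translate_series_def
      by (intro sums_diff summable_sums summable_rabs_cancel[OF elim(1)] summable_rabs_cancel[OF elim(2)])
    then show ?case unfolding translate_series_def by (simp add: sums_iff right_diff_distrib)
  qed
  then have "(LINT z|T2. \<bar>translate_series c a u z - translate_series c a v z\<bar> powr p)
     = (LINT z|T2. \<bar>translate_series c a ?d z\<bar> powr p)"
    by (intro integral_cong_AE) auto
  also have "\<dots> \<le> C powr p * (LINT z|T2. \<bar>?d z\<bar> powr p)"
    unfolding C_def using d by (intro translate_series_AE(3)[OF p c]) (auto simp: Lp_space_iff)
  finally have "Lp_norm p (\<lambda>z. translate_series c a u z - translate_series c a v z)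
     \<le> (C powr p * (LINT z|T2. \<bar>?d z\<bar> powr p)) powr (1 / p)"
    unfolding Lp_norm_T2 using p by (intro powr_mono2) auto
  also have "\<dots> = C * Lp_norm p ?d"
    unfolding Lp_norm_T2 using p C0 by (simp add: powr_mult powr_powr)
  finally show ?thesis unfolding C_def .
qed

definition binomial_weight :: "real \<Rightarrow> nat \<Rightarrow> real" where
  "binomial_weight \<alpha> \<nu> = (-1) ^ \<nu> * (\<alpha> gchoose \<nu>)"

lemma summable_binomial_weight: "\<alpha> > 0 \<Longrightarrow> summable (\<lambda>\<nu>. \<bar>binomial_weight \<alpha> \<nu>\<bar>)"
  unfolding binomial_weight_def by (simp add: abs_mult summable_abs_gbinomial)

lemma diff_x_translate_series:
  "diff_x \<alpha> h = translate_series (binomial_weight \<alpha>) (\<lambda>\<nu>. ((\<alpha> - real \<nu>) * h, 0))"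
  unfolding diff_x_def translate_series_def binomial_weight_def by (auto simp: fun_eq_iff)

lemma diff_y_translate_series:
  "diff_y \<alpha> h = translate_series (binomial_weight \<alpha>) (\<lambda>\<nu>. (0, (\<alpha> - real \<nu>) * h))"
  unfolding diff_y_def translate_series_def binomial_weight_def by (auto simp: fun_eq_iff)

definition lac_factor :: "nat \<Rightarrow> real \<Rightarrow> real" where
  "lac_factor i h = \<bar>2 * sin (2 ^ i * h / 2)\<bar>"

lemma difference_phases:
  assumes \<alpha>: "\<alpha> > 0"
  shows "\<exists>\<psi>. \<forall>i \<phi>. (\<lambda>\<nu>. binomial_weight \<alpha> \<nu> * cos (\<phi> + (\<alpha> - real \<nu>) * (2 ^ i * h)))
           sums (lac_factor i h powr \<alpha> * cos (\<phi> + \<psi> i))"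
  unfolding binomial_weight_def lac_factor_def
  by (rule choice) (use difference_of_cos[OF \<alpha>] in blast)

lemma diff_x_lac_poly:
  assumes \<alpha>: "\<alpha> > 0"
  shows "\<exists>\<psi>. \<forall>S c \<theta> \<phi>. diff_x \<alpha> h (lac_poly c \<theta> \<phi> S)
      = lac_poly (\<lambda>s. c s * lac_factor (fst s) h powr \<alpha>) (\<lambda>i. \<theta> i + \<psi> i) \<phi> S"
proof -
  obtain \<psi> where \<psi>: "\<And>i \<phi>. (\<lambda>\<nu>. binomial_weight \<alpha> \<nu> * cos (\<phi> + (\<alpha> - real \<nu>) * (2 ^ i * h)))
           sums (lac_factor i h powr \<alpha> * cos (\<phi> + \<psi> i))" using difference_phases[OF \<alpha>] by blast
  have "diff_x \<alpha> h (lac_poly c \<theta> \<phi> S) z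
     = lac_poly (\<lambda>s. c s * lac_factor (fst s) h powr \<alpha>) (\<lambda>i. \<theta> i + \<psi> i) \<phi> S z" for S c \<theta> \<phi> z
  proof -
    have "(\<lambda>\<nu>. \<Sum>s\<in>S. c s * cos (2 ^ snd s * snd z + \<phi> (snd s)) *
         (binomial_weight \<alpha> \<nu> * cos ((2 ^ fst s * fst z + \<theta> (fst s)) + (\<alpha> - real \<nu>) * (2 ^ fst s * h))))
       sums (\<Sum>s\<in>S. c s * cos (2 ^ snd s * snd z + \<phi> (snd s)) *
         (lac_factor (fst s) h powr \<alpha> * cos ((2 ^ fst s * fst z + \<theta> (fst s)) + \<psi> (fst s))))"
      by (intro sums_sum sums_mult \<psi>)
    moreover have "(\<Sum>s\<in>S. c s * cos (2 ^ snd s * snd z + \<phi> (snd s)) *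
         (binomial_weight \<alpha> \<nu> * cos ((2 ^ fst s * fst z + \<theta> (fst s)) + (\<alpha> - real \<nu>) * (2 ^ fst s * h))))
       = binomial_weight \<alpha> \<nu> * lac_poly c \<theta> \<phi> S (z + ((\<alpha> - real \<nu>) * h, 0))" for \<nu>
      unfolding lac_poly_def case_prod_unfold sum_distrib_left prod.collapse
      by (intro sum.cong refl) (simp add: algebra_simps)
    moreover have "(\<Sum>s\<in>S. c s * cos (2 ^ snd s * snd z + \<phi> (snd s)) *
         (lac_factor (fst s) h powr \<alpha> * cos ((2 ^ fst s * fst z + \<theta> (fst s)) + \<psi> (fst s))))
       = lac_poly (\<lambda>s. c s * lac_factor (fst s) h powr \<alpha>) (\<lambda>i. \<theta> i + \<psi> i) \<phi> S z"
      unfolding lac_poly_def case_prod_unfold prod.collapse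
      by (intro sum.cong refl) (simp add: algebra_simps)
    ultimately show ?thesis unfolding diff_x_translate_series translate_series_def by (simp add: sums_iff)
  qed
  then show ?thesis by blast
qed

lemma diff_y_lac_poly:
  assumes \<alpha>: "\<alpha> > 0"
  shows "\<exists>\<psi>. \<forall>S c \<theta> \<phi>. diff_y \<alpha> h (lac_poly c \<theta> \<phi> S)
      = lac_poly (\<lambda>s. c s * lac_factor (snd s) h powr \<alpha>) \<theta> (\<lambda>j. \<phi> j + \<psi> j) S"
proof -
  obtain \<psi> where \<psi>: "\<And>i \<phi>. (\<lambda>\<nu>. binomial_weight \<alpha> \<nu> * cos (\<phi> + (\<alpha> - real \<nu>) * (2 ^ i * h)))
           sums (lac_factor i h powr \<alpha> * cos (\<phi> + \<psi> i))" using difference_phases[OF \<alpha>] by blast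
  have "diff_y \<alpha> h (lac_poly c \<theta> \<phi> S) z
     = lac_poly (\<lambda>s. c s * lac_factor (snd s) h powr \<alpha>) \<theta> (\<lambda>j. \<phi> j + \<psi> j) S z" for S c \<theta> \<phi> z
  proof -
    have "(\<lambda>\<nu>. \<Sum>s\<in>S. c s * cos (2 ^ fst s * fst z + \<theta> (fst s)) *
         (binomial_weight \<alpha> \<nu> * cos ((2 ^ snd s * snd z + \<phi> (snd s)) + (\<alpha> - real \<nu>) * (2 ^ snd s * h))))
       sums (\<Sum>s\<in>S. c s * cos (2 ^ fst s * fst z + \<theta> (fst s)) *
         (lac_factor (snd s) h powr \<alpha> * cos ((2 ^ snd s * snd z + \<phi> (snd s)) + \<psi> (snd s))))"
      by (intro sums_sum sums_mult \<psi>)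
    moreover have "(\<Sum>s\<in>S. c s * cos (2 ^ fst s * fst z + \<theta> (fst s)) *
         (binomial_weight \<alpha> \<nu> * cos ((2 ^ snd s * snd z + \<phi> (snd s)) + (\<alpha> - real \<nu>) * (2 ^ snd s * h))))
       = binomial_weight \<alpha> \<nu> * lac_poly c \<theta> \<phi> S (z + (0, (\<alpha> - real \<nu>) * h))" for \<nu>
      unfolding lac_poly_def case_prod_unfold sum_distrib_left prod.collapse
      by (intro sum.cong refl) (simp add: algebra_simps)
    moreover have "(\<Sum>s\<in>S. c s * cos (2 ^ fst s * fst z + \<theta> (fst s)) *
         (lac_factor (snd s) h powr \<alpha> * cos ((2 ^ snd s * snd z + \<phi> (snd s)) + \<psi> (snd s))))
       = lac_poly (\<lambda>s. c s * lac_factor (snd s) h powr \<alpha>) \<theta> (\<lambda>j. \<phi> j + \<psi> j) S z"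
      unfolding lac_poly_def case_prod_unfold prod.collapse
      by (intro sum.cong refl) (simp add: algebra_simps)
    ultimately show ?thesis unfolding diff_y_translate_series translate_series_def by (simp add: sums_iff)
  qed
  then show ?thesis by blast
qed

text \<open>
  The squared norm of a mixed difference is comparable to the supremum over finite \<open>S\<close> of the
  following sums; \<open>w\<close> stands for the squares of the coefficients.
\<close>

definition difference_sum ::
    "(nat \<times> nat \<Rightarrow> real) \<Rightarrow> real \<Rightarrow> real \<Rightarrow> real \<Rightarrow> real \<Rightarrow> (nat \<times> nat) set \<Rightarrow> real" where
  "difference_sum w a1 a2 h1 h2 S =
     (\<Sum>s\<in>S. w s * lac_factor (fst s) h1 powr (2 * a1) * lac_factor (snd s) h2 powr (2 * a2))"

text \<open>An upper bound \<open>M\<close> of all finite sums stands for the sum over all pairs, so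
  no question of summability arises. One constant \<open>C\<close> serves all orders and
  steps.\<close>

definition difference_estimates ::
    "real \<Rightarrow> (nat \<times> nat \<Rightarrow> real) \<Rightarrow> real \<Rightarrow> (real \<times> real \<Rightarrow> real) \<Rightarrow> bool" where
  "difference_estimates C w p f \<longleftrightarrow>
    (\<forall>a1 a2 h1 h2. a1 > 0 \<longrightarrow> a2 > 0 \<longrightarrow>
      (\<forall>S. finite S \<longrightarrow> sqrt (difference_sum w a1 a2 h1 h2 S) \<le> C * Lp_norm p (diff_x a1 h1 (diff_y a2 h2 f))) \<and>
      (\<forall>M. (\<forall>S. finite S \<longrightarrow> difference_sum w a1 a2 h1 h2 S \<le> M) \<longrightarrow>
         Lp_norm p (diff_x a1 h1 (diff_y a2 h2 f)) \<le> C * sqrt M))"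

text \<open>The mixed difference \<open>W\<close> is bounded on the space with a constant
  \<open>K\<close>, and it maps partial sums to lacunary sums whose squared coefficients are the
  terms of \<open>difference_sum\<close>. \<open>K\<close> depends on the orders, but it only
  decides how long a partial sum must be taken; this is why \<open>C\<close> depends on
  \<open>p\<close> alone.\<close>

lemma mixed_difference_norm:
  assumes p: "p > 1"
  shows "\<exists>C>0. \<forall>f\<in>Lambda_class p. \<exists>w B. (\<forall>s. w s \<ge> 0) \<and> (\<forall>S. finite S \<longrightarrow> sum w S \<le> B) \<and>
    difference_estimates C w p f"
proof -
  have p0: "p > 0" and p1: "p \<ge> 1" using p by auto
  obtain D where D: "D > 0" "\<And>S c \<theta> \<phi>. finite S \<Longrightarrow> Lp_norm p (lac_poly c \<theta> \<phi> S) \<le> D * sqrt (\<Sum>s\<in>S. (c s)\<^sup>2)"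
    using Lp_norm_lac_poly_le[OF p0] by auto
  obtain E where E: "E > 0" "\<And>S c \<theta> \<phi>. finite S \<Longrightarrow> sqrt (\<Sum>s\<in>S. (c s)\<^sup>2) \<le> E * Lp_norm p (lac_poly c \<theta> \<phi> S)"
    using Lp_norm_lac_poly_ge[OF p] by auto
  \<comment> \<open>The factors 4 are those of \<open>Lp_norm_add_le\<close>, used once in each
    direction.\<close>
  define C where "C = 4 * D + 4 * E"
  have C: "C > 0" "4 * D \<le> C" "4 * E \<le> C" unfolding C_def using D E by auto
  have main: "\<exists>w B. (\<forall>s. w s \<ge> 0) \<and> (\<forall>S. finite S \<longrightarrow> sum w S \<le> B) \<and>
    difference_estimates C w p f"
    if f: "f \<in> Lambda_class p" for f
  proof -
    have fp: "f \<in> Lp_space p" using f by (auto simp: Lambda_class_def Lp0_space_def)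
    obtain lam B where B: "\<And>S. finite S \<Longrightarrow> (\<Sum>s\<in>S. (lam s)\<^sup>2) \<le> B"
      and approx: "\<And>e. e > 0 \<Longrightarrow> \<exists>S0. finite S0 \<and> (\<forall>S. finite S \<and> S0 \<subseteq> S \<longrightarrow> Lp_norm p (\<lambda>z. f z - lac_cos lam S z) \<le> e)"
      using lacunary_approximation[OF p f] by blast
    define w where "w s = (lam s)\<^sup>2" for s
    have est: "(\<forall>S. finite S \<longrightarrow> sqrt (difference_sum w a1 a2 h1 h2 S) \<le> C * Lp_norm p (diff_x a1 h1 (diff_y a2 h2 f))) \<and>
      (\<forall>M. (\<forall>S. finite S \<longrightarrow> difference_sum w a1 a2 h1 h2 S \<le> M) \<longrightarrow>
         Lp_norm p (diff_x a1 h1 (diff_y a2 h2 f)) \<le> C * sqrt M)"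
      if \<alpha>: "a1 > 0" "a2 > 0" for a1 a2 h1 h2
    proof -
      define V where "V = difference_sum w a1 a2 h1 h2"
      define W where "W u = diff_x a1 h1 (diff_y a2 h2 u)" for u
      have s1: "summable (\<lambda>\<nu>. \<bar>binomial_weight a1 \<nu>\<bar>)" and s2: "summable (\<lambda>\<nu>. \<bar>binomial_weight a2 \<nu>\<bar>)"
        by (intro summable_binomial_weight \<alpha>)+
      define K where "K = (\<Sum>\<nu>. \<bar>binomial_weight a1 \<nu>\<bar>) * (\<Sum>\<nu>. \<bar>binomial_weight a2 \<nu>\<bar>)"
      have K: "K \<ge> 0" unfolding K_def by (intro mult_nonneg_nonneg suminf_nonneg s1 s2) auto
      have W_Lp: "W u \<in> Lp_space p" if "u \<in> Lp_space p" for u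
        unfolding W_def diff_x_translate_series diff_y_translate_series
        by (intro translate_series_in_Lp_space p s1 s2 that)
      have W_diff: "Lp_norm p (\<lambda>z. W u z - W v z) \<le> K * Lp_norm p (\<lambda>z. u z - v z)"
        if "u \<in> Lp_space p" "v \<in> Lp_space p" for u v
      proof -
        have "Lp_norm p (\<lambda>z. W u z - W v z) \<le> (\<Sum>\<nu>. \<bar>binomial_weight a1 \<nu>\<bar>) *
            Lp_norm p (\<lambda>z. diff_y a2 h2 u z - diff_y a2 h2 v z)"
          unfolding W_def diff_x_translate_series diff_y_translate_series
          by (intro Lp_norm_translate_series_diff translate_series_in_Lp_space p s1 s2 that)
        also have "\<dots> \<le> (\<Sum>\<nu>. \<bar>binomial_weight a1 \<nu>\<bar>) * ((\<Sum>\<nu>. \<bar>binomial_weight a2 \<nu>\<bar>) * Lp_norm p (\<lambda>z. u z - v z))"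
          unfolding diff_y_translate_series
          by (intro mult_left_mono Lp_norm_translate_series_diff p s2 that suminf_nonneg s1) auto
        finally show ?thesis unfolding K_def by (simp add: mult.assoc)
      qed
      obtain \<theta> where \<theta>: "\<And>S c t \<phi>. diff_x a1 h1 (lac_poly c t \<phi> S)
          = lac_poly (\<lambda>s. c s * lac_factor (fst s) h1 powr a1) (\<lambda>i. t i + \<theta> i) \<phi> S"
        using diff_x_lac_poly[OF \<alpha>(1)] by blast
      obtain \<phi> where \<phi>: "\<And>S c \<theta> t. diff_y a2 h2 (lac_poly c \<theta> t S)
          = lac_poly (\<lambda>s. c s * lac_factor (snd s) h2 powr a2) \<theta> (\<lambda>i. t i + \<phi> i) S"
        using diff_y_lac_poly[OF \<alpha>(2)] by blast
      define c where "c s = lam s * lac_factor (snd s) h2 powr a2 * lac_factor (fst s) h1 powr a1" for s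
      have WP: "W (lac_cos lam S) = lac_poly c \<theta> \<phi> S" for S
        unfolding W_def \<theta> \<phi> c_def by simp
      have pw: "x powr (2 * a) = (x powr a)\<^sup>2" for x a :: real
        by (simp add: power2_eq_square powr_add[symmetric])
      have sq: "(\<Sum>s\<in>S. (c s)\<^sup>2) = V S" for S
        unfolding V_def difference_sum_def c_def w_def pw
        by (intro sum.cong refl) (simp add: power_mult_distrib mult_ac)
      have lacp: "lac_cos lam S \<in> Lp_space p" for S by (rule lac_poly_in_Lp_space[OF p0])
      have V_mono: "V S \<le> V S'" if "S \<subseteq> S'" "finite S'" for S S'
        unfolding V_def difference_sum_def w_def using that by (intro sum_mono2) auto
      have close: "\<exists>S'. finite S' \<and> S \<subseteq> S' \<and> K * Lp_norm p (\<lambda>z. f z - lac_cos lam S' z) \<le> e" if S: "finite S" and e: "e > 0" for S e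
      proof -
        \<comment> \<open>The summand 1 makes the denominator positive, as \<open>K\<close> has only
          been shown to be nonnegative.\<close>
        have "e / (K + 1) > 0" using K e by simp
        from approx[OF this] obtain S0 where S0: "finite S0"
          "\<And>S. finite S \<Longrightarrow> S0 \<subseteq> S \<Longrightarrow> Lp_norm p (\<lambda>z. f z - lac_cos lam S z) \<le> e / (K + 1)" by blast
        have "K * Lp_norm p (\<lambda>z. f z - lac_cos lam (S \<union> S0) z) \<le> K * (e / (K + 1))"
          by (intro mult_left_mono S0(2) K) (use S S0 in auto)
        also have "\<dots> \<le> e" using K e by (simp add: field_simps)
        finally show ?thesis using S S0(1) by (intro exI[of _ "S \<union> S0"]) auto
      qed
      have lower: "sqrt (V S) \<le> C * Lp_norm p (W f)" if S: "finite S" for S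
      proof (rule field_le_epsilon)
        fix e :: real assume e: "e > 0"
        then have "e / C > 0" using C by simp
        from close[OF S this] obtain S' where S': "finite S'" "S \<subseteq> S'"
          "K * Lp_norm p (\<lambda>z. f z - lac_cos lam S' z) \<le> e / C" by blast
        have "sqrt (V S) \<le> sqrt (V S')" using V_mono[OF S'(2,1)] by simp
        also have "\<dots> \<le> E * Lp_norm p (W (lac_cos lam S'))"
          unfolding WP using E(2)[OF S'(1), of c] by (simp add: sq)
        also have "Lp_norm p (W (lac_cos lam S')) = Lp_norm p (\<lambda>z. W f z + - (W f z - W (lac_cos lam S') z))" by simp
        also have "\<dots> \<le> 4 * (Lp_norm p (W f) + Lp_norm p (\<lambda>z. - (W f z - W (lac_cos lam S') z)))"
          by (intro Lp_norm_add_le p1 W_Lp Lp_space_minus Lp_space_diff fp lacp) (use p in auto)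
        also have "Lp_norm p (\<lambda>z. - (W f z - W (lac_cos lam S') z)) = Lp_norm p (\<lambda>z. W f z - W (lac_cos lam S') z)"
          unfolding Lp_norm_T2 abs_minus_cancel ..
        also have "\<dots> \<le> e / C" by (rule order_trans[OF W_diff[OF fp lacp] S'(3)])
        finally have "sqrt (V S) \<le> E * (4 * (Lp_norm p (W f) + e / C))" using E(1) by simp
        also have "\<dots> = (4 * E) * (Lp_norm p (W f) + e / C)" by simp
        also have "\<dots> \<le> C * (Lp_norm p (W f) + e / C)"
          using C(3) e C(1) by (intro mult_right_mono add_nonneg_nonneg Lp_norm_nonneg) auto
        also have "\<dots> = C * Lp_norm p (W f) + e" using C(1) by (simp add: distrib_left)
        finally show "sqrt (V S) \<le> C * Lp_norm p (W f) + e" .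
      qed
      have upper: "Lp_norm p (W f) \<le> C * sqrt M" if M: "\<And>S. finite S \<Longrightarrow> V S \<le> M" for M
      proof (rule field_le_epsilon)
        fix e :: real assume e: "e > 0"
        then have "e / 4 > 0" by simp
        from close[OF finite.emptyI this] obtain S' where S': "finite S'"
          "K * Lp_norm p (\<lambda>z. f z - lac_cos lam S' z) \<le> e / 4" by blast
        have M0: "M \<ge> 0" using M[of "{}"] by (simp add: V_def difference_sum_def)
        have "Lp_norm p (W f) = Lp_norm p (\<lambda>z. W (lac_cos lam S') z + (W f z - W (lac_cos lam S') z))" by simp
        also have "\<dots> \<le> 4 * (Lp_norm p (W (lac_cos lam S')) + Lp_norm p (\<lambda>z. W f z - W (lac_cos lam S') z))"
          by (intro Lp_norm_add_le p1 W_Lp Lp_space_diff fp lacp) (use p in auto)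
        also have "Lp_norm p (\<lambda>z. W f z - W (lac_cos lam S') z) \<le> e / 4"
          by (rule order_trans[OF W_diff[OF fp lacp] S'(2)])
        also have "Lp_norm p (W (lac_cos lam S')) \<le> D * sqrt M"
        proof -
          have "Lp_norm p (W (lac_cos lam S')) \<le> D * sqrt (V S')"
            unfolding WP sq[symmetric] by (rule D(2)[OF S'(1)])
          also have "\<dots> \<le> D * sqrt M" using M[OF S'(1)] D(1) by (intro mult_left_mono) auto
          finally show ?thesis .
        qed
        finally have "Lp_norm p (W f) \<le> (4 * D) * sqrt M + e" by simp
        also have "\<dots> \<le> C * sqrt M + e" using C(2) M0 by (intro add_mono mult_right_mono) auto
        finally show "Lp_norm p (W f) \<le> C * sqrt M + e" .
      qed
      show ?thesis using lower upper unfolding V_def W_def by blast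
    qed
    show ?thesis
    proof (intro exI[of _ w] exI[of _ B] conjI allI)
      show "w s \<ge> 0" for s unfolding w_def by simp
      show "finite S \<longrightarrow> sum w S \<le> B" for S unfolding w_def using B by blast
      show "difference_estimates C w p f" unfolding difference_estimates_def using est by blast
    qed
  qed
  show ?thesis using C(1) main by blast
qed

subsection \<open>The mixed modulus\<close>

text \<open>The order of magnitude of the largest value of \<open>lac_factor i h\<close> for
  \<open>\<bar>h\<bar> \<le> t\<close>.\<close>

definition lac_scale :: "nat \<Rightarrow> real \<Rightarrow> real" where
  "lac_scale i t = min 1 (2 ^ i * t)"

lemma lac_scale_bounds: "t > 0 \<Longrightarrow> 0 < lac_scale i t" "lac_scale i t \<le> 1" "lac_scale i t \<le> 2 ^ i * t"
  unfolding lac_scale_def by auto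

lemma abs_sin_half_le:
  assumes "\<bar>h\<bar> \<le> t"
  shows "\<bar>sin (2 ^ i * h / 2)\<bar> \<le> lac_scale i t"
proof -
  have "\<bar>sin (2 ^ i * h / 2)\<bar> \<le> \<bar>2 ^ i * h / 2\<bar>" by (rule abs_sin_x_le_abs_x)
  also have "\<dots> \<le> 2 ^ i * \<bar>h\<bar>" by (simp add: abs_mult)
  also have "\<dots> \<le> 2 ^ i * t" using assms by (intro mult_left_mono) auto
  finally show ?thesis unfolding lac_scale_def by simp
qed

lemma lac_factor_powr_le:
  assumes "\<alpha> > 0" "\<bar>h\<bar> \<le> t"
  shows "lac_factor i h powr (2 * \<alpha>) \<le> 2 powr (2 * \<alpha>) * lac_scale i t powr (2 * \<alpha>)"
proof -
  have "lac_factor i h \<le> 2 * lac_scale i t"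
    using abs_sin_half_le[OF assms(2), of i] unfolding lac_factor_def abs_mult by simp
  then have "lac_factor i h powr (2 * \<alpha>) \<le> (2 * lac_scale i t) powr (2 * \<alpha>)"
    using assms(1) by (intro powr_mono2) (auto simp: lac_factor_def)
  also have "\<dots> = 2 powr (2 * \<alpha>) * lac_scale i t powr (2 * \<alpha>)"
    using order_trans[OF abs_ge_zero abs_sin_half_le[OF assms(2), of i]] by (simp add: powr_mult)
  finally show ?thesis .
qed

text \<open>Up to 2 the Taylor polynomial with its remainder is used: there x ^ 5 is at most 4 x ^
  3, and 1 / 6 - 4 / 120 = 2 / 15. Beyond 2 the right side is 13 / 15 x, which exceeds 1.\<close>

lemma sin_le_cubic:
  fixes x :: real
  assumes x: "x > 0"
  shows "sin x \<le> x - 2 / 15 * (min 1 x)\<^sup>2 * x"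
proof (cases "x \<le> 2")
  case True
  have "\<bar>sin x - (\<Sum>m<5. sin_coeff m * x ^ m)\<bar> \<le> inverse (fact 5) * \<bar>x\<bar> ^ 5"
    by (rule Maclaurin_sin_bound)
  moreover have "(\<Sum>m<5. sin_coeff m * x ^ m) = x - x ^ 3 / 6"
  proof -
    have "{..<5::nat} = {0, 1, 2, 3, 4}" by auto
    moreover have "sin_coeff 0 = 0" "sin_coeff 1 = 1" "sin_coeff 2 = 0" "sin_coeff 3 = - 1 / 6" "sin_coeff 4 = 0"
      by (simp_all add: sin_coeff_def fact_numeral)
    ultimately show ?thesis by simp
  qed
  moreover have "inverse (fact 5) * \<bar>x\<bar> ^ 5 = x ^ 5 / 120"
    using x by (simp add: fact_numeral field_simps)
  ultimately have "sin x \<le> x - x ^ 3 / 6 + x ^ 5 / 120" by linarith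
  moreover have "x ^ 5 \<le> 4 * x ^ 3"
  proof -
    have "x ^ 2 \<le> 2 ^ 2" using x True by (intro power_mono) auto
    then have "x ^ 2 * x ^ 3 \<le> 2 ^ 2 * x ^ 3" using x by (intro mult_right_mono) auto
    then show ?thesis by (simp flip: power_add)
  qed
  ultimately have "sin x \<le> x - 2 / 15 * x ^ 3" by linarith
  moreover have "(min 1 x)\<^sup>2 * x \<le> x ^ 3"
  proof -
    have "(min 1 x)\<^sup>2 \<le> x\<^sup>2" using x by (intro power_mono) auto
    then have "(min 1 x)\<^sup>2 * x \<le> x\<^sup>2 * x" using x by (intro mult_right_mono) auto
    then show ?thesis by (simp add: power2_eq_square power3_eq_cube)
  qed
  ultimately show ?thesis by linarith
next
  case False
  then have "min 1 x = 1" by simp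
  moreover have "sin x \<le> 13 / 15 * x" using sin_le_one[of x] False by linarith
  ultimately show ?thesis by simp
qed

text \<open>
  Averaging over \<open>h\<close> in \<open>{0..t}\<close>, via the mean value theorem: the average of
  \<open>sin\<^sup>2 (2 ^ i * h / 2)\<close> is \<open>(1 - sin X / X) / 2\<close> with \<open>X = 2 ^ i * t\<close>, hence at least
  \<open>(min 1 X)\<^sup>2 / 15\<close>.
\<close>

lemma sin_square_average:
  assumes t: "t > 0" and w: "\<And>s. s \<in> S \<Longrightarrow> w s \<ge> 0"
  shows "\<exists>h\<in>{0..t}. (\<Sum>s\<in>S. w s) / 15 \<le> (\<Sum>s\<in>S. w s * (sin (2 ^ k s * h / 2) / lac_scale (k s) t)\<^sup>2)"
proof -
  define m where "m s = lac_scale (k s) t" for s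
  have m: "m s > 0" for s unfolding m_def using lac_scale_bounds(1)[OF t] .
  define F where "F h = (\<Sum>s\<in>S. w s / (m s)\<^sup>2 * (h / 2 - sin (2 ^ k s * h) / (2 * 2 ^ k s)))" for h
  have der1: "((\<lambda>h. c * (h / 2 - sin (a * h) / (2 * a))) has_real_derivative c * (1 / 2 - cos (a * h) / 2)) (at h)"
    if "a \<noteq> 0" for a c h :: real
    using that by (auto intro!: derivative_eq_intros)
  define F' where "F' h = (\<Sum>s\<in>S. w s * (sin (2 ^ k s * h / 2) / m s)\<^sup>2)" for h
  have der: "(F has_real_derivative F' h) (at h)" for h
  proof -
    have "(F has_real_derivative (\<Sum>s\<in>S. w s / (m s)\<^sup>2 * (1 / 2 - cos (2 ^ k s * h) / 2))) (at h)"
      unfolding F_def by (intro DERIV_sum der1) simp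
    moreover have "1 / 2 - cos (2 ^ k s * h) / 2 = (sin (2 ^ k s * h / 2))\<^sup>2" for s
      using cos_double_sin[of "2 ^ k s * h / 2"] by (simp add: field_simps)
    ultimately show ?thesis unfolding F'_def by (simp add: power_divide)
  qed
  from MVT2[OF t der] obtain h where h: "0 < h" "h < t" "F t - F 0 = (t - 0) * F' h" by blast
  have "t * ((\<Sum>s\<in>S. w s) / 15) = (\<Sum>s\<in>S. w s * (t / 15))"
    by (simp add: sum_distrib_left sum_divide_distrib mult.commute)
  also have "\<dots> \<le> F t"
    unfolding F_def
  proof (rule sum_mono)
    fix s assume s: "s \<in> S"
    define X where "X = 2 ^ k s * t"
    have X: "X > 0" unfolding X_def using t by simp
    have "m s = min 1 X" unfolding m_def lac_scale_def X_def ..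
    with sin_le_cubic[OF X] have "2 / 15 * (m s)\<^sup>2 * X \<le> X - sin X" by simp
    then have "2 / 15 * (m s)\<^sup>2 * t * 2 ^ k s \<le> (t - sin X / 2 ^ k s) * 2 ^ k s"
    proof -
      have e1: "(t - sin X / 2 ^ k s) * 2 ^ k s = X - sin X"
        unfolding left_diff_distrib X_def by simp
      have e2: "2 / 15 * (m s)\<^sup>2 * t * 2 ^ k s = 2 / 15 * (m s)\<^sup>2 * X"
        unfolding X_def by (simp add: mult_ac)
      show ?thesis unfolding e1 e2 by fact
    qed
    then have "2 / 15 * (m s)\<^sup>2 * t \<le> t - sin X / 2 ^ k s"
      by (rule mult_right_le_imp_le) simp
    then have "t / 15 * (m s)\<^sup>2 \<le> t / 2 - sin X / (2 * 2 ^ k s)" by (simp add: field_simps)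
    then have "t / 15 \<le> (t / 2 - sin X / (2 * 2 ^ k s)) / (m s)\<^sup>2" using m[of s] by (simp add: field_simps)
    then have "w s * (t / 15) \<le> w s * ((t / 2 - sin X / (2 * 2 ^ k s)) / (m s)\<^sup>2)"
      using w[OF s] by (rule mult_left_mono)
    then show "w s * (t / 15) \<le> w s / (m s)\<^sup>2 * (t / 2 - sin (2 ^ k s * t) / (2 * 2 ^ k s))"
      unfolding X_def by simp
  qed
  also have "F t = t * F' h" using h(3) unfolding F_def by simp
  finally have "(\<Sum>s\<in>S. w s) / 15 \<le> F' h" using t by simp
  then show ?thesis unfolding F'_def m_def using h by (intro bexI[of _ h]) auto
qed

definition averaging_const :: "real \<Rightarrow> real" where
  "averaging_const \<alpha> = (1 / 30) powr \<alpha> / 30"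

text \<open>One \<open>h\<close> has to serve all \<open>s\<close>, and it is the one found for the
  squared sines. With r in [0, 1] the squared ratio of sine and scale, weighted by the full terms,
  its average at \<open>h\<close> is at least 1 / 15. Half of this is given up to pass from r to r
  powr \<alpha>, so 1 / 15 - 1 / 30 = 1 / 30 remains; the other factor of
  \<open>averaging_const\<close> is the value of r powr \<alpha> at the threshold 1 / 30.\<close>

lemma lac_factor_average:
  assumes \<alpha>: "\<alpha> > 0" and t: "t > 0" and w: "\<And>s. s \<in> S \<Longrightarrow> w s \<ge> 0"
  shows "\<exists>h\<in>{0..t}. averaging_const \<alpha> * (\<Sum>s\<in>S. w s * lac_scale (k s) t powr (2 * \<alpha>))
      \<le> (\<Sum>s\<in>S. w s * lac_factor (k s) h powr (2 * \<alpha>))"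
proof -
  define m where "m s = lac_scale (k s) t" for s
  have m: "m s > 0" for s unfolding m_def using lac_scale_bounds(1)[OF t] .
  define v where "v s = w s * m s powr (2 * \<alpha>)" for s
  have v: "v s \<ge> 0" if "s \<in> S" for s unfolding v_def using w[OF that] by simp
  obtain h where h: "h \<in> {0..t}" and avg: "(\<Sum>s\<in>S. v s) / 15 \<le> (\<Sum>s\<in>S. v s * (sin (2 ^ k s * h / 2) / m s)\<^sup>2)"
    using sin_square_average[where k = k and S = S and w = v, OF t v] unfolding m_def by blast
  define r where "r s = (sin (2 ^ k s * h / 2) / m s)\<^sup>2" for s
  have r: "0 \<le> r s" "r s \<le> 1" for s
  proof -
    show "0 \<le> r s" unfolding r_def by simp
    have "\<bar>sin (2 ^ k s * h / 2)\<bar> \<le> m s" unfolding m_def by (rule abs_sin_half_le) (use h in auto)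
    then have "\<bar>sin (2 ^ k s * h / 2) / m s\<bar> \<le> 1" using m[of s] by simp
    then show "r s \<le> 1" unfolding r_def by (simp add: abs_square_le_1)
  qed
  have lf: "(1 / 30) powr \<alpha> * (v s * r s - v s / 30) \<le> w s * lac_factor (k s) h powr (2 * \<alpha>)" if s: "s \<in> S" for s
  proof -
    \<comment> \<open>A lower bound that is linear in \<open>r s\<close>, so that it can be
      averaged, valid for \<alpha> on either side of 1: above the threshold it uses
      \<open>r s \<le> 1\<close>, below it the left side is negative.\<close>
    have r_powr: "(1 / 30) powr \<alpha> * (r s - 1 / 30) \<le> r s powr \<alpha>"
    proof (cases "r s \<ge> 1 / 30")
      case True
      have "(1 / 30) powr \<alpha> * (r s - 1 / 30) \<le> (1 / 30) powr \<alpha> * 1"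
        using r(2)[of s] by (intro mult_left_mono) auto
      also have "\<dots> \<le> r s powr \<alpha>" using True \<alpha> by (simp add: powr_mono2)
      finally show ?thesis .
    next
      case False
      then have "(1 / 30) powr \<alpha> * (r s - 1 / 30) \<le> 0" by (intro mult_nonneg_nonpos) auto
      then show ?thesis by (smt (verit) powr_ge_zero)
    qed
    have "(m s powr (2 * \<alpha>)) * r s powr \<alpha> = \<bar>sin (2 ^ k s * h / 2)\<bar> powr (2 * \<alpha>)"
    proof -
      have sq: "y\<^sup>2 powr \<alpha> = \<bar>y\<bar> powr (2 * \<alpha>)" for y :: real
      proof -
        have "y\<^sup>2 = \<bar>y\<bar> powr 2" by (cases "y = 0") (simp_all add: powr_numeral)
        then show ?thesis by (simp only: powr_powr)
      qed
      have "\<bar>sin (2 ^ k s * h / 2)\<bar> = m s * \<bar>sin (2 ^ k s * h / 2) / m s\<bar>" using m[of s] by (simp add: abs_divide)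
      moreover have "m s powr (2 * \<alpha>) * \<bar>sin (2 ^ k s * h / 2) / m s\<bar> powr (2 * \<alpha>)
          = (m s * \<bar>sin (2 ^ k s * h / 2) / m s\<bar>) powr (2 * \<alpha>)"
        using m[of s] by (subst powr_mult) auto
      ultimately show ?thesis unfolding r_def sq by simp
    qed
    also have "\<dots> \<le> lac_factor (k s) h powr (2 * \<alpha>)"
      unfolding lac_factor_def using \<alpha> by (intro powr_mono2) (auto simp: abs_mult)
    finally have "w s * (m s powr (2 * \<alpha>) * r s powr \<alpha>) \<le> w s * lac_factor (k s) h powr (2 * \<alpha>)"
      using w[OF s] by (rule mult_left_mono)
    moreover have "v s * ((1 / 30) powr \<alpha> * (r s - 1 / 30)) \<le> v s * r s powr \<alpha>"
      using r_powr v[OF s] by (rule mult_left_mono)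
    ultimately show ?thesis unfolding v_def by (simp add: algebra_simps)
  qed
  have "averaging_const \<alpha> * (\<Sum>s\<in>S. v s) = (1 / 30) powr \<alpha> * ((\<Sum>s\<in>S. v s) / 15 - (\<Sum>s\<in>S. v s) / 30)"
    unfolding averaging_const_def by simp
  also have "\<dots> \<le> (1 / 30) powr \<alpha> * ((\<Sum>s\<in>S. v s * r s) - (\<Sum>s\<in>S. v s) / 30)"
    using avg unfolding r_def by (intro mult_left_mono) auto
  also have "\<dots> = (\<Sum>s\<in>S. (1 / 30) powr \<alpha> * (v s * r s - v s / 30))"
    by (simp add: sum_distrib_left sum_subtractf sum_divide_distrib right_diff_distrib)
  also have "\<dots> \<le> (\<Sum>s\<in>S. w s * lac_factor (k s) h powr (2 * \<alpha>))"
    by (rule sum_mono) (rule lf)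
  finally show ?thesis using h unfolding v_def m_def by blast
qed

definition scale_sum ::
    "(nat \<times> nat \<Rightarrow> real) \<Rightarrow> real \<Rightarrow> real \<Rightarrow> real \<Rightarrow> real \<Rightarrow> (nat \<times> nat) set \<Rightarrow> real" where
  "scale_sum w a1 a2 t1 t2 S =
     (\<Sum>s\<in>S. w s * lac_scale (fst s) t1 powr (2 * a1) * lac_scale (snd s) t2 powr (2 * a2))"

lemma scale_sum_le_sum:
  assumes "\<And>s. w s \<ge> 0" "a1 > 0" "a2 > 0" "t1 > 0" "t2 > 0"
  shows "scale_sum w a1 a2 t1 t2 S \<le> sum w S"
  unfolding scale_sum_def
proof (rule sum_mono)
  fix s
  have "lac_scale (fst s) t1 powr (2 * a1) * lac_scale (snd s) t2 powr (2 * a2) \<le> 1 * 1"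
  proof (intro mult_mono)
    have le1: "lac_scale i t powr (2 * a) \<le> 1" if "t > 0" "a > 0" for i t a
      using lac_scale_bounds(1)[OF that(1), of i] lac_scale_bounds(2)[of i t] that(2) by (simp add: powr_le1)
    show "lac_scale (fst s) t1 powr (2 * a1) \<le> 1" "lac_scale (snd s) t2 powr (2 * a2) \<le> 1"
      by (intro le1 assms)+
  qed auto
  then show "w s * lac_scale (fst s) t1 powr (2 * a1) * lac_scale (snd s) t2 powr (2 * a2) \<le> w s"
    using mult_left_mono[OF _ assms(1)[of s]] by (fastforce simp: mult.assoc)
qed

text \<open>\<open>\<Omega>\<close> stands for a mixed modulus. Monotonicity is recorded with the
  two estimates because the measurability of the integrand is derived from it.\<close>

definition comparable_modulus ::
    "real \<Rightarrow> (nat \<times> nat \<Rightarrow> real) \<Rightarrow> real \<Rightarrow> real \<Rightarrow> (real \<Rightarrow> real \<Rightarrow> real) \<Rightarrow> bool" where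
  "comparable_modulus C w a1 a2 \<Omega> \<longleftrightarrow> (\<forall>t1>0. \<forall>t2>0. 0 \<le> \<Omega> t1 t2
     \<and> (\<forall>t1'\<ge>t1. \<forall>t2'\<ge>t2. \<Omega> t1 t2 \<le> \<Omega> t1' t2')
     \<and> (\<forall>S. finite S \<longrightarrow> scale_sum w a1 a2 t1 t2 S \<le> C * (\<Omega> t1 t2)\<^sup>2)
     \<and> (\<forall>M. (\<forall>S. finite S \<longrightarrow> scale_sum w a1 a2 t1 t2 S \<le> M) \<longrightarrow> (\<Omega> t1 t2)\<^sup>2 \<le> C * M))"

lemma comparable_modulus_weaken:
  assumes "comparable_modulus C w a1 a2 \<Omega>" "C \<le> D"
  shows "comparable_modulus D w a1 a2 \<Omega>"
proof -
  have 1: "C * (\<Omega> t1 t2)\<^sup>2 \<le> D * (\<Omega> t1 t2)\<^sup>2" for t1 t2 using assms(2) by (intro mult_right_mono) auto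
  have 2: "C * M \<le> D * M" if "\<forall>S. finite S \<longrightarrow> scale_sum w a1 a2 t1 t2 S \<le> M" for t1 t2 M
    using that[rule_format, of "{}"] assms(2) by (intro mult_right_mono) (auto simp: scale_sum_def)
  show ?thesis using assms(1) 1 2 unfolding comparable_modulus_def by (meson order_trans)
qed

text \<open>Upper estimate: for all admissible steps each factor is at most twice its scale. Lower
  estimate: averaging in both variables yields one pair of steps at which the difference is large.
  The two bounds on \<open>D\<close> come from these two halves.\<close>

lemma comparable_mixed_modulus:
  assumes C: "C > 0" and \<alpha>: "a1 > 0" "a2 > 0" and w: "\<And>s. w s \<ge> 0" and B: "\<And>S. finite S \<Longrightarrow> sum w S \<le> B"
    and lower: "\<And>h1 h2 S. finite S \<Longrightarrow>
        sqrt (difference_sum w a1 a2 h1 h2 S) \<le> C * Lp_norm p (diff_x a1 h1 (diff_y a2 h2 f))"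
    and upper: "\<And>h1 h2 M. (\<And>S. finite S \<Longrightarrow> difference_sum w a1 a2 h1 h2 S \<le> M) \<Longrightarrow>
        Lp_norm p (diff_x a1 h1 (diff_y a2 h2 f)) \<le> C * sqrt M"
    and D: "C\<^sup>2 * (2 powr (2 * a1) * 2 powr (2 * a2)) \<le> D"
      "C\<^sup>2 / (averaging_const a1 * averaging_const a2) \<le> D"
  shows "comparable_modulus D w a1 a2 (mixed_modulus p a1 a2 f)"
proof -
  define N where "N h1 h2 = Lp_norm p (diff_x a1 h1 (diff_y a2 h2 f))" for h1 h2
  define K where "K = 2 powr (2 * a1) * 2 powr (2 * a2)"
  have K: "K > 0" unfolding K_def by simp
  define \<kappa> where "\<kappa> = averaging_const a1 * averaging_const a2"
  have kpos: "averaging_const a > 0" for a unfolding averaging_const_def by simp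
  have \<kappa>: "\<kappa> > 0" unfolding \<kappa>_def using kpos by simp
  have N0: "N h1 h2 \<ge> 0" for h1 h2 unfolding N_def by (rule Lp_norm_nonneg)
  have mm: "mixed_modulus p a1 a2 f t1 t2 = (SUP (h1, h2) \<in> {-t1..t1} \<times> {-t2..t2}. N h1 h2)" for t1 t2
    unfolding mixed_modulus_def N_def ..
  have N_le: "N h1 h2 \<le> C * sqrt (K * M)"
    if h: "\<bar>h1\<bar> \<le> t1" "\<bar>h2\<bar> \<le> t2" and M: "\<And>S. finite S \<Longrightarrow> scale_sum w a1 a2 t1 t2 S \<le> M" for h1 h2 t1 t2 M
    unfolding N_def
  proof (rule upper)
    fix S :: "(nat \<times> nat) set" assume S: "finite S"
    have "difference_sum w a1 a2 h1 h2 S \<le> K * scale_sum w a1 a2 t1 t2 S"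
      unfolding difference_sum_def scale_sum_def sum_distrib_left
    proof (rule sum_mono)
      fix s
      have "lac_factor (fst s) h1 powr (2 * a1) * lac_factor (snd s) h2 powr (2 * a2)
        \<le> (2 powr (2 * a1) * lac_scale (fst s) t1 powr (2 * a1)) * (2 powr (2 * a2) * lac_scale (snd s) t2 powr (2 * a2))"
        by (intro mult_mono lac_factor_powr_le \<alpha> h) auto
      then have "w s * (lac_factor (fst s) h1 powr (2 * a1) * lac_factor (snd s) h2 powr (2 * a2))
        \<le> w s * ((2 powr (2 * a1) * lac_scale (fst s) t1 powr (2 * a1)) * (2 powr (2 * a2) * lac_scale (snd s) t2 powr (2 * a2)))"
        by (rule mult_left_mono) (rule w)
      then show "w s * lac_factor (fst s) h1 powr (2 * a1) * lac_factor (snd s) h2 powr (2 * a2)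
        \<le> K * (w s * lac_scale (fst s) t1 powr (2 * a1) * lac_scale (snd s) t2 powr (2 * a2))"
        unfolding K_def by (simp only: mult_ac)
    qed
    also have "\<dots> \<le> K * M" using K M[OF S] by (intro mult_left_mono) auto
    finally show "difference_sum w a1 a2 h1 h2 S \<le> K * M" .
  qed
  \<comment> \<open>Boundedness is what gives the supremum in the reals its meaning; the total
    weight \<open>B\<close> bounds the differences for all steps at once.\<close>
  have bdd: "bdd_above ((\<lambda>(h1, h2). N h1 h2) ` ({-t1..t1} \<times> {-t2..t2}))" if t: "t1 > 0" "t2 > 0" for t1 t2
  proof (rule bdd_aboveI2)
    fix h assume "h \<in> {-t1..t1} \<times> {-t2..t2}"
    then have "\<bar>fst h\<bar> \<le> t1" "\<bar>snd h\<bar> \<le> t2" by (auto simp: abs_le_iff)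
    moreover have "scale_sum w a1 a2 t1 t2 S \<le> B" if "finite S" for S
      using scale_sum_le_sum[of w, OF w \<alpha> t] B[OF that] order_trans by blast
    ultimately have "N (fst h) (snd h) \<le> C * sqrt (K * B)" by (rule N_le)
    then show "(case h of (h1, h2) \<Rightarrow> N h1 h2) \<le> C * sqrt (K * B)" by (simp add: case_prod_unfold)
  qed
  have N_mm: "N h1 h2 \<le> mixed_modulus p a1 a2 f t1 t2" if "t1 > 0" "t2 > 0" "\<bar>h1\<bar> \<le> t1" "\<bar>h2\<bar> \<le> t2" for h1 h2 t1 t2
    unfolding mm using cSUP_upper[OF _ bdd[OF that(1,2)], of "(h1, h2)"] that(3,4) by (auto simp: abs_le_iff)
  have mm_le: "mixed_modulus p a1 a2 f t1 t2 \<le> M"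
    if "t1 > 0" "t2 > 0" "\<And>h1 h2. \<bar>h1\<bar> \<le> t1 \<Longrightarrow> \<bar>h2\<bar> \<le> t2 \<Longrightarrow> N h1 h2 \<le> M" for t1 t2 M
    unfolding mm
  proof (rule cSUP_least)
    show "{-t1..t1} \<times> {-t2..t2} \<noteq> {}" using that(1,2) by auto
    show "(case h of (h1, h2) \<Rightarrow> N h1 h2) \<le> M" if "h \<in> {-t1..t1} \<times> {-t2..t2}" for h
      using \<open>\<And>h1 h2. \<bar>h1\<bar> \<le> t1 \<Longrightarrow> \<bar>h2\<bar> \<le> t2 \<Longrightarrow> N h1 h2 \<le> M\<close>[of "fst h" "snd h"] that
      by (auto simp: case_prod_unfold abs_le_iff)
  qed
  show ?thesis
    unfolding comparable_modulus_def
  proof (intro allI impI conjI)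
    fix t1 t2 :: real assume t: "t1 > 0" "t2 > 0"
    let ?\<Omega> = "mixed_modulus p a1 a2 f t1 t2"
    show O0: "0 \<le> ?\<Omega>" using N0[of 0 0] N_mm[OF t, of 0 0] t by linarith
    show "?\<Omega> \<le> mixed_modulus p a1 a2 f t1' t2'" if "t1' \<ge> t1" "t2' \<ge> t2" for t1' t2'
      using that t by (intro mm_le N_mm) auto
    show "scale_sum w a1 a2 t1 t2 S \<le> D * ?\<Omega>\<^sup>2" if S: "finite S" for S
    proof -
      \<comment> \<open>In the choice of \<open>h1\<close> the scales of the second variable belong
        to the weights. In the choice of \<open>h2\<close> the weights contain the factors of the
        first variable at the step \<open>h1\<close> already chosen.\<close>
      obtain h1 where h1: "h1 \<in> {0..t1}" and le1: "averaging_const a1 *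
          (\<Sum>s\<in>S. (w s * lac_scale (snd s) t2 powr (2 * a2)) * lac_scale (fst s) t1 powr (2 * a1))
        \<le> (\<Sum>s\<in>S. (w s * lac_scale (snd s) t2 powr (2 * a2)) * lac_factor (fst s) h1 powr (2 * a1))"
        using lac_factor_average[OF \<alpha>(1) t(1), of S "\<lambda>s. w s * lac_scale (snd s) t2 powr (2 * a2)" fst] w by auto
      obtain h2 where h2: "h2 \<in> {0..t2}" and le2: "averaging_const a2 *
          (\<Sum>s\<in>S. (w s * lac_factor (fst s) h1 powr (2 * a1)) * lac_scale (snd s) t2 powr (2 * a2))
        \<le> (\<Sum>s\<in>S. (w s * lac_factor (fst s) h1 powr (2 * a1)) * lac_factor (snd s) h2 powr (2 * a2))"
        using lac_factor_average[OF \<alpha>(2) t(2), of S "\<lambda>s. w s * lac_factor (fst s) h1 powr (2 * a1)" snd] w by auto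
      have "\<kappa> * scale_sum w a1 a2 t1 t2 S
         = averaging_const a2 * (averaging_const a1 *
          (\<Sum>s\<in>S. (w s * lac_scale (snd s) t2 powr (2 * a2)) * lac_scale (fst s) t1 powr (2 * a1)))"
        unfolding \<kappa>_def scale_sum_def by (simp add: mult_ac)
      also have "\<dots> \<le> averaging_const a2 *
          (\<Sum>s\<in>S. (w s * lac_scale (snd s) t2 powr (2 * a2)) * lac_factor (fst s) h1 powr (2 * a1))"
        using le1 kpos[of a2] by (intro mult_left_mono) auto
      also have "\<dots> = averaging_const a2 *
          (\<Sum>s\<in>S. (w s * lac_factor (fst s) h1 powr (2 * a1)) * lac_scale (snd s) t2 powr (2 * a2))"
        by (simp add: mult_ac)
      also note le2
      also have "(\<Sum>s\<in>S. (w s * lac_factor (fst s) h1 powr (2 * a1)) * lac_factor (snd s) h2 powr (2 * a2))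
         = difference_sum w a1 a2 h1 h2 S" unfolding difference_sum_def ..
      also have "\<dots> \<le> (C * ?\<Omega>)\<^sup>2"
      proof (rule sqrt_le_D)
        have "sqrt (difference_sum w a1 a2 h1 h2 S) \<le> C * N h1 h2" unfolding N_def by (rule lower[OF S])
        also have "\<dots> \<le> C * ?\<Omega>" using C N_mm[OF t, of h1 h2] h1 h2 by (intro mult_left_mono) auto
        finally show "sqrt (difference_sum w a1 a2 h1 h2 S) \<le> C * ?\<Omega>" .
      qed
      finally have "scale_sum w a1 a2 t1 t2 S \<le> C\<^sup>2 / \<kappa> * ?\<Omega>\<^sup>2"
        using \<kappa> by (simp add: field_simps power_mult_distrib)
      also have "\<dots> \<le> D * ?\<Omega>\<^sup>2" using D(2) unfolding \<kappa>_def by (intro mult_right_mono) auto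
      finally show ?thesis .
    qed
    show "?\<Omega>\<^sup>2 \<le> D * M" if M: "\<forall>S. finite S \<longrightarrow> scale_sum w a1 a2 t1 t2 S \<le> M" for M
    proof -
      have M0: "M \<ge> 0" using M[rule_format, of "{}"] by (simp add: scale_sum_def)
      have "?\<Omega> \<le> C * sqrt (K * M)" by (intro mm_le t N_le) (use M in auto)
      then have "?\<Omega>\<^sup>2 \<le> (C * sqrt (K * M))\<^sup>2" using O0 by (intro power_mono)
      also have "\<dots> = C\<^sup>2 * K * M" using K M0 by (simp add: power_mult_distrib)
      also have "\<dots> \<le> D * M" using D(1) M0 unfolding K_def by (intro mult_right_mono) auto
      finally show ?thesis .
    qed
  qed
qed

text \<open>The same weights \<open>w\<close> describe the moduli of both pairs of orders; through
  them the two moduli can be compared.\<close>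

lemma mixed_modulus_comparison:
  assumes p: "p > 1" and pos: "a1 > 0" "a2 > 0" "b1 > 0" "b2 > 0"
  shows "\<exists>C>0. \<forall>f\<in>Lambda_class p. \<exists>w B. (\<forall>s. w s \<ge> 0) \<and> (\<forall>S. finite S \<longrightarrow> sum w S \<le> B) \<and>
    comparable_modulus C w a1 a2 (mixed_modulus p a1 a2 f) \<and>
    comparable_modulus C w b1 b2 (mixed_modulus p b1 b2 f)"
proof -
  from mixed_difference_norm[OF p] obtain C where C: "C > 0" and mdn: "\<forall>f\<in>Lambda_class p. \<exists>w B. (\<forall>s. w s \<ge> 0) \<and> (\<forall>S. finite S \<longrightarrow> sum w S \<le> B) \<and>
    difference_estimates C w p f"
    by (elim exE conjE)
  define D where "D a b = max (C\<^sup>2 * (2 powr (2 * a) * 2 powr (2 * b))) (C\<^sup>2 / (averaging_const a * averaging_const b))"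
    for a b :: real
  have cm: "comparable_modulus (D a b) w a b (mixed_modulus p a b f)"
    if ab: "a > 0" "b > 0" and w: "\<And>s. w s \<ge> 0" and B: "\<And>S. finite S \<Longrightarrow> sum w S \<le> B"
      and two: "difference_estimates C w p f"
    for a b w B f
    by (rule comparable_mixed_modulus[OF C ab w B]) (use two ab in \<open>auto simp: D_def difference_estimates_def\<close>)
  define E where "E = max (D a1 a2) (D b1 b2)"
  have "C\<^sup>2 * (2 powr (2 * a1) * 2 powr (2 * a2)) > 0" using C by simp
  then have E: "E > 0" unfolding E_def D_def by (simp add: less_max_iff_disj)
  show ?thesis
  proof (intro exI[of _ E] conjI ballI E)
    fix f assume "f \<in> Lambda_class p"
    from bspec[OF mdn this] obtain w B where w': "\<forall>s. w s \<ge> 0" and B': "\<forall>S. finite S \<longrightarrow> sum w S \<le> B"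
      and two: "difference_estimates C w p f" by (elim exE conjE)
    note w = w'[rule_format] and B = B'[rule_format]
    have "comparable_modulus E w a1 a2 (mixed_modulus p a1 a2 f)"
      by (rule comparable_modulus_weaken[OF cm[OF pos(1,2) w B two]]) (auto simp: E_def)
    moreover have "comparable_modulus E w b1 b2 (mixed_modulus p b1 b2 f)"
      by (rule comparable_modulus_weaken[OF cm[OF pos(3,4) w B two]]) (auto simp: E_def)
    ultimately show "\<exists>w B. (\<forall>s. w s \<ge> 0) \<and> (\<forall>S. finite S \<longrightarrow> sum w S \<le> B) \<and>
      comparable_modulus E w a1 a2 (mixed_modulus p a1 a2 f) \<and>
      comparable_modulus E w b1 b2 (mixed_modulus p b1 b2 f)"
      using w' B' by (intro exI[of _ w] exI[of _ B] conjI)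
  qed
qed

subsection \<open>Integrals of the modulus\<close>

lemma powr_has_integral:
  fixes r x y :: real
  assumes "0 < x" "x \<le> y" "r \<noteq> -1"
  shows "((\<lambda>t. t powr r) has_integral (y powr (r + 1) / (r + 1) - x powr (r + 1) / (r + 1))) {x..y}"
proof (rule fundamental_theorem_of_calculus[OF assms(2)])
  fix t assume "t \<in> {x..y}"
  then have "t > 0" using assms(1) by auto
  have "((\<lambda>t. t powr (r + 1)) has_real_derivative (r + 1) * t powr (r + 1 - 1)) (at t within {x..y})"
    by (rule has_field_derivative_at_within[OF has_real_derivative_powr[OF \<open>t > 0\<close>]])
  from DERIV_cdivide[OF this, of "r + 1"]
  have "((\<lambda>t. t powr (r + 1) / (r + 1)) has_real_derivative t powr r) (at t within {x..y})"
    using assms(3) by simp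
  then show "((\<lambda>t. t powr (r + 1) / (r + 1)) has_vector_derivative t powr r) (at t within {x..y})"
    by (simp add: has_real_derivative_iff_has_vector_derivative)
qed

text \<open>One variable's share of the squared integrand: the exponent of \<open>t\<close> collects
  the square of \<open>t powr (- a)\<close> and the density of dt / t.\<close>

definition scale_kernel :: "real \<Rightarrow> real \<Rightarrow> nat \<Rightarrow> real \<Rightarrow> real" where
  "scale_kernel a b i t = t powr (- 2 * a - 1) * lac_scale i t powr (2 * b)"

lemma continuous_on_scale_kernel:
  assumes "b > 0" "\<delta> > 0"
  shows "continuous_on {\<delta>..c} (scale_kernel a b i)"
proof -
  have "continuous_on {\<delta>..c} (lac_scale i)"
    unfolding lac_scale_def by (intro continuous_intros)
  then have "continuous_on {\<delta>..c} (\<lambda>t. lac_scale i t powr (2 * b))"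
    by (rule continuous_on_powr'[OF _ continuous_on_const]) (use assms in \<open>auto simp: lac_scale_def\<close>)
  moreover have "continuous_on {\<delta>..c} (\<lambda>t. t powr (- 2 * a - 1))"
    by (rule continuous_on_powr'[OF continuous_on_id continuous_on_const]) (use assms in auto)
  ultimately show ?thesis unfolding scale_kernel_def by (intro continuous_on_mult)
qed

text \<open>The right side is a multiple of c powr (-2 a), where c is the larger of \<delta> and 1 /
  2 ^ i. Below c the scale is at most t / c, and a < b makes the exponent of t exceed -1, which
  gives 1 / (2 (b - a)). Above c the scale is at most 1, which gives 1 / (2 a).\<close>

lemma scale_kernel_integral_upper:
  assumes ab: "0 < a" "a < b" and \<delta>: "0 < \<delta>" "\<delta> < 1 / 2"
  shows "integral {\<delta>..1} (scale_kernel a b i)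
    \<le> (1 / (2 * (b - a)) + 1 / (2 * a)) * (\<delta> powr (- 2 * a) * lac_scale i \<delta> powr (2 * a))"
proof -
  define c where "c = max \<delta> (1 / 2 ^ i)"
  have c: "0 < c" "\<delta> \<le> c" "c \<le> 1" "1 / 2 ^ i \<le> c" unfolding c_def using \<delta> by (auto simp: field_simps)
  have m: "lac_scale i \<delta> = \<delta> / c"
    unfolding c_def lac_scale_def using \<delta> by (auto simp: max_def min_def field_simps)
  have target: "\<delta> powr (- 2 * a) * lac_scale i \<delta> powr (2 * a) = c powr (- 2 * a)"
    unfolding m using c \<delta> by (simp add: powr_divide powr_minus field_simps)
  have int: "scale_kernel a b i integrable_on {x..y}" if "0 < x" for x y
    by (rule integrable_continuous_real[OF continuous_on_scale_kernel]) (use ab that in auto)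
  have "integral {\<delta>..1} (scale_kernel a b i) = integral {\<delta>..c} (scale_kernel a b i) + integral {c..1} (scale_kernel a b i)"
    by (rule Henstock_Kurzweil_Integration.integral_combine[symmetric]) (use c int \<delta> in auto)
  also have "integral {c..1} (scale_kernel a b i) \<le> c powr (- 2 * a) / (2 * a)"
  proof -
    have h: "((\<lambda>t. t powr (- 2 * a - 1)) has_integral
        (1 powr (- 2 * a - 1 + 1) / (- 2 * a - 1 + 1) - c powr (- 2 * a - 1 + 1) / (- 2 * a - 1 + 1))) {c..1}"
      by (rule powr_has_integral) (use c ab in auto)
    have "integral {c..1} (scale_kernel a b i) \<le> 1 powr (- 2 * a - 1 + 1) / (- 2 * a - 1 + 1) - c powr (- 2 * a - 1 + 1) / (- 2 * a - 1 + 1)"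
    proof (rule has_integral_le[OF integrable_integral[OF int[OF c(1)]] h])
      fix t assume t: "t \<in> {c..1}"
      have "lac_scale i t powr (2 * b) \<le> 1"
        using lac_scale_bounds(1)[of t i] lac_scale_bounds(2)[of i t] t c ab by (intro powr_le1) auto
      then have "t powr (- 2 * a - 1) * lac_scale i t powr (2 * b) \<le> t powr (- 2 * a - 1) * 1"
        by (intro mult_left_mono) auto
      then show "scale_kernel a b i t \<le> t powr (- 2 * a - 1)" unfolding scale_kernel_def by simp
    qed
    also have "\<dots> \<le> c powr (- 2 * a) / (2 * a)" using ab by (simp add: field_simps)
    finally show ?thesis .
  qed
  also have "integral {\<delta>..c} (scale_kernel a b i) \<le> c powr (- 2 * a) / (2 * (b - a))"
  proof -
    define r where "r = 2 * b - 2 * a - 1"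
    have h: "((\<lambda>t. c powr (- 2 * b) * t powr r) has_integral
        c powr (- 2 * b) * (c powr (r + 1) / (r + 1) - \<delta> powr (r + 1) / (r + 1))) {\<delta>..c}"
      by (intro has_integral_mult_right powr_has_integral) (use c \<delta> ab in \<open>auto simp: r_def\<close>)
    have "integral {\<delta>..c} (scale_kernel a b i) \<le> c powr (- 2 * b) * (c powr (r + 1) / (r + 1) - \<delta> powr (r + 1) / (r + 1))"
    proof (cases "c = \<delta>")
      case True
      then show ?thesis by simp
    next
      case False
      then have ci: "c = 1 / 2 ^ i" unfolding c_def max_def by (simp split: if_splits)
      show ?thesis
      proof (rule has_integral_le[OF integrable_integral[OF int[OF \<delta>(1)]] h])
        fix t assume t: "t \<in> {\<delta>..c}"
        have t0: "t > 0" using t \<delta> by auto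
        have "lac_scale i t \<le> t / c" using lac_scale_bounds(3)[of i t] unfolding ci by (simp add: mult.commute)
        then have "lac_scale i t powr (2 * b) \<le> (t / c) powr (2 * b)"
          using lac_scale_bounds(1)[OF t0, of i] ab by (intro powr_mono2) auto
        then have "t powr (- 2 * a - 1) * lac_scale i t powr (2 * b) \<le> t powr (- 2 * a - 1) * (t / c) powr (2 * b)"
          by (intro mult_left_mono) auto
        also have "\<dots> = c powr (- 2 * b) * (t powr (- 2 * a - 1) * t powr (2 * b))"
          using t0 c by (simp add: powr_divide powr_minus field_simps)
        also have "t powr (- 2 * a - 1) * t powr (2 * b) = t powr r"
          unfolding powr_add[symmetric] r_def by (simp add: algebra_simps)
        finally show "scale_kernel a b i t \<le> c powr (- 2 * b) * t powr r" unfolding scale_kernel_def .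
      qed
    qed
    also have "\<dots> \<le> c powr (- 2 * b) * (c powr (r + 1) / (r + 1))"
      using ab by (intro mult_left_mono) (auto simp: r_def)
    also have "\<dots> = c powr (- 2 * a) / (2 * (b - a))"
    proof -
      have "c powr (- 2 * b) * c powr (r + 1) = c powr (- 2 * a)"
        unfolding powr_add[symmetric] r_def by (simp add: algebra_simps)
      then show ?thesis unfolding r_def by (simp add: algebra_simps)
    qed
    finally show ?thesis .
  qed
  finally show ?thesis unfolding target by (simp add: algebra_simps)
qed

text \<open>On \<open>{d..2 * d}\<close> with \<open>d\<close> as below the scale factor is at least \<open>1 / 2\<close>.\<close>

lemma scale_kernel_integral_lower:
  assumes ab: "0 < a" "0 < b" and \<delta>: "0 < \<delta>" "\<delta> < 1 / 2"
  shows "2 powr (- 2 * a - 1) * 2 powr (- 2 * b) * (\<delta> powr (- 2 * a) * lac_scale i \<delta> powr (2 * a))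
    \<le> integral {\<delta>..1} (scale_kernel a b i)"
proof -
  define c where "c = max \<delta> (1 / 2 ^ i)"
  have c: "0 < c" unfolding c_def using \<delta> by (auto simp: less_max_iff_disj)
  have m: "lac_scale i \<delta> = \<delta> / c"
    unfolding c_def lac_scale_def using \<delta> by (auto simp: max_def min_def field_simps)
  have target: "\<delta> powr (- 2 * a) * lac_scale i \<delta> powr (2 * a) = c powr (- 2 * a)"
    unfolding m using c \<delta> by (simp add: powr_divide powr_minus field_simps)
  \<comment> \<open>Halving \<open>1 / 2 ^ i\<close> keeps \<open>2 * d \<le> 1\<close> even for
    \<open>i = 0\<close>, so the interval stays inside the range of integration;
    \<open>d \<le> c\<close> makes the negative power at \<open>d\<close> the larger one.\<close>
  define d where "d = max \<delta> (1 / 2 ^ i / 2)"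
  have pi: "1 / 2 ^ i \<le> (1::real)" by (simp add: field_simps)
  have d: "0 < d" "\<delta> \<le> d" "2 * d \<le> 1" "d \<le> c" "1 / 2 ^ i / 2 \<le> d"
    unfolding c_def d_def using \<delta> pi by (auto simp: max_def)
  have int: "scale_kernel a b i integrable_on {x..y}" if "0 < x" for x y
    by (rule integrable_continuous_real[OF continuous_on_scale_kernel]) (use ab that in auto)
  have "2 powr (- 2 * a - 1) * 2 powr (- 2 * b) * c powr (- 2 * a)
      \<le> 2 powr (- 2 * a - 1) * 2 powr (- 2 * b) * d powr (- 2 * a)"
    using d ab by (intro mult_left_mono powr_mono2') auto
  also have "\<dots> = d * ((2 * d) powr (- 2 * a - 1) * 2 powr (- 2 * b))"
  proof -
    have e1: "d * d powr (- 2 * a - 1) = d powr (- 2 * a)" using d by (simp add: powr_mult_base)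
    have e2: "(2 * d) powr (- 2 * a - 1) = 2 powr (- 2 * a - 1) * d powr (- 2 * a - 1)"
      using d by (simp only: powr_mult)
    show ?thesis unfolding e2 e1[symmetric] by (simp only: mult_ac)
  qed
  also have "\<dots> = integral {d..2 * d} (\<lambda>t. (2 * d) powr (- 2 * a - 1) * 2 powr (- 2 * b))"
    using d by simp
  also have "\<dots> \<le> integral {d..2 * d} (scale_kernel a b i)"
  proof (rule integral_le)
    fix t assume t: "t \<in> {d..2 * d}"
    have "1 / 2 \<le> 2 ^ i * t"
    proof -
      have "1 / 2 ^ i / 2 \<le> t" using d(5) t by auto
      then have "2 ^ i * (1 / 2 ^ i / 2) \<le> 2 ^ i * t" by (intro mult_left_mono) auto
      then show ?thesis by simp
    qed
    then have "1 / 2 \<le> lac_scale i t" unfolding lac_scale_def by simp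
    then have "(1 / 2) powr (2 * b) \<le> lac_scale i t powr (2 * b)" using ab by (intro powr_mono2) auto
    moreover have "(1 / 2) powr (2 * b) = 2 powr (- 2 * b)" by (simp add: powr_divide powr_minus_divide)
    moreover have "(2 * d) powr (- 2 * a - 1) \<le> t powr (- 2 * a - 1)"
      using t d ab by (intro powr_mono2') auto
    ultimately show "(2 * d) powr (- 2 * a - 1) * 2 powr (- 2 * b) \<le> scale_kernel a b i t"
      unfolding scale_kernel_def by (intro mult_mono) auto
  qed (use int d in auto)
  also have "\<dots> \<le> integral {\<delta>..1} (scale_kernel a b i)"
    by (rule integral_subset_le) (use d \<delta> int in \<open>auto simp: scale_kernel_def\<close>)
  finally show ?thesis unfolding target .
qed

section \<open>Integrability in one variable\<close>

lemma set_integrable_continuous_open_interval: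
  fixes f :: "real \<Rightarrow> real"
  assumes "continuous_on {a..b} f"
  shows "set_integrable lborel {a<..<b} f"
  by (rule set_integrable_subset[OF borel_integrable_atLeastAtMost'[OF assms]]) auto

lemma LBINT_open_interval_continuous:
  fixes f :: "real \<Rightarrow> real"
  assumes "continuous_on {a..b} f"
  shows "(LBINT t:{a<..<b}. f t) = integral {a..b} f"
  using set_borel_integral_eq_integral(2)[OF set_integrable_continuous_open_interval[OF assms]]
  by (simp add: integral_open_interval_real)

text \<open>Serves for the squared modulus and for its inner integral, whose measurability comes
  from monotonicity.\<close>

lemma set_integrable_mono_on_bounded_mult:
  fixes g k :: "real \<Rightarrow> real"
  assumes g: "mono_on {a<..<b} g" and bd: "\<And>t. t \<in> {a<..<b} \<Longrightarrow> \<bar>g t\<bar> \<le> M" and k: "continuous_on {a..b} k"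
  shows "set_integrable lborel {a<..<b} (\<lambda>t. k t * g t)"
proof -
  have "g \<in> borel_measurable (restrict_space borel {a<..<b})"
    by (rule borel_measurable_mono_on_fnc[OF g])
  then have gm: "(\<lambda>t. indicator {a<..<b} t *\<^sub>R g t) \<in> borel_measurable borel"
    by (subst (asm) borel_measurable_restrict_space_iff) auto
  have ki: "set_integrable lborel {a<..<b} k" by (rule set_integrable_continuous_open_interval[OF k])
  have km: "(\<lambda>t. indicator {a<..<b} t *\<^sub>R k t) \<in> borel_measurable borel"
    using ki unfolding set_integrable_def by (auto dest: borel_measurable_integrable)
  have kMi: "set_integrable lborel {a<..<b} (\<lambda>t. M * k t)" using ki by (rule set_integrable_mult_right[rotated])
  show ?thesis
  proof (rule set_integrable_bound[OF kMi])
    have "(\<lambda>t. indicator {a<..<b} t *\<^sub>R (k t * g t))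
        = (\<lambda>t. (indicator {a<..<b} t *\<^sub>R k t) * (indicator {a<..<b} t *\<^sub>R g t))"
      by (auto simp: indicator_def)
    then show "set_borel_measurable lborel {a<..<b} (\<lambda>t. k t * g t)"
      unfolding set_borel_measurable_def using borel_measurable_times[OF km gm] by simp
    have "norm (k t * g t) \<le> norm (M * k t)" if t: "t \<in> {a<..<b}" for t
    proof -
      have "\<bar>k t\<bar> * \<bar>g t\<bar> \<le> \<bar>k t\<bar> * \<bar>M\<bar>" using bd[OF t] by (intro mult_left_mono) auto
      then show ?thesis by (simp add: abs_mult mult.commute)
    qed
    then show "AE t in lborel. t \<in> {a<..<b} \<longrightarrow> norm (k t * g t) \<le> norm (M * k t)" by (intro AE_I2) auto
  qed
qed

text \<open>The term with \<open>e\<close> carries the error that arises when one nearly maximal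
  finite set replaces all finite sets.\<close>

lemma scale_kernel_combination:
  fixes a b e \<delta> :: real and c :: "'a \<Rightarrow> real" and k :: "'a \<Rightarrow> nat" and S :: "'a set"
  assumes b: "b > 0" and \<delta>: "\<delta> > 0"
  defines "f \<equiv> \<lambda>t. (\<Sum>s\<in>S. c s * scale_kernel a b (k s) t) + e * t powr (- 2 * a - 1)"
  shows "set_integrable lborel {\<delta><..<1} f"
    and "(LBINT t:{\<delta><..<1}. f t)
       = (\<Sum>s\<in>S. c s * integral {\<delta>..1} (scale_kernel a b (k s))) + e * integral {\<delta>..1} (\<lambda>t. t powr (- 2 * a - 1))"
proof -
  have k: "continuous_on {\<delta>..1} (scale_kernel a b i)" for i
    by (rule continuous_on_scale_kernel[OF b \<delta>])
  have p: "continuous_on {\<delta>..1} (\<lambda>t. t powr (- 2 * a - 1))"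
    by (rule continuous_on_powr'[OF continuous_on_id continuous_on_const]) (use \<delta> in auto)
  have f: "continuous_on {\<delta>..1} f" unfolding f_def by (intro continuous_intros k p)
  show "set_integrable lborel {\<delta><..<1} f" by (rule set_integrable_continuous_open_interval[OF f])
  have sum0: "(\<Sum>s\<in>S. g s) = 0" if "infinite S" for g :: "'a \<Rightarrow> real" using that by simp
  have "((\<lambda>t. \<Sum>s\<in>S. c s * scale_kernel a b (k s) t) has_integral
      (\<Sum>s\<in>S. c s * integral {\<delta>..1} (scale_kernel a b (k s)))) {\<delta>..1}"
  proof (cases "finite S")
    case True
    then show ?thesis
      by (intro has_integral_sum has_integral_mult_right integrable_integral integrable_continuous_real k)
  qed (simp add: sum0)
  then have "(f has_integral (\<Sum>s\<in>S. c s * integral {\<delta>..1} (scale_kernel a b (k s)))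
      + e * integral {\<delta>..1} (\<lambda>t. t powr (- 2 * a - 1))) {\<delta>..1}"
    unfolding f_def
    by (intro has_integral_add has_integral_mult_right integrable_integral integrable_continuous_real p)
  then show "(LBINT t:{\<delta><..<1}. f t)
       = (\<Sum>s\<in>S. c s * integral {\<delta>..1} (scale_kernel a b (k s))) + e * integral {\<delta>..1} (\<lambda>t. t powr (- 2 * a - 1))"
    unfolding LBINT_open_interval_continuous[OF f] by (rule integral_unique)
qed

text \<open>Let \<open>S\<close> nearly exhaust the total weight. Scales are at most 1, so what any
  other finite set adds is at most the missing weight, whatever the arguments are. This uniformity
  permits fixing \<open>S\<close> before integrating.\<close>

lemma scale_sum_nearly_maximal:
  assumes w: "\<And>s. w s \<ge> 0" and B: "\<And>S. finite S \<Longrightarrow> sum w S \<le> B" and e: "e > 0" and \<beta>: "b1 > 0" "b2 > 0"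
  shows "\<exists>S. finite S \<and> (\<forall>t1>0. \<forall>t2>0. \<forall>S'. finite S' \<longrightarrow> scale_sum w b1 b2 t1 t2 S' \<le> scale_sum w b1 b2 t1 t2 S + e)"
proof -
  define A where "A = (SUP S\<in>{S. finite S}. sum w S)"
  have bdd: "bdd_above (sum w ` {S. finite S})" using B by (intro bdd_aboveI2) auto
  have le_A: "sum w S \<le> A" if "finite S" for S
    unfolding A_def by (rule cSUP_upper[OF _ bdd]) (use that in simp)
  have ne: "{S :: (nat \<times> nat) set. finite S} \<noteq> {}" by auto
  have "A - e < A" using e by simp
  then obtain S where S: "finite S" "A - e < sum w S"
    using less_cSUP_iff[OF ne bdd, of "A - e", folded A_def] by blast
  have "scale_sum w b1 b2 t1 t2 S' \<le> scale_sum w b1 b2 t1 t2 S + e" if t: "t1 > 0" "t2 > 0" and S': "finite S'" for t1 t2 S'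
  proof -
    have "scale_sum w b1 b2 t1 t2 S' \<le> scale_sum w b1 b2 t1 t2 (S \<union> (S' - S))"
      unfolding scale_sum_def using S S' w by (intro sum_mono2) auto
    also have "\<dots> = scale_sum w b1 b2 t1 t2 S + scale_sum w b1 b2 t1 t2 (S' - S)"
      unfolding scale_sum_def using S S' by (intro sum.union_disjoint) auto
    also have "scale_sum w b1 b2 t1 t2 (S' - S) \<le> sum w (S' - S)"
      by (rule scale_sum_le_sum[OF w \<beta> t])
    also have "\<dots> = sum w (S \<union> (S' - S)) - sum w S"
      using sum.union_disjoint[of S "S' - S" w] S S' by auto
    also have "\<dots> \<le> e" using le_A[of "S \<union> (S' - S)"] S S' by simp
    finally show ?thesis by simp
  qed
  then show ?thesis using S(1) by blast
qed

text \<open>For a finite set the double integral of the weighted kernels is a finite sum of products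
  \<open>J1 * J2\<close>, and these are known up to constants. From below, every finite sum is
  dominated by the integrand; from above, one nearly maximal set bounds the integrand up to a small
  error. Each direction uses the comparison once for either modulus, whence
  \<open>C\<^sup>2\<close>.\<close>

lemma modulus_integral_equivalence:
  assumes \<alpha>: "0 < a1" "a1 < b1" "0 < a2" "a2 < b2" and C: "C > 0"
    and w: "\<And>s. w s \<ge> 0" and B: "\<And>S. finite S \<Longrightarrow> sum w S \<le> B"
    and A: "comparable_modulus C w a1 a2 \<Omega>\<^sub>\<alpha>" and Bm: "comparable_modulus C w b1 b2 \<Omega>\<^sub>\<beta>"
    and \<delta>: "0 < d1" "d1 < 1 / 2" "0 < d2" "d2 < 1 / 2"
  defines "I \<equiv> (LBINT t1:{d1<..<1}. (LBINT t2:{d2<..<1}.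
               (t1 powr (-a1) * t2 powr (-a2) * \<Omega>\<^sub>\<beta> t1 t2)\<^sup>2 / t2) / t1)"
    and "U \<equiv> (1 / (2 * (b1 - a1)) + 1 / (2 * a1)) * (1 / (2 * (b2 - a2)) + 1 / (2 * a2))"
    and "l \<equiv> (2 powr (- 2 * a1 - 1) * 2 powr (- 2 * b1)) * (2 powr (- 2 * a2 - 1) * 2 powr (- 2 * b2))"
    and "T \<equiv> d1 powr (- 2 * a1) * d2 powr (- 2 * a2)"
  shows "I \<le> C\<^sup>2 * U * T * (\<Omega>\<^sub>\<alpha> d1 d2)\<^sup>2" and "(\<Omega>\<^sub>\<alpha> d1 d2)\<^sup>2 \<le> C\<^sup>2 / (l * T) * I" and "0 \<le> I"
proof -
  have \<beta>: "b1 > 0" "b2 > 0" using \<alpha> by auto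
  define k1 where "k1 t = t powr (- 2 * a1 - 1)" for t :: real
  define k2 where "k2 t = t powr (- 2 * a2 - 1)" for t :: real
  define K1 where "K1 = integral {d1..1} k1"
  define K2 where "K2 = integral {d2..1} k2"
  define J1 where "J1 i = integral {d1..1} (scale_kernel a1 b1 i)" for i
  define J2 where "J2 i = integral {d2..1} (scale_kernel a2 b2 i)" for i
  have contk: "continuous_on {d1..1} k1" "continuous_on {d2..1} k2"
    unfolding k1_def k2_def
    by (rule continuous_on_powr'[OF continuous_on_id continuous_on_const]; use \<delta> in auto)+
  have kpos: "k1 t \<ge> 0" "k2 t \<ge> 0" for t unfolding k1_def k2_def by auto
  define g where "g t1 t2 = (\<Omega>\<^sub>\<beta> t1 t2)\<^sup>2" for t1 t2
  have g0: "g t1 t2 \<ge> 0" for t1 t2 unfolding g_def by simp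
  have g_lower: "scale_sum w b1 b2 t1 t2 S \<le> C * g t1 t2" if "t1 > 0" "t2 > 0" "finite S" for t1 t2 S
    using Bm that unfolding comparable_modulus_def g_def by blast
  have g_upper: "g t1 t2 \<le> C * M" if "t1 > 0" "t2 > 0" "\<And>S. finite S \<Longrightarrow> scale_sum w b1 b2 t1 t2 S \<le> M" for t1 t2 M
    using Bm that unfolding comparable_modulus_def g_def by blast
  have g_bound: "g t1 t2 \<le> C * B" if t: "t1 > 0" "t2 > 0" for t1 t2
    by (rule g_upper[OF t order_trans[OF scale_sum_le_sum[OF w \<beta> t] B]])
  have g_mono: "g t1 t2 \<le> g t1' t2'" if "t1 > 0" "t2 > 0" "t1 \<le> t1'" "t2 \<le> t2'" for t1 t2 t1' t2'
    using Bm that unfolding comparable_modulus_def g_def by (intro power_mono) auto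
  define h where "h t1 = (LBINT t2:{d2<..<1}. k2 t2 * g t1 t2)" for t1
  have int2: "set_integrable lborel {d2<..<1} (\<lambda>t2. k2 t2 * g t1 t2)" if "t1 > 0" for t1
  proof (rule set_integrable_mono_on_bounded_mult[OF _ _ contk(2)])
    show "mono_on {d2<..<1} (g t1)"
      using that \<delta> by (intro mono_onI g_mono) auto
    show "\<bar>g t1 t2\<bar> \<le> C * B" if "t2 \<in> {d2<..<1}" for t2
      using g_bound[of t1 t2] g0[of t1 t2] that \<open>t1 > 0\<close> \<delta> by auto
  qed
  have h0: "0 \<le> h t1" for t1
    unfolding h_def set_lebesgue_integral_def
    by (intro integral_nonneg_AE AE_I2) (auto simp: indicator_def g0 kpos)
  have h_mono: "h s \<le> h t" if "0 < s" "s \<le> t" for s t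
    unfolding h_def
  proof (rule set_integral_mono)
    show "k2 t2 * g s t2 \<le> k2 t2 * g t t2" if "t2 \<in> {d2<..<1}" for t2
      using that \<open>0 < s\<close> \<open>s \<le> t\<close> \<delta> by (intro mult_left_mono g_mono kpos) auto
  qed (use that int2 in auto)
  have int1: "set_integrable lborel {d1<..<1} (\<lambda>t1. k1 t1 * h t1)"
  proof (rule set_integrable_mono_on_bounded_mult[OF _ _ contk(1)])
    show "mono_on {d1<..<1} h" using \<delta> by (intro mono_onI h_mono) auto
    show "\<bar>h t\<bar> \<le> h 1" if "t \<in> {d1<..<1}" for t
      using h0[of t] h_mono[of t 1] that \<delta> by auto
  qed
  have I_eq: "I = (LBINT t1:{d1<..<1}. k1 t1 * h t1)"
    unfolding I_def
  proof (rule set_lebesgue_integral_cong)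
    show "\<forall>t1. t1 \<in> {d1<..<1} \<longrightarrow> (LBINT t2:{d2<..<1}.
               (t1 powr (-a1) * t2 powr (-a2) * \<Omega>\<^sub>\<beta> t1 t2)\<^sup>2 / t2) / t1 = k1 t1 * h t1"
    proof (intro allI impI)
      fix t1 assume "t1 \<in> {d1<..<1}"
      then have t1: "t1 > 0" using \<delta> by auto
      have sq: "(t powr (- a))\<^sup>2 = t powr (- 2 * a)" for t a :: real
        by (simp add: power2_eq_square powr_add[symmetric])
      have k: "t powr (- 2 * a) / t = t powr (- 2 * a - 1)" if "t > 0" for t a :: real
        using that by (simp add: powr_diff)
      have "(LBINT t2:{d2<..<1}. (t1 powr (-a1) * t2 powr (-a2) * \<Omega>\<^sub>\<beta> t1 t2)\<^sup>2 / t2)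
         = (LBINT t2:{d2<..<1}. t1 powr (- 2 * a1) * (k2 t2 * g t1 t2))"
      proof (rule set_lebesgue_integral_cong)
        show "\<forall>t2. t2 \<in> {d2<..<1} \<longrightarrow> (t1 powr (-a1) * t2 powr (-a2) * \<Omega>\<^sub>\<beta> t1 t2)\<^sup>2 / t2
           = t1 powr (- 2 * a1) * (k2 t2 * g t1 t2)"
        proof (intro allI impI)
          fix t2 assume "t2 \<in> {d2<..<1}"
          then have t2: "t2 > 0" using \<delta> by auto
          show "(t1 powr (-a1) * t2 powr (-a2) * \<Omega>\<^sub>\<beta> t1 t2)\<^sup>2 / t2 = t1 powr (- 2 * a1) * (k2 t2 * g t1 t2)"
            unfolding power_mult_distrib sq k2_def g_def k[OF t2, symmetric] by (simp only: times_divide_eq_left times_divide_eq_right mult_ac)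
        qed
      qed simp
      also have "\<dots> = t1 powr (- 2 * a1) * h t1" unfolding h_def by (rule set_integral_mult_right)
      finally show "(LBINT t2:{d2<..<1}. (t1 powr (-a1) * t2 powr (-a2) * \<Omega>\<^sub>\<beta> t1 t2)\<^sup>2 / t2) / t1 = k1 t1 * h t1"
        unfolding k1_def k[OF t1, symmetric] by simp
    qed
  qed simp
  show I0: "0 \<le> I"
    unfolding I_eq set_lebesgue_integral_def
    by (intro integral_nonneg_AE AE_I2) (auto simp: indicator_def h0 kpos)
  have T: "T > 0" unfolding T_def using \<delta> by simp
  have l: "l > 0" unfolding l_def by simp
  have J0: "J1 i \<ge> 0" "J2 i \<ge> 0" for i
    unfolding J1_def J2_def
    by (intro integral_nonneg integrable_continuous_real continuous_on_scale_kernel \<beta> \<delta>; simp add: scale_kernel_def)+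
  have J_upper: "(\<Sum>s\<in>S. w s * (J1 (fst s) * J2 (snd s))) \<le> U * T * scale_sum w a1 a2 d1 d2 S" for S
    unfolding scale_sum_def sum_distrib_left
  proof (rule sum_mono)
    fix s
    have "J1 (fst s) * J2 (snd s)
      \<le> ((1 / (2 * (b1 - a1)) + 1 / (2 * a1)) * (d1 powr (- 2 * a1) * lac_scale (fst s) d1 powr (2 * a1)))
       * ((1 / (2 * (b2 - a2)) + 1 / (2 * a2)) * (d2 powr (- 2 * a2) * lac_scale (snd s) d2 powr (2 * a2)))"
      using J0 \<alpha> unfolding J1_def J2_def
      by (intro mult_mono scale_kernel_integral_upper \<alpha> \<delta> mult_nonneg_nonneg add_nonneg_nonneg) auto
    then have "w s * (J1 (fst s) * J2 (snd s)) \<le> w s * (((1 / (2 * (b1 - a1)) + 1 / (2 * a1)) * (d1 powr (- 2 * a1) * lac_scale (fst s) d1 powr (2 * a1)))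
       * ((1 / (2 * (b2 - a2)) + 1 / (2 * a2)) * (d2 powr (- 2 * a2) * lac_scale (snd s) d2 powr (2 * a2))))"
      using w by (rule mult_left_mono)
    then show "w s * (J1 (fst s) * J2 (snd s))
      \<le> U * T * (w s * lac_scale (fst s) d1 powr (2 * a1) * lac_scale (snd s) d2 powr (2 * a2))"
      unfolding U_def T_def by (simp only: mult_ac)
  qed
  have J_lower: "l * T * scale_sum w a1 a2 d1 d2 S \<le> (\<Sum>s\<in>S. w s * (J1 (fst s) * J2 (snd s)))" for S
    unfolding scale_sum_def sum_distrib_left
  proof (rule sum_mono)
    fix s
    have "((2 powr (- 2 * a1 - 1) * 2 powr (- 2 * b1)) * (d1 powr (- 2 * a1) * lac_scale (fst s) d1 powr (2 * a1)))
       * ((2 powr (- 2 * a2 - 1) * 2 powr (- 2 * b2)) * (d2 powr (- 2 * a2) * lac_scale (snd s) d2 powr (2 * a2)))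
      \<le> J1 (fst s) * J2 (snd s)"
      using J0(1) unfolding J1_def J2_def
      by (intro mult_mono scale_kernel_integral_lower \<alpha> \<beta> \<delta> mult_nonneg_nonneg) auto
    then have "w s * (((2 powr (- 2 * a1 - 1) * 2 powr (- 2 * b1)) * (d1 powr (- 2 * a1) * lac_scale (fst s) d1 powr (2 * a1)))
       * ((2 powr (- 2 * a2 - 1) * 2 powr (- 2 * b2)) * (d2 powr (- 2 * a2) * lac_scale (snd s) d2 powr (2 * a2))))
      \<le> w s * (J1 (fst s) * J2 (snd s))"
      using w by (rule mult_left_mono)
    then show "l * T * (w s * lac_scale (fst s) d1 powr (2 * a1) * lac_scale (snd s) d2 powr (2 * a2))
      \<le> w s * (J1 (fst s) * J2 (snd s))"
      unfolding l_def T_def by (simp only: mult_ac)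
  qed
  let ?V = "\<lambda>S t1. \<Sum>s\<in>S. w s * lac_scale (fst s) t1 powr (2 * b1) * J2 (snd s)"
  let ?F1 = "\<lambda>S t1. \<Sum>s\<in>S. w s * J2 (snd s) * scale_kernel a1 b1 (fst s) t1"
  let ?F2 = "\<lambda>S t1 t2. \<Sum>s\<in>S. w s * lac_scale (fst s) t1 powr (2 * b1) * scale_kernel a2 b2 (snd s) t2"
  note comb1 = scale_kernel_combination[OF \<beta>(1) \<delta>(1), where a = a1 and k = fst, folded k1_def J1_def, folded K1_def]
  note comb2 = scale_kernel_combination[OF \<beta>(2) \<delta>(3), where a = a2 and k = snd, folded k2_def J2_def, folded K2_def]
  have k2_sum: "k2 t2 * scale_sum w b1 b2 t1 t2 S
      = ?F2 S t1 t2" for t1 t2 S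
    unfolding scale_sum_def scale_kernel_def sum_distrib_left k2_def by (intro sum.cong refl) (simp only: mult_ac)
  have k1_sum: "k1 t1 * ?V S t1
      = ?F1 S t1" for t1 S
    unfolding scale_kernel_def sum_distrib_left k1_def by (intro sum.cong refl) (simp only: mult_ac)
  have sum_J: "(\<Sum>s\<in>S. w s * J2 (snd s) * J1 (fst s)) = (\<Sum>s\<in>S. w s * (J1 (fst s) * J2 (snd s)))" for S
    by (intro sum.cong refl) (simp only: mult_ac)
  show "(\<Omega>\<^sub>\<alpha> d1 d2)\<^sup>2 \<le> C\<^sup>2 / (l * T) * I"
  proof -
    have "scale_sum w a1 a2 d1 d2 S \<le> C / (l * T) * I" if S: "finite S" for S
    proof -
      have inner: "?V S t1 \<le> C * h t1" if t1: "t1 > 0" for t1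
      proof -
        \<comment> \<open>The zero multiple brings the integrand into the form of
          \<open>scale_kernel_combination\<close>.\<close>
        have "?V S t1
          = (LBINT t2:{d2<..<1}. ?F2 S t1 t2 + 0 * k2 t2)"
          unfolding comb2(2) by simp
        also have "\<dots> \<le> (LBINT t2:{d2<..<1}. C * (k2 t2 * g t1 t2))"
        proof (rule set_integral_mono[OF comb2(1) set_integrable_mult_right])
          show "set_integrable lborel {d2<..<1} (\<lambda>t2. k2 t2 * g t1 t2)" by (rule int2[OF t1])
          fix t2 assume "t2 \<in> {d2<..<1}"
          then have "t2 > 0" using \<delta> by auto
          then have "k2 t2 * scale_sum w b1 b2 t1 t2 S \<le> k2 t2 * (C * g t1 t2)"
            by (intro mult_left_mono g_lower t1 S kpos)
          then show "?F2 S t1 t2 + 0 * k2 t2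
             \<le> C * (k2 t2 * g t1 t2)"
            unfolding k2_sum by (simp add: mult.left_commute)
        qed
        also have "\<dots> = C * h t1" unfolding h_def by (rule set_integral_mult_right)
        finally show ?thesis .
      qed
      have "l * T * scale_sum w a1 a2 d1 d2 S \<le> (\<Sum>s\<in>S. w s * J2 (snd s) * J1 (fst s))"
        unfolding sum_J by (rule J_lower)
      also have "\<dots> = (LBINT t1:{d1<..<1}. ?F1 S t1 + 0 * k1 t1)"
        unfolding comb1(2) by simp
      also have "\<dots> \<le> (LBINT t1:{d1<..<1}. C * (k1 t1 * h t1))"
      proof (rule set_integral_mono[OF comb1(1) set_integrable_mult_right])
        show "set_integrable lborel {d1<..<1} (\<lambda>t1. k1 t1 * h t1)" by (rule int1)
        fix t1 assume "t1 \<in> {d1<..<1}"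
        then have "t1 > 0" using \<delta> by auto
        then have "k1 t1 * ?V S t1 \<le> k1 t1 * (C * h t1)"
          by (intro mult_left_mono inner kpos)
        then show "?F1 S t1 + 0 * k1 t1 \<le> C * (k1 t1 * h t1)"
          unfolding k1_sum by (simp add: mult.left_commute)
      qed
      also have "\<dots> = C * I" unfolding I_eq by (rule set_integral_mult_right)
      finally have "scale_sum w a1 a2 d1 d2 S * (l * T) \<le> C * I" by (simp only: mult_ac)
      then have "scale_sum w a1 a2 d1 d2 S \<le> C * I / (l * T)" using l T by (subst pos_le_divide_eq) auto
      then show ?thesis by simp
    qed
    then have "(\<Omega>\<^sub>\<alpha> d1 d2)\<^sup>2 \<le> C * (C / (l * T) * I)"
      using A \<delta> unfolding comparable_modulus_def by blast
    then show ?thesis by (simp add: power2_eq_square)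
  qed
  show "I \<le> C\<^sup>2 * U * T * (\<Omega>\<^sub>\<alpha> d1 d2)\<^sup>2"
  proof (rule field_le_epsilon)
    fix e :: real assume e: "e > 0"
    have K0: "K1 \<ge> 0" "K2 \<ge> 0"
      unfolding K1_def K2_def by (intro integral_nonneg integrable_continuous_real contk kpos)+
    \<comment> \<open>Integration multiplies the error by \<open>K1 * K2\<close> and the comparison
      by \<open>C\<close>; the summand 1 keeps the quotient defined.\<close>
    define \<epsilon> where "\<epsilon> = e / (C * K1 * K2 + 1)"
    have pos: "C * K1 * K2 + 1 > 0" using C K0 by (intro add_nonneg_pos mult_nonneg_nonneg) auto
    have \<epsilon>: "\<epsilon> > 0" unfolding \<epsilon>_def using e pos by simp
    obtain S where S: "finite S" and near: "\<And>t1 t2 S'. t1 > 0 \<Longrightarrow> t2 > 0 \<Longrightarrow> finite S' \<Longrightarrow>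
        scale_sum w b1 b2 t1 t2 S' \<le> scale_sum w b1 b2 t1 t2 S + \<epsilon>"
      using scale_sum_nearly_maximal[OF w B \<epsilon> \<beta>] by blast
    have inner: "h t1 \<le> C * (?V S t1 + \<epsilon> * K2)" if t1: "t1 > 0" for t1
    proof -
      have "h t1 \<le> (LBINT t2:{d2<..<1}. C * (?F2 S t1 t2 + \<epsilon> * k2 t2))"
        unfolding h_def
      proof (rule set_integral_mono[OF int2[OF t1] set_integrable_mult_right[OF comb2(1)]])
        fix t2 assume "t2 \<in> {d2<..<1}"
        then have t2: "t2 > 0" using \<delta> by auto
        have "k2 t2 * g t1 t2 \<le> k2 t2 * (C * (scale_sum w b1 b2 t1 t2 S + \<epsilon>))"
          by (intro mult_left_mono g_upper near t1 t2 kpos)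
        also have "\<dots> = C * (k2 t2 * scale_sum w b1 b2 t1 t2 S + \<epsilon> * k2 t2)" by (simp add: algebra_simps)
        finally show "k2 t2 * g t1 t2 \<le> C * (?F2 S t1 t2 + \<epsilon> * k2 t2)"
          unfolding k2_sum .
      qed
      also have "\<dots> = C * (LBINT t2:{d2<..<1}. ?F2 S t1 t2 + \<epsilon> * k2 t2)"
        by (rule set_integral_mult_right)
      finally show ?thesis unfolding comb2(2) .
    qed
    have "I \<le> (LBINT t1:{d1<..<1}. C * (?F1 S t1 + \<epsilon> * K2 * k1 t1))"
      unfolding I_eq
    proof (rule set_integral_mono[OF int1 set_integrable_mult_right[OF comb1(1)]])
      fix t1 assume "t1 \<in> {d1<..<1}"
      then have t1: "t1 > 0" using \<delta> by auto
      have "k1 t1 * h t1 \<le> k1 t1 * (C * (?V S t1 + \<epsilon> * K2))"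
        by (intro mult_left_mono inner t1 kpos)
      also have "\<dots> = C * (k1 t1 * ?V S t1 + \<epsilon> * K2 * k1 t1)"
        by (simp only: distrib_left mult_ac)
      finally show "k1 t1 * h t1 \<le> C * (?F1 S t1 + \<epsilon> * K2 * k1 t1)"
        unfolding k1_sum .
    qed
    also have "\<dots> = C * (LBINT t1:{d1<..<1}. ?F1 S t1 + \<epsilon> * K2 * k1 t1)"
      by (rule set_integral_mult_right)
    also have "\<dots> = C * ((\<Sum>s\<in>S. w s * (J1 (fst s) * J2 (snd s))) + \<epsilon> * K2 * K1)"
      unfolding comb1(2) sum_J ..
    also have "\<dots> \<le> C * (U * T * (C * (\<Omega>\<^sub>\<alpha> d1 d2)\<^sup>2) + \<epsilon> * K2 * K1)"
    proof -
      have "scale_sum w a1 a2 d1 d2 S \<le> C * (\<Omega>\<^sub>\<alpha> d1 d2)\<^sup>2"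
        using A \<delta> S unfolding comparable_modulus_def by blast
      moreover have "U * T \<ge> 0" unfolding U_def using T \<alpha> by (intro mult_nonneg_nonneg) auto
      ultimately have "U * T * scale_sum w a1 a2 d1 d2 S \<le> U * T * (C * (\<Omega>\<^sub>\<alpha> d1 d2)\<^sup>2)"
        by (rule mult_left_mono)
      then show ?thesis using J_upper[of S] C by (intro mult_left_mono add_right_mono) auto
    qed
    also have "\<dots> = C\<^sup>2 * U * T * (\<Omega>\<^sub>\<alpha> d1 d2)\<^sup>2 + \<epsilon> * (C * K1 * K2)"
      by (simp add: power2_eq_square algebra_simps)
    also have "\<epsilon> * (C * K1 * K2) \<le> e"
    proof -
      have "\<epsilon> * (C * K1 * K2) \<le> \<epsilon> * (C * K1 * K2 + 1)" using \<epsilon> by (intro mult_left_mono) auto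
      also have "\<dots> = e" unfolding \<epsilon>_def using pos by simp
      finally show ?thesis .
    qed
    finally show "I \<le> C\<^sup>2 * U * T * (\<Omega>\<^sub>\<alpha> d1 d2)\<^sup>2 + e" by simp
  qed
qed

theorem theorem10p3:
  fixes p \<alpha>\<^sub>1 \<alpha>\<^sub>2 \<beta>\<^sub>1 \<beta>\<^sub>2 :: real
  assumes "1 < p" and "0 < \<alpha>\<^sub>1" "\<alpha>\<^sub>1 < \<beta>\<^sub>1" and "0 < \<alpha>\<^sub>2" "\<alpha>\<^sub>2 < \<beta>\<^sub>2"
  shows "\<exists>C>0. \<forall>f \<in> Lambda_class p. \<forall>\<delta>\<^sub>1 \<in> {0<..<1/2}. \<forall>\<delta>\<^sub>2 \<in> {0<..<1/2}.
    (let A = mixed_modulus p \<alpha>\<^sub>1 \<alpha>\<^sub>2 f \<delta>\<^sub>1 \<delta>\<^sub>2;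
         B = \<delta>\<^sub>1 powr \<alpha>\<^sub>1 * \<delta>\<^sub>2 powr \<alpha>\<^sub>2 *
             sqrt (LBINT t\<^sub>1:{\<delta>\<^sub>1<..<1}. (LBINT t\<^sub>2:{\<delta>\<^sub>2<..<1}.
               (t\<^sub>1 powr (-\<alpha>\<^sub>1) * t\<^sub>2 powr (-\<alpha>\<^sub>2) * mixed_modulus p \<beta>\<^sub>1 \<beta>\<^sub>2 f t\<^sub>1 t\<^sub>2)\<^sup>2 / t\<^sub>2) / t\<^sub>1)
     in inverse C * B \<le> A \<and> A \<le> C * B)"
proof -
  have \<beta>: "\<beta>\<^sub>1 > 0" "\<beta>\<^sub>2 > 0" using assms by auto
  from mixed_modulus_comparison[OF assms(1,2,4) \<beta>] obtain C where C: "C > 0" and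
    cmp: "\<forall>f\<in>Lambda_class p. \<exists>w B. (\<forall>s. w s \<ge> 0) \<and> (\<forall>S. finite S \<longrightarrow> sum w S \<le> B) \<and>
    comparable_modulus C w \<alpha>\<^sub>1 \<alpha>\<^sub>2 (mixed_modulus p \<alpha>\<^sub>1 \<alpha>\<^sub>2 f) \<and>
    comparable_modulus C w \<beta>\<^sub>1 \<beta>\<^sub>2 (mixed_modulus p \<beta>\<^sub>1 \<beta>\<^sub>2 f)"
    by (elim exE conjE)
  define U where "U = (1 / (2 * (\<beta>\<^sub>1 - \<alpha>\<^sub>1)) + 1 / (2 * \<alpha>\<^sub>1)) * (1 / (2 * (\<beta>\<^sub>2 - \<alpha>\<^sub>2)) + 1 / (2 * \<alpha>\<^sub>2))"
  define l where "l = (2 powr (- 2 * \<alpha>\<^sub>1 - 1) * 2 powr (- 2 * \<beta>\<^sub>1)) * (2 powr (- 2 * \<alpha>\<^sub>2 - 1) * 2 powr (- 2 * \<beta>\<^sub>2))"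
  \<comment> \<open>The estimates compare squares, with constants \<open>C\<^sup>2 * U\<close> and
    \<open>C\<^sup>2 / l\<close>; the root passes to the quantities themselves.\<close>
  define D where "D = sqrt (max (C\<^sup>2 * U) (C\<^sup>2 / l))"
  have "C\<^sup>2 / l > 0" using C unfolding l_def by simp
  then have D: "D > 0" unfolding D_def by (simp add: less_max_iff_disj)
  have D2: "C\<^sup>2 * U \<le> D\<^sup>2" "C\<^sup>2 / l \<le> D\<^sup>2"
    unfolding D_def using \<open>C\<^sup>2 / l > 0\<close> by (simp_all add: le_max_iff_disj)
  show ?thesis
  proof (intro exI[of _ D] conjI D ballI)
    fix f and \<delta>\<^sub>1 \<delta>\<^sub>2 :: real assume f: "f \<in> Lambda_class p" and "\<delta>\<^sub>1 \<in> {0<..<1/2}" "\<delta>\<^sub>2 \<in> {0<..<1/2::real}"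
    then have \<delta>: "0 < \<delta>\<^sub>1" "\<delta>\<^sub>1 < 1 / 2" "0 < \<delta>\<^sub>2" "\<delta>\<^sub>2 < 1 / 2" by auto
    from bspec[OF cmp f] obtain w B where w: "\<forall>s. w s \<ge> 0" and B: "\<forall>S. finite S \<longrightarrow> sum w S \<le> B"
      and a: "comparable_modulus C w \<alpha>\<^sub>1 \<alpha>\<^sub>2 (mixed_modulus p \<alpha>\<^sub>1 \<alpha>\<^sub>2 f)"
      and b: "comparable_modulus C w \<beta>\<^sub>1 \<beta>\<^sub>2 (mixed_modulus p \<beta>\<^sub>1 \<beta>\<^sub>2 f)" by (elim exE conjE)
    define I where "I = (LBINT t\<^sub>1:{\<delta>\<^sub>1<..<1}. (LBINT t\<^sub>2:{\<delta>\<^sub>2<..<1}.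
               (t\<^sub>1 powr (-\<alpha>\<^sub>1) * t\<^sub>2 powr (-\<alpha>\<^sub>2) * mixed_modulus p \<beta>\<^sub>1 \<beta>\<^sub>2 f t\<^sub>1 t\<^sub>2)\<^sup>2 / t\<^sub>2) / t\<^sub>1)"
    define A where "A = mixed_modulus p \<alpha>\<^sub>1 \<alpha>\<^sub>2 f \<delta>\<^sub>1 \<delta>\<^sub>2"
    define P where "P = \<delta>\<^sub>1 powr \<alpha>\<^sub>1 * \<delta>\<^sub>2 powr \<alpha>\<^sub>2"
    define T where "T = \<delta>\<^sub>1 powr (- 2 * \<alpha>\<^sub>1) * \<delta>\<^sub>2 powr (- 2 * \<alpha>\<^sub>2)"
    note eq = modulus_integral_equivalence[OF assms(2-5) C w[rule_format] B[rule_format] a b \<delta>,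
        folded I_def U_def l_def, folded T_def A_def]
    have P: "P > 0" unfolding P_def using \<delta> by simp
    have PT: "P\<^sup>2 * T = 1"
    proof -
      have "(t powr x)\<^sup>2 * t powr (- 2 * x) = 1" if "t > 0" for t x :: real
        using that by (simp add: power2_eq_square powr_add[symmetric])
      from this[OF \<delta>(1), of \<alpha>\<^sub>1] this[OF \<delta>(3), of \<alpha>\<^sub>2]
      have "((\<delta>\<^sub>1 powr \<alpha>\<^sub>1)\<^sup>2 * \<delta>\<^sub>1 powr (- 2 * \<alpha>\<^sub>1)) * ((\<delta>\<^sub>2 powr \<alpha>\<^sub>2)\<^sup>2 * \<delta>\<^sub>2 powr (- 2 * \<alpha>\<^sub>2)) = 1 * 1" by (simp only:)
      then show ?thesis unfolding P_def T_def power_mult_distrib by (simp only: mult_ac mult_1_left)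
    qed
    have T: "T > 0" unfolding T_def using \<delta> by simp
    have A0: "A \<ge> 0" using a \<delta> unfolding A_def comparable_modulus_def by blast
    have "(P * sqrt I)\<^sup>2 = P\<^sup>2 * I" using eq(3) by (simp add: power_mult_distrib)
    also have "\<dots> \<le> P\<^sup>2 * (C\<^sup>2 * U * T * A\<^sup>2)" by (intro mult_left_mono eq(1)) auto
    also have "\<dots> = C\<^sup>2 * U * A\<^sup>2 * (P\<^sup>2 * T)" by (simp only: mult_ac)
    also have "\<dots> \<le> D\<^sup>2 * A\<^sup>2" unfolding PT using D2(1) by (simp add: mult_right_mono)
    finally have "(P * sqrt I)\<^sup>2 \<le> (D * A)\<^sup>2" by (simp only: power_mult_distrib)
    then have 1: "P * sqrt I \<le> D * A" by (rule power2_le_imp_le) (use D A0 in simp)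
    have "A\<^sup>2 \<le> C\<^sup>2 / (l * T) * I" by (rule eq(2))
    also have "\<dots> = C\<^sup>2 / l * (1 / T) * I" by simp
    also have "1 / T = P\<^sup>2" using PT T by (simp add: field_simps)
    also have "C\<^sup>2 / l * P\<^sup>2 * I \<le> D\<^sup>2 * P\<^sup>2 * I" using D2(2) eq(3) by (intro mult_right_mono) auto
    also have "\<dots> = (D * (P * sqrt I))\<^sup>2" using eq(3) by (simp add: power_mult_distrib)
    finally have 2: "A \<le> D * (P * sqrt I)" by (rule power2_le_imp_le) (use D P eq(3) in simp)
    have "inverse D * (P * sqrt I) \<le> A" using 1 D by (simp add: field_simps)
    with 2 show "let A = mixed_modulus p \<alpha>\<^sub>1 \<alpha>\<^sub>2 f \<delta>\<^sub>1 \<delta>\<^sub>2;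
         B = \<delta>\<^sub>1 powr \<alpha>\<^sub>1 * \<delta>\<^sub>2 powr \<alpha>\<^sub>2 *
             sqrt (LBINT t\<^sub>1:{\<delta>\<^sub>1<..<1}. (LBINT t\<^sub>2:{\<delta>\<^sub>2<..<1}.
               (t\<^sub>1 powr (-\<alpha>\<^sub>1) * t\<^sub>2 powr (-\<alpha>\<^sub>2) * mixed_modulus p \<beta>\<^sub>1 \<beta>\<^sub>2 f t\<^sub>1 t\<^sub>2)\<^sup>2 / t\<^sub>2) / t\<^sub>1)
     in inverse D * B \<le> A \<and> A \<le> D * B"
      unfolding Let_def I_def[symmetric] A_def[symmetric] P_def[symmetric] by blast
  qed
qed

end
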